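(* Let $k\ge 1$ be a constant integer, $\alpha>1$ a constant, $m=n^{\alpha}$, and let $\omega=\omega(n)$ be a real-valued function of $n$. For an integer $j\ge1$ put $$ p_j=p_j(n)=\sqrt{\frac{\ln n+(j-1)\ln\ln n+\omega}{mn}}, $$ where $\omega$ is such that the probabilities $p_j$ used below are well defined and lie in $[0,1]$. Then, as $n\to\infty$: (i) if $\omega\to-\infty$, then with probability tending to $1$ the random intersection graph $\mathcal{G}(n,m,p_k)$ is not $k$-connected; (ii) if $\omega\to\infty$, then with probability tending to $1$ the random intersection graph $\mathcal{G}(n,m,p_k)$ is $k$-connected; (i') if $\omega\to-\infty$, then with probability tending to $1$ the random intersection graph $\mathcal{G}(n,m,p_2)$ does not contain a Hamilton cycle; (ii') if $\omega\to\infty$, then with probability tending to $1$ the random intersection graph $\mathcal{G}(n,m,p_2)$ contains a Hamilton cycle.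
   Context: The random intersection graph $\mathcal{G}(n,m,p)$ is defined as follows. Let $\mathcal{V}$ be a set of $n$ vertices and $\mathcal{W}$ an auxiliary set of $m$ features. Each vertex $v\in\mathcal{V}$ is assigned a random subset $W_v\subseteq\mathcal{W}$, where each feature $w\in\mathcal{W}$ belongs to $W_v$ with probability $p$, independently over all pairs $(v,w)$. Two distinct vertices $v_1,v_2$ are adjacent if and only if $W_{v_1}\cap W_{v_2}\neq\emptyset$. All limits are taken as $n\to\infty$. "$k$-connected" means $k$-vertex-connected. *)

theory Defs
  imports "HOL-Probability.Probability" "Graph_Theory.Digraph_Component"
begin

text \<open>
  An undirected simple graph is a symmetric loop-free digraph without parallel arcs
  (locale \<^term>\<open>pair_graph\<close>): each edge is represented by its two orientations.
\<close>

definition intersection_graph :: "'v set \<Rightarrow> ('v \<Rightarrow> 'w set) \<Rightarrow> 'v pair_pre_digraph" where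
  "intersection_graph V W =
     \<lparr>pverts = V, parcs = {(u, v). u \<in> V \<and> v \<in> V \<and> u \<noteq> v \<and> W u \<inter> W v \<noteq> {}}\<rparr>"

lemma pair_graph_intersection_graph:
  assumes "finite V"
  shows "pair_graph (intersection_graph V W)"
proof
  show "finite (parcs (intersection_graph V W))"
    by (rule finite_subset[of _ "V \<times> V"]) (auto simp: intersection_graph_def assms)
  show "symmetric (with_proj (intersection_graph V W))"
    by (auto simp: symmetric_def arcs_ends_def arc_to_ends_def intersection_graph_def sym_def)
qed (auto simp: intersection_graph_def assms)

text \<open>
  \<open>X (v, w)\<close> is the indicator of the event that vertex \<open>v < n\<close> has feature \<open>w < m\<close>.
  Note that \<^term>\<open>bernoulli_pmf p\<close> is only meaningful for \<open>p \<in> {0..1}\<close>.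
\<close>
definition random_intersection_graph :: "nat \<Rightarrow> nat \<Rightarrow> real \<Rightarrow> nat pair_pre_digraph pmf" where
  "random_intersection_graph n m p =
     map_pmf (\<lambda>X. intersection_graph {..<n} (\<lambda>v. {w \<in> {..<m}. X (v, w)}))
       (Pi_pmf ({..<n} \<times> {..<m}) False (\<lambda>_. bernoulli_pmf p))"

text \<open>
  More than \<open>k\<close> vertices, and no removal of fewer than \<open>k\<close> vertices disconnects the graph.
  (The qualified name distinguishes graph connectedness from the topological notion.)
\<close>
definition k_connected :: "nat \<Rightarrow> ('a, 'b) pre_digraph \<Rightarrow> bool" where
  "k_connected k G \<longleftrightarrow> k < card (verts G) \<and>
     (\<forall>S \<subseteq> verts G. card S < k \<longrightarrow>
        Digraph_Component.connected (induce_subgraph G (verts G - S)))"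

text \<open>
  The bound on the length excludes traversing a single edge back and forth, which is a
  directed cycle of the symmetric digraph but not a cycle of the undirected graph.
\<close>
definition has_hamilton_cycle :: "('a, 'b) pre_digraph \<Rightarrow> bool" where
  "has_hamilton_cycle G \<longleftrightarrow>
     (\<exists>c. pre_digraph.cycle G c \<and> 3 \<le> length c \<and> tail G ` set c = verts G)"

text \<open>
  The real square root of the library is odd, so for \<open>n \<ge> 2\<close> and \<open>m n > 0\<close> the condition
  \<open>0 \<le> threshold_prob m \<omega> j n\<close> says exactly that the radicand is nonnegative.
\<close>
definition threshold_prob :: "(nat \<Rightarrow> nat) \<Rightarrow> (nat \<Rightarrow> real) \<Rightarrow> nat \<Rightarrow> nat \<Rightarrow> real" where
  "threshold_prob m \<omega> j n =
     sqrt ((ln (real n) + (real j - 1) * ln (ln (real n)) + \<omega> n) / (real (m n) * real n))"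

end

theory Submission
  imports Defs "HOL-Real_Asymp.Real_Asymp"
begin

text \<open>The graph is a union of cliques on independent random vertex sets, one for each feature, and
  everything is done on these sets directly. Put \<open>L = m n p\<^sup>2\<close>.

  Below the threshold, the second moment method produces a vertex of degree less than \<open>k\<close>.

  Above the threshold, let \<open>S\<close> be a minimal set with few neighbours (fewer than \<open>k\<close>, or fewer than
  \<open>2 |S|\<close>) and let \<open>T\<close> be the set of these neighbours. By minimality \<open>S \<union> T\<close> is connected through the
  features that meet \<open>S\<close>, so their sizes minus one add up to at least \<open>|S \<union> T| - 1\<close>, while none of them
  contains a vertex outside of \<open>S \<union> T\<close>. An exponential moment bounds the probability of this by
  roughly \<open>(|S \<union> T| L / n)\<close> to the power \<open>|S \<union> T| - 1\<close> times \<open>exp (- |S| L)\<close>, which is small enough for a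
  union bound over \<open>S\<close> and \<open>T\<close>.

  For the Hamilton cycle a small part of the features is set aside. The others already make the graph a
  connected graph in which every set \<open>S\<close> of at most \<open>n / 30\<close> vertices has at least \<open>2 |S|\<close> neighbours. By
  Posa's rotations such a graph is Hamiltonian or has quadratically many boosters, i.e. pairs whose
  addition makes it Hamiltonian or lengthens its longest path. A feature that was set aside contains a
  booster with probability of order \<open>n\<^sup>2 p\<^sup>2\<close>, and there are so many of them that \<open>n\<close> improvements occur.\<close>

subsection \<open>Random features\<close>

text \<open>That no feature leads from \<open>S\<close> out of \<open>S \<union> T\<close> costs
  only about \<open>exp (- |S| L)\<close>, roughly \<open>n\<close> to the power
  \<open>- |S|\<close>, against \<open>n\<close> to the power \<open>|S \<union> T|\<close> choices
  of the sets. Connectedness has to supply the missing factor, and the sizes minus one express it as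
  a sum over independent features.

  After the union bound a single factor \<open>n\<close> survives. Singletons \<open>S\<close> give
  \<open>n * L ^ (k - 1) * exp (- L)\<close>, the order of the expected number of vertices of degree
  below \<open>k\<close>, and this fixes the threshold; larger sets have to be of lower order.

  The main role of \<open>\<alpha> > 1\<close> is
  \<open>L * (n p) \<longlonglongrightarrow> 0\<close>: features with more than two vertices are so
  rare that they change the exponents by bounded amounts only. An arbitrary \<open>\<omega>\<close>
  is first truncated to \<open>|\<omega>| \<le> ln (ln n)\<close>, by monotonicity in
  \<open>p\<close>, which confines \<open>L\<close> to the order of \<open>ln n\<close>.\<close>

definition random_subset :: "nat \<Rightarrow> real \<Rightarrow> nat set pmf" where
  "random_subset n p =
     map_pmf (\<lambda>X. {v \<in> {..<n}. X v}) (Pi_pmf {..<n} False (\<lambda>_. bernoulli_pmf p))"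

text \<open>The random matrix is read by columns: the vertex sets of the features are independent
  and identically distributed, and the events to be estimated factor over features, not over
  vertices.\<close>

definition features :: "nat \<Rightarrow> nat \<Rightarrow> real \<Rightarrow> (nat \<Rightarrow> nat set) pmf" where
  "features n m p = Pi_pmf {..<m} {} (\<lambda>_. random_subset n p)"

abbreviation "feature_prob n m p \<equiv> measure_pmf.prob (features n m p)"
abbreviation "subset_prob n p \<equiv> measure_pmf.prob (random_subset n p)"
abbreviation "subset_expectation n p \<equiv> measure_pmf.expectation (random_subset n p)"

lemma set_random_subset: "A \<in> set_pmf (random_subset n p) \<Longrightarrow> A \<subseteq> {..<n}"
  by (auto simp: random_subset_def)

lemma finite_set_random_subset [simp]: "finite (set_pmf (random_subset n p))"
  by (rule finite_subset[of _ "Pow {..<n}"]) (auto dest: set_random_subset)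

lemma set_features: "F \<in> set_pmf (features n m p) \<Longrightarrow> F w \<subseteq> {..<n}"
  using set_Pi_pmf_subset'[of "{..<m}" "{}" "\<lambda>_. random_subset n p"]
  by (cases "w < m") (auto simp: features_def PiE_dflt_def dest!: set_random_subset)

lemma finite_set_features [simp]: "finite (set_pmf (features n m p))"
proof (rule finite_subset)
  show "set_pmf (features n m p) \<subseteq> PiE_dflt {..<m} {} (\<lambda>_. set_pmf (random_subset n p))"
    using set_Pi_pmf_subset'[of "{..<m}" "{}" "\<lambda>_. random_subset n p"]
    by (simp add: features_def o_def)
qed auto

lemma integrable_random_subset [simp]:
  fixes f :: "nat set \<Rightarrow> real"
  shows "integrable (measure_pmf (random_subset n p)) f"
  by (rule integrable_measure_pmf_finite) simp

lemma integrable_features [simp]: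
  fixes f :: "(nat \<Rightarrow> nat set) \<Rightarrow> real"
  shows "integrable (measure_pmf (features n m p)) f"
  by (rule integrable_measure_pmf_finite) simp

lemma expectation_prod_features:
  fixes f :: "nat \<Rightarrow> nat set \<Rightarrow> real"
  assumes "\<And>w A. f w A \<ge> 0"
  shows "measure_pmf.expectation (features n m p) (\<lambda>F. \<Prod>w<m. f w (F w)) =
         (\<Prod>w<m. subset_expectation n p (f w))"
  unfolding features_def using assms by (subst expectation_prod_Pi_pmf) auto

lemma expectation_random_subset_prod:
  fixes g :: "nat \<Rightarrow> bool \<Rightarrow> real"
  assumes "\<And>v b. g v b \<ge> 0" and p: "0 \<le> p" "p \<le> 1"
  shows "subset_expectation n p (\<lambda>A. \<Prod>v<n. g v (v \<in> A)) =
         (\<Prod>v<n. p * g v True + (1 - p) * g v False)"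
proof -
  have "subset_expectation n p (\<lambda>A. \<Prod>v<n. g v (v \<in> A)) =
        measure_pmf.expectation (Pi_pmf {..<n} False (\<lambda>_. bernoulli_pmf p)) (\<lambda>X. \<Prod>v<n. g v (X v))"
    unfolding random_subset_def integral_map_pmf by (intro arg_cong[where f = "integral\<^sup>L _"] ext prod.cong) auto
  also have "\<dots> = (\<Prod>v<n. measure_pmf.expectation (bernoulli_pmf p) (g v))"
    using assms by (subst expectation_prod_Pi_pmf) (auto intro: integrable_measure_pmf_finite)
  also have "\<dots> = (\<Prod>v<n. p * g v True + (1 - p) * g v False)"
    using p by (intro prod.cong) auto
  finally show ?thesis .
qed

text \<open>Induction on \<open>m\<close> splits off the column of the entries
  \<open>(v, m)\<close>, which is independent of the earlier ones. Outside the index set both sides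
  agree, because the default \<open>False\<close> makes the set of such a feature empty, which is
  the default of \<open>features\<close>.\<close>

lemma Pi_pmf_curry:
  "map_pmf (\<lambda>X w. {v \<in> {..<n}. X (v, w)}) (Pi_pmf ({..<n} \<times> {..<m}) False (\<lambda>_. bernoulli_pmf p))
     = features n m p"
proof (induction m)
  case 0
  show ?case by (simp add: features_def)
next
  case (Suc m)
  let ?b = "\<lambda>_. bernoulli_pmf p"
  have eq: "{..<n} \<times> {..<Suc m} = ({..<n} \<times> {m}) \<union> ({..<n} \<times> {..<m})" by (auto simp: less_Suc_eq)
  have 1: "Pi_pmf {..<n} False ?b = map_pmf (\<lambda>g. g \<circ> (\<lambda>v. (v, m))) (Pi_pmf ({..<n} \<times> {m}) False ?b)"
    by (rule Pi_pmf_bij_betw) (auto simp: bij_betw_def inj_on_def)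
  have "map_pmf (\<lambda>X w. {v \<in> {..<n}. X (v, w)}) (Pi_pmf ({..<n} \<times> {..<Suc m}) False ?b) =
     map_pmf (\<lambda>(f, g) w. {v \<in> {..<n}. if w = m then f (v, w) else w < m \<and> g (v, w)})
      (pair_pmf (Pi_pmf ({..<n} \<times> {m}) False ?b) (Pi_pmf ({..<n} \<times> {..<m}) False ?b))"
    unfolding eq
    apply (subst Pi_pmf_union)
       apply simp
      apply simp
     apply force
    unfolding pmf.map_comp
    apply (rule map_pmf_cong[OF refl])
    apply (auto simp: fun_eq_iff set_eq_iff split: if_splits)
    subgoal for f g v w
      using set_Pi_pmf_subset[of "{..<n} \<times> {..<m}" False ?b]
      by (auto)
    subgoal for f g v w
      using set_Pi_pmf_subset[of "{..<n} \<times> {..<m}" False ?b]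
      by (auto)
    done
  also have "\<dots> = map_pmf (\<lambda>(y, F). F(m := y)) (pair_pmf 
      (map_pmf (\<lambda>f. {v \<in> {..<n}. f (v, m)}) (Pi_pmf ({..<n} \<times> {m}) False ?b))
      (map_pmf (\<lambda>X w. {v \<in> {..<n}. X (v, w)}) (Pi_pmf ({..<n} \<times> {..<m}) False ?b)))"
    unfolding pair_map_pmf1 pair_map_pmf2 pmf.map_comp
    apply (rule map_pmf_cong[OF refl])
    apply (auto simp: fun_eq_iff set_eq_iff split: if_splits)
    subgoal for f g w v
      using set_Pi_pmf_subset[of "{..<n} \<times> {..<m}" False ?b]
      by (auto)
    done
  also have "map_pmf (\<lambda>f. {v \<in> {..<n}. f (v, m)}) (Pi_pmf ({..<n} \<times> {m}) False ?b) = random_subset n p"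
    unfolding random_subset_def 1 pmf.map_comp by (simp add: o_def)
  also have "pair_pmf (random_subset n p) (map_pmf (\<lambda>X w. {v \<in> {..<n}. X (v, w)})
      (Pi_pmf ({..<n} \<times> {..<m}) False ?b)) = pair_pmf (random_subset n p) (features n m p)"
    unfolding Suc ..
  also have "map_pmf (\<lambda>(y, F). F(m := y)) \<dots> = features n (Suc m) p"
    unfolding features_def lessThan_Suc by (rule Pi_pmf_insert[symmetric]) auto
  finally show ?case .
qed

lemma random_intersection_graph_features:
  "random_intersection_graph n m p =
     map_pmf (\<lambda>F. intersection_graph {..<n} (\<lambda>v. {w \<in> {..<m}. v \<in> F w})) (features n m p)"
  unfolding random_intersection_graph_def Pi_pmf_curry[symmetric] pmf.map_comp
  by (intro map_pmf_cong refl) (auto simp: intersection_graph_def)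

lemma prob_eq_expectation_indicator:
  "measure_pmf.prob M A = measure_pmf.expectation M (indicator A :: _ \<Rightarrow> real)"
  by simp

text \<open>An induction over the coordinates takes the place of a coupling: conditioning on
  coordinate \<open>i\<close> makes the expectation a mixture of two expectations over
  \<open>I\<close>. The parameter of the other coordinates is raised first, by the induction
  hypothesis, then that of \<open>i\<close>, which moves weight to the larger of the two.\<close>

lemma expectation_Pi_bernoulli_mono:
  fixes f :: "('a \<Rightarrow> bool) \<Rightarrow> real"
  assumes "finite I" and mono: "\<And>X Y. (\<And>i. X i \<longrightarrow> Y i) \<Longrightarrow> f X \<le> f Y"
    and p: "0 \<le> p" "p \<le> p'" "p' \<le> 1"
  shows "measure_pmf.expectation (Pi_pmf I False (\<lambda>_. bernoulli_pmf p)) f \<le>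
         measure_pmf.expectation (Pi_pmf I False (\<lambda>_. bernoulli_pmf p')) f"
  using assms(1,2)
proof (induction arbitrary: f rule: finite_induct)
  case empty
  then show ?case by simp
next
  case (insert i I)
  have fin: "finite (set_pmf (Pi_pmf I False (\<lambda>_. bernoulli_pmf q)))" for q :: real
    by (rule finite_subset[OF set_Pi_pmf_subset'[OF insert.hyps(1)]])
      (intro finite_PiE_dflt insert.hyps, simp)
  have E: "measure_pmf.expectation (Pi_pmf (insert i I) False (\<lambda>_. bernoulli_pmf q)) f =
     q * measure_pmf.expectation (Pi_pmf I False (\<lambda>_. bernoulli_pmf q)) (\<lambda>X. f (X(i := True))) +
     (1 - q) * measure_pmf.expectation (Pi_pmf I False (\<lambda>_. bernoulli_pmf q)) (\<lambda>X. f (X(i := False)))"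
    if "0 \<le> q" "q \<le> 1" for q
  proof -
    have "measure_pmf.expectation (Pi_pmf (insert i I) False (\<lambda>_. bernoulli_pmf q)) f =
      measure_pmf.expectation (bind_pmf (bernoulli_pmf q) (\<lambda>y. map_pmf (\<lambda>X. X(i := y)) (Pi_pmf I False (\<lambda>_. bernoulli_pmf q)))) f"
      using insert.hyps by (simp add: Pi_pmf_insert' map_pmf_def)
    also have "\<dots> = measure_pmf.expectation (bernoulli_pmf q) (\<lambda>y. measure_pmf.expectation
         (map_pmf (\<lambda>X. X(i := y)) (Pi_pmf I False (\<lambda>_. bernoulli_pmf q))) f)"
      using fin by (subst pmf_expectation_bind[of UNIV]) (auto simp: integral_measure_pmf[of UNIV])
    finally show ?thesis using that by simp
  qed
  let ?E = "\<lambda>q f. measure_pmf.expectation (Pi_pmf I False (\<lambda>_. bernoulli_pmf q)) f"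
  have ih: "?E p (\<lambda>X. f (X(i := b))) \<le> ?E p' (\<lambda>X. f (X(i := b)))" for b
    by (rule insert.IH) (auto intro: insert.prems)
  have ft: "?E p' (\<lambda>X. f (X(i := False))) \<le> ?E p' (\<lambda>X. f (X(i := True)))"
    by (intro integral_mono integrable_measure_pmf_finite fin) (auto intro: insert.prems)
  have "p * ?E p (\<lambda>X. f (X(i := True))) + (1 - p) * ?E p (\<lambda>X. f (X(i := False))) \<le>
        p * ?E p' (\<lambda>X. f (X(i := True))) + (1 - p) * ?E p' (\<lambda>X. f (X(i := False)))"
    using p by (intro add_mono mult_left_mono ih) auto
  also have "\<dots> \<le> p' * ?E p' (\<lambda>X. f (X(i := True))) + (1 - p') * ?E p' (\<lambda>X. f (X(i := False)))"
    using mult_right_mono[OF ft, of "p' - p"] p by (simp add: algebra_simps)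
  finally show ?case using p E by simp
qed

text \<open>This is what allows \<open>\<omega>\<close> to be truncated: an increasing property is
  compared with the same property at a parameter for which \<open>L\<close> is of order
  \<open>ln n\<close>.\<close>

lemma prob_features_mono:
  assumes "\<And>F F'. (\<And>w. F w \<subseteq> F' w) \<Longrightarrow> (\<And>w. F' w \<subseteq> {..<n}) \<Longrightarrow> P F \<Longrightarrow> P F'"
    and p: "0 \<le> p" "p \<le> p'" "p' \<le> 1"
  shows "feature_prob n m p {F. P F} \<le> feature_prob n m p' {F. P F}"
proof -
  let ?c = "\<lambda>X w. {v \<in> {..<n}. X (v, w)}"
  have *: "feature_prob n m q {F. P F} =
      measure_pmf.expectation (Pi_pmf ({..<n} \<times> {..<m}) False (\<lambda>_. bernoulli_pmf q))
       (\<lambda>X. indicator {F. P F} (?c X) :: real)" for q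
    unfolding prob_eq_expectation_indicator Pi_pmf_curry[symmetric] integral_map_pmf ..
  have "indicator {F. P F} (?c X) \<le> (indicator {F. P F} (?c Y) :: real)"
    if "\<And>i. X i \<longrightarrow> Y i" for X Y
    using assms(1)[of "?c X" "?c Y"] that by (fastforce simp: indicator_def)
  then show ?thesis
    unfolding * by (intro expectation_Pi_bernoulli_mono p) simp_all
qed

subsection \<open>Sets with few neighbours\<close>

definition nbrs :: "'a set \<Rightarrow> ('a \<Rightarrow> 'a \<Rightarrow> bool) \<Rightarrow> 'a set \<Rightarrow> 'a set" where
  "nbrs V E S = {v \<in> V - S. \<exists>u\<in>S. E u v}"

definition adj :: "nat \<Rightarrow> (nat \<Rightarrow> 'a set) \<Rightarrow> 'a \<Rightarrow> 'a \<Rightarrow> bool" where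
  "adj m F u v \<longleftrightarrow> u \<noteq> v \<and> (\<exists>w<m. u \<in> F w \<and> v \<in> F w)"

lemma adj_sym: "adj m F u v \<longleftrightarrow> adj m F v u"
  by (auto simp: adj_def)

lemma adj_mono: "adj m F u v \<Longrightarrow> (\<And>w. F w \<subseteq> F' w) \<Longrightarrow> adj m F' u v"
  unfolding adj_def by blast

lemma nbrs_subset: "nbrs V E S \<subseteq> V - S"
  by (auto simp: nbrs_def)

lemma finite_nbrs: "finite V \<Longrightarrow> finite (nbrs V E S)"
  by (rule finite_subset[OF nbrs_subset]) auto

lemma nbrs_mono: "(\<And>u v. E u v \<Longrightarrow> E' u v) \<Longrightarrow> nbrs V E S \<subseteq> nbrs V E' S"
  by (auto simp: nbrs_def)

text \<open>The analogue for connected hypergraphs of the number of edges of a spanning tree. A set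
  that starts as one point grows by sets \<open>F i\<close> that cross its boundary; each of them
  shares a point with it and so adds at most its size minus one.\<close>

lemma card_le_sum_crossing:
  fixes F :: "'i \<Rightarrow> 'a set"
  assumes fin: "finite I" "finite R" and "R \<noteq> {}" and sub: "\<And>i. i \<in> I \<Longrightarrow> F i \<subseteq> R"
    and cross: "\<And>C. C \<noteq> {} \<Longrightarrow> C \<subset> R \<Longrightarrow> \<exists>i\<in>I. F i \<inter> C \<noteq> {} \<and> \<not> F i \<subseteq> C"
  shows "card R \<le> 1 + (\<Sum>i\<in>I. card (F i) - 1)"
proof -
  \<comment> \<open>The condition \<open>F j \<subseteq> C\<close> ensures that a set crossing the
    boundary of \<open>C\<close> is not yet in \<open>J\<close>, so that it is counted once. A
    maximal member of \<open>M\<close> must be \<open>R\<close>.\<close>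
  define M where "M = {C. C \<subseteq> R \<and> C \<noteq> {} \<and>
    (\<exists>J\<subseteq>I. (\<forall>j\<in>J. F j \<subseteq> C) \<and> card C \<le> 1 + (\<Sum>i\<in>J. card (F i) - 1))}"
  obtain x where "x \<in> R" using \<open>R \<noteq> {}\<close> by auto
  then have "{x} \<in> M" unfolding M_def by (auto intro!: exI[of _ "{}"])
  moreover have "finite M" by (rule finite_subset[of _ "Pow R"]) (auto simp: M_def fin)
  ultimately obtain C where C: "C \<in> M" and max: "\<And>D. D \<in> M \<Longrightarrow> C \<subseteq> D \<Longrightarrow> C = D"
    using finite_has_maximal[of M] by (metis empty_iff)
  from C obtain J where J: "J \<subseteq> I" "\<forall>j\<in>J. F j \<subseteq> C" "card C \<le> 1 + (\<Sum>i\<in>J. card (F i) - 1)"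
    and CR: "C \<subseteq> R" "C \<noteq> {}" unfolding M_def by auto
  have finJ: "finite J" using J(1) fin(1) by (rule finite_subset)
  show ?thesis
  proof (cases "C = R")
    case True
    have "(\<Sum>i\<in>J. card (F i) - 1) \<le> (\<Sum>i\<in>I. card (F i) - 1)"
      by (rule sum_mono2) (auto simp: fin J)
    with J(3) show ?thesis unfolding True by linarith
  next
    case False
    then obtain i where i: "i \<in> I" "F i \<inter> C \<noteq> {}" "\<not> F i \<subseteq> C"
      using cross[of C] CR by auto
    have fins: "finite C" "finite (F i)" using CR sub[OF i(1)] fin(2) finite_subset by auto
    have "card (C \<union> F i) + card (C \<inter> F i) = card C + card (F i)"
      using card_Un_Int[OF fins] by linarith
    moreover have "card (C \<inter> F i) \<ge> 1"
      using i(2) fins by (simp add: Int_commute Suc_leI card_gt_0_iff)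
    moreover have "(\<Sum>j\<in>insert i J. card (F j) - 1) = (card (F i) - 1) + (\<Sum>j\<in>J. card (F j) - 1)"
      using i J finJ by (intro sum.insert) auto
    ultimately have "card (C \<union> F i) \<le> 1 + (\<Sum>j\<in>insert i J. card (F j) - 1)"
      using J(3) by linarith
    moreover have "insert i J \<subseteq> I" "\<forall>j\<in>insert i J. F j \<subseteq> C \<union> F i"
      using i J by auto
    ultimately have "C \<union> F i \<in> M" unfolding M_def using CR sub[OF i(1)] by blast
    with max[of "C \<union> F i"] i(3) show ?thesis by auto
  qed
qed

text \<open>A necessary condition for \<open>S \<union> T\<close> being connected through the features that meet \<open>S\<close>, none of
  which leaves \<open>S \<union> T\<close>. It only involves a sum over the independent features.\<close>

definition bad_pair :: "nat \<Rightarrow> (nat \<Rightarrow> 'a set) \<Rightarrow> 'a set \<Rightarrow> 'a set \<Rightarrow> bool" where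
  "bad_pair m F S T \<longleftrightarrow> (\<forall>w<m. F w \<inter> S \<noteq> {} \<longrightarrow> F w \<subseteq> S \<union> T) \<and>
     card (S \<union> T) \<le> 1 + (\<Sum>w | w < m \<and> F w \<inter> S \<noteq> {}. card (F w) - 1)"

text \<open>A set \<open>C\<close> whose boundary is crossed by no feature meeting \<open>S\<close>
  would split \<open>S\<close> into \<open>S \<inter> C\<close> and \<open>S - C\<close>, without
  edges between them and without common neighbours. Neither part is empty, since each neighbour of
  \<open>S\<close> is joined to a vertex of \<open>S\<close> on its own side of \<open>C\<close>. In
  both applications minimality of \<open>S\<close> excludes such a split.\<close>

lemma bad_pair_nbrs:
  assumes "finite V" "S \<subseteq> V" "S \<noteq> {}" and F: "\<And>w. F w \<subseteq> V"
    and nosplit: "\<And>S1 S2. S1 \<noteq> {} \<Longrightarrow> S2 \<noteq> {} \<Longrightarrow> S1 \<union> S2 = S \<Longrightarrow> S1 \<inter> S2 = {} \<Longrightarrow>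
      nbrs V (adj m F) S1 \<inter> nbrs V (adj m F) S2 = {} \<Longrightarrow> nbrs V (adj m F) S1 \<inter> S2 = {} \<Longrightarrow>
      nbrs V (adj m F) S2 \<inter> S1 = {} \<Longrightarrow> False"
  shows "bad_pair m F S (nbrs V (adj m F) S)"
proof -
  let ?N = "nbrs V (adj m F)"
  define R where "R = S \<union> ?N S"
  have sub: "F w \<subseteq> R" if "w < m" "F w \<inter> S \<noteq> {}" for w
  proof
    fix x assume x: "x \<in> F w"
    from that obtain u where "u \<in> F w" "u \<in> S" by auto
    show "x \<in> R"
    proof (cases "x \<in> S")
      case False
      with \<open>u \<in> S\<close> \<open>u \<in> F w\<close> x that(1) have "adj m F u x" unfolding adj_def by blast
      with False \<open>u \<in> S\<close> x F[of w] show ?thesis unfolding R_def nbrs_def by blast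
    qed (simp add: R_def)
  qed
  have "card R \<le> 1 + (\<Sum>w | w < m \<and> F w \<inter> S \<noteq> {}. card (F w) - 1)"
  proof (rule card_le_sum_crossing)
    show "finite R" unfolding R_def
      using finite_nbrs[OF assms(1)] finite_subset[OF assms(2,1)] by simp
    show "R \<noteq> {}" using assms(3) by (simp add: R_def)
    show "F w \<subseteq> R" if "w \<in> {w. w < m \<and> F w \<inter> S \<noteq> {}}" for w using sub that by auto
    fix C assume C: "C \<noteq> {}" "C \<subset> R"
    show "\<exists>w\<in>{w. w < m \<and> F w \<inter> S \<noteq> {}}. F w \<inter> C \<noteq> {} \<and> \<not> F w \<subseteq> C"
    proof (rule ccontr)
      assume "\<not> ?thesis"
      then have cl: "\<And>w. w < m \<Longrightarrow> F w \<inter> S \<noteq> {} \<Longrightarrow> F w \<inter> C \<noteq> {} \<Longrightarrow> F w \<subseteq> C" by blast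
      have step: "v \<in> C \<longleftrightarrow> u \<in> C" if "u \<in> S" "adj m F u v" for u v
      proof -
        from that obtain w where "w < m" "u \<in> F w" "v \<in> F w" by (auto simp: adj_def)
        with cl[of w] \<open>u \<in> S\<close> show ?thesis by blast
      qed
      have "S \<inter> C \<noteq> {}"
      proof
        assume e: "S \<inter> C = {}"
        from C obtain x where "x \<in> C" "x \<in> R" by auto
        with e have "x \<in> ?N S" by (auto simp: R_def)
        then obtain u where "u \<in> S" "adj m F u x" by (auto simp: nbrs_def)
        with step \<open>x \<in> C\<close> e show False by blast
      qed
      moreover have "S - C \<noteq> {}"
      proof
        assume e: "S - C = {}"
        from C obtain x where "x \<notin> C" "x \<in> R" by auto
        with e have "x \<in> ?N S" by (auto simp: R_def)
        then obtain u where "u \<in> S" "adj m F u x" by (auto simp: nbrs_def)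
        with step \<open>x \<notin> C\<close> e show False by blast
      qed
      moreover have "?N (S \<inter> C) \<subseteq> C" "?N (S - C) \<inter> C = {}"
        using step unfolding nbrs_def by blast+
      ultimately show False by (intro nosplit[of "S \<inter> C" "S - C"]) blast+
    qed
  qed auto
  with sub show ?thesis unfolding bad_pair_def R_def by blast
qed

text \<open>\<open>k\<close>-connectedness in terms of boundaries instead of separating sets; for
  \<open>k = 1\<close> and finite \<open>V\<close> it is connectedness. In this form it is
  increasing in \<open>E\<close>, like \<open>expander\<close>, and its failure produces a set
  together with its small boundary.\<close>

definition cut_free :: "'a set \<Rightarrow> ('a \<Rightarrow> 'a \<Rightarrow> bool) \<Rightarrow> nat \<Rightarrow> bool" where
  "cut_free V E k \<longleftrightarrow> (\<forall>S\<subseteq>V. S \<noteq> {} \<longrightarrow> card (nbrs V E S) < k \<longrightarrow> S \<union> nbrs V E S = V)"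

definition expander :: "'a set \<Rightarrow> ('a \<Rightarrow> 'a \<Rightarrow> bool) \<Rightarrow> real \<Rightarrow> bool" where
  "expander V E b \<longleftrightarrow> (\<forall>S\<subseteq>V. S \<noteq> {} \<longrightarrow> real (card S) \<le> b \<longrightarrow> 2 * card S \<le> card (nbrs V E S))"

lemma cut_free_mono:
  assumes "finite V" "\<And>u v. E u v \<Longrightarrow> E' u v" "cut_free V E k" shows "cut_free V E' k"
  unfolding cut_free_def
proof (intro allI impI)
  fix S assume S: "S \<subseteq> V" "S \<noteq> {}" "card (nbrs V E' S) < k"
  have sub: "nbrs V E S \<subseteq> nbrs V E' S" using assms(2) by (rule nbrs_mono)
  then have "card (nbrs V E S) < k"
    using card_mono[OF finite_nbrs[OF assms(1)] sub] S by linarith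
  with S assms(3) have "S \<union> nbrs V E S = V" unfolding cut_free_def by blast
  with sub nbrs_subset[of V E' S] S show "S \<union> nbrs V E' S = V" by blast
qed

lemma expander_mono:
  assumes "finite V" "\<And>u v. E u v \<Longrightarrow> E' u v" "expander V E b" shows "expander V E' b"
proof -
  have "card (nbrs V E S) \<le> card (nbrs V E' S)" for S
    by (intro card_mono finite_nbrs nbrs_mono assms)
  with assms(3) show ?thesis unfolding expander_def by (meson order_trans)
qed

text \<open>A counterexample \<open>S\<close> of least size cannot split: the boundary of a part
  lies in the boundary of \<open>S\<close>, so the part would be a smaller counterexample.\<close>

lemma not_cut_free_bad_pair:
  assumes "finite V" and F: "\<And>w. F w \<subseteq> V" and nc: "\<not> cut_free V (adj m F) k"
  obtains S T where "S \<subseteq> V" "T \<subseteq> V" "S \<inter> T = {}" "S \<noteq> {}" "2 * card S \<le> card V" "card T < k"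
    "bad_pair m F S T"
proof -
  let ?N = "nbrs V (adj m F)"
  define Q where "Q S \<longleftrightarrow> S \<subseteq> V \<and> S \<noteq> {} \<and> card (?N S) < k \<and> S \<union> ?N S \<noteq> V" for S
  from nc obtain S0 where "Q S0" unfolding cut_free_def Q_def by blast
  define S where "S = arg_min card Q"
  have S: "Q S" and min: "\<And>S'. Q S' \<Longrightarrow> card S \<le> card S'"
    using arg_min_nat_lemma[where P = Q and m = card, OF \<open>Q S0\<close>] by (simp_all add: S_def)
  have SV: "S \<subseteq> V" "S \<noteq> {}" "card (?N S) < k" "S \<union> ?N S \<noteq> V" using S by (auto simp: Q_def)
  have fin: "finite S" "finite (?N S)" using SV assms(1) finite_subset finite_nbrs by blast+
  have NV: "?N S \<subseteq> V - S" by (rule nbrs_subset)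
  have "2 * card S \<le> card V"
  proof -
    \<comment> \<open>The far side of the cut is a counterexample as well, its boundary being part
      of that of \<open>S\<close>. So the smallest one has at most half of the vertices.\<close>
    define B where "B = V - S - ?N S"
    have NB: "?N B \<subseteq> ?N S"
    proof
      fix x assume x: "x \<in> ?N B"
      then obtain u where u: "u \<in> B" "adj m F u x" and "x \<in> V - B" by (auto simp: nbrs_def)
      moreover have "x \<notin> S" using u unfolding B_def nbrs_def by (auto simp: adj_sym)
      ultimately show "x \<in> ?N S" by (auto simp: B_def)
    qed
    have "Q B" unfolding Q_def
      using SV NV NB card_mono[OF fin(2) NB] by (auto simp: B_def)
    then have "card S \<le> card B" by (rule min)
    moreover have "card (S \<union> B) \<le> card V" by (intro card_mono assms) (use SV in \<open>auto simp: B_def\<close>)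
    moreover have "card (S \<union> B) = card S + card B"
      using assms(1) fin by (intro card_Un_disjoint) (auto simp: B_def)
    ultimately show ?thesis by linarith
  qed
  moreover have "bad_pair m F S (?N S)"
  proof (rule bad_pair_nbrs)
    fix S1 S2 assume *: "S1 \<noteq> {}" "S2 \<noteq> {}" "S1 \<union> S2 = S" "S1 \<inter> S2 = {}" "?N S1 \<inter> S2 = {}"
    have "?N S1 \<subseteq> ?N S" using *(3,5) unfolding nbrs_def by blast
    then have "card (?N S1) < k" using SV(3) by (meson card_mono fin(2) le_less_trans)
    moreover have "S1 \<union> ?N S1 \<noteq> V"
    proof
      assume "S1 \<union> ?N S1 = V"
      then have "S2 \<subseteq> S1 \<union> ?N S1" using *(3) SV(1) by blast
      with *(2,4,5) show False by blast
    qed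
    ultimately have "Q S1" using *(1,3) SV(1) unfolding Q_def by blast
    then have "card S \<le> card S1" by (rule min)
    moreover have "card S1 < card S" using *(1-4) fin by (intro psubset_card_mono) blast+
    ultimately show False by simp
  qed (use assms SV in auto)
  moreover have "?N S \<subseteq> V" "S \<inter> ?N S = {}" using NV by blast+
  ultimately show ?thesis using that[of S "?N S"] SV by simp
qed

text \<open>The parts of a split are too small to be counterexamples, hence each has at least twice
  as many neighbours as vertices. Their boundaries are disjoint and lie in that of \<open>S\<close>,
  so \<open>S\<close> would expand as well.\<close>

lemma not_expander_bad_pair:
  assumes "finite V" and F: "\<And>w. F w \<subseteq> V" and ne: "\<not> expander V (adj m F) b"
  obtains S T where "S \<subseteq> V" "T \<subseteq> V" "S \<inter> T = {}" "S \<noteq> {}" "real (card S) \<le> b" "card T < 2 * card S"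
    "bad_pair m F S T"
proof -
  let ?N = "nbrs V (adj m F)"
  define Q where "Q S \<longleftrightarrow> S \<subseteq> V \<and> S \<noteq> {} \<and> card (?N S) < 2 * card S \<and> real (card S) \<le> b" for S
  from ne obtain S0 where "Q S0" unfolding expander_def Q_def not_all not_imp not_le by blast
  define S where "S = arg_min card Q"
  have S: "Q S" and min: "\<And>S'. Q S' \<Longrightarrow> card S \<le> card S'"
    using arg_min_nat_lemma[where P = Q and m = card, OF \<open>Q S0\<close>] by (simp_all add: S_def)
  have SV: "S \<subseteq> V" "S \<noteq> {}" "card (?N S) < 2 * card S" "real (card S) \<le> b" using S by (auto simp: Q_def)
  have fin: "finite S" "finite (?N S)" using SV assms(1) finite_subset finite_nbrs by blast+
  have NV: "?N S \<subseteq> V - S" by (rule nbrs_subset)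
  have "bad_pair m F S (?N S)"
  proof (rule bad_pair_nbrs)
    fix S1 S2 assume *: "S1 \<noteq> {}" "S2 \<noteq> {}" "S1 \<union> S2 = S" "S1 \<inter> S2 = {}" "?N S1 \<inter> S2 = {}"
      "?N S2 \<inter> S1 = {}" "?N S1 \<inter> ?N S2 = {}"
    have "S1 \<subset> S" "S2 \<subset> S" using *(1-4) by blast+
    then have less: "card S1 < card S" "card S2 < card S" using fin by (auto intro: psubset_card_mono)
    have grow: "2 * card S' \<le> card (?N S')" if "S' \<noteq> {}" "S' \<subset> S" "card S' < card S" for S'
    proof (rule ccontr)
      assume "\<not> ?thesis"
      then have "Q S'" using that SV unfolding Q_def by auto
      from min[OF this] that show False by simp
    qed
    have "2 * card S1 \<le> card (?N S1)" "2 * card S2 \<le> card (?N S2)"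
      using grow less * \<open>S1 \<subset> S\<close> \<open>S2 \<subset> S\<close> by blast+
    moreover have "card (?N S1 \<union> ?N S2) = card (?N S1) + card (?N S2)"
      by (intro card_Un_disjoint finite_nbrs assms *)
    moreover have "card (?N S1 \<union> ?N S2) \<le> card (?N S)"
    proof (intro card_mono fin)
      show "?N S1 \<union> ?N S2 \<subseteq> ?N S"
        using *(3,5,6) unfolding nbrs_def by blast
    qed
    moreover have "card S = card S1 + card S2"
      using card_Un_disjoint[of S1 S2] *(3,4) fin by (metis finite_Un)
    ultimately show False using SV(3) by linarith
  qed (use assms SV in auto)
  moreover have "?N S \<subseteq> V" "S \<inter> ?N S = {}" using NV by blast+
  ultimately show ?thesis using that[of S "?N S"] SV by simp
qed

section \<open>The exponential moment bound for a single pair of sets\<close>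

lemma prod_if_const_lessThan:
  fixes a b :: real
  assumes "R \<subseteq> {..<n}"
  shows "(\<Prod>v<n. if v \<in> R then a else b) = a ^ card R * b ^ (n - card R)"
proof -
  have "(\<Prod>v<n. if v \<in> R then a else b) = (\<Prod>v\<in>{..<n} \<inter> R. a) * (\<Prod>v\<in>{..<n} \<inter> - R. b)"
    by (subst prod.If_cases) auto
  moreover have "{..<n} \<inter> R = R" "{..<n} \<inter> - R = {..<n} - R" using assms by auto
  ultimately show ?thesis using assms by (simp add: card_Diff_subset finite_subset)
qed

lemma prod_indicator_power:
  fixes c :: real and n :: nat
  assumes "A \<subseteq> {..<n}"
  shows "(\<Prod>v<n. if v \<in> A then (if v \<in> R then c else 0) else 1) = (if A \<subseteq> R then c ^ card A else 0)"
proof (cases "A \<subseteq> R")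
  case True
  then have "(\<Prod>v<n. if v \<in> A then (if v \<in> R then c else 0) else 1) = (\<Prod>v<n. if v \<in> A then c else 1)"
    by (intro prod.cong) auto
  with True prod_if_const_lessThan[OF assms, of c 1] show ?thesis by simp
next
  case False
  then obtain v where "v \<in> A" "v \<notin> R" by auto
  then have "(\<Prod>v<n. if v \<in> A then (if v \<in> R then c else 0) else 1) = 0"
    using assms by (intro prod_zero) (auto intro!: bexI[of _ v])
  with False show ?thesis by simp
qed

lemma prob_random_subset_disjoint:
  assumes S: "S \<subseteq> {..<n}" and p: "0 \<le> p" "p \<le> 1"
  shows "subset_prob n p {A. A \<inter> S = {}} = (1 - p) ^ card S"
proof -
  define g where "g v b = (if v \<in> S \<and> b then 0 else (1::real))" for v b
  have g: "(\<Prod>v<n. g v (v \<in> A)) = indicator {A. A \<inter> S = {}} A" for A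
  proof (cases "A \<inter> S = {}")
    case True
    then show ?thesis by (auto simp: g_def intro!: prod.neutral)
  next
    case False
    then obtain v where "v \<in> A" "v \<in> S" by auto
    then have "(\<Prod>v<n. g v (v \<in> A)) = 0"
      using S by (intro prod_zero) (auto simp: g_def intro!: bexI[of _ v])
    with False show ?thesis by simp
  qed
  have "subset_prob n p {A. A \<inter> S = {}} =
      subset_expectation n p (\<lambda>A. \<Prod>v<n. g v (v \<in> A))"
    unfolding g by simp
  also have "\<dots> = (\<Prod>v<n. p * g v True + (1 - p) * g v False)"
    using p by (intro expectation_random_subset_prod) (auto simp: g_def)
  also have "\<dots> = (\<Prod>v<n. if v \<in> S then 1 - p else 1)"
    by (intro prod.cong) (auto simp: g_def algebra_simps)
  also have "\<dots> = (1 - p) ^ card S" using prod_if_const_lessThan[OF S] by simp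
  finally show ?thesis .
qed

text \<open>For \<open>c \<ge> 1\<close>, the product of these weights over all features dominates
  \<open>c ^ (card (S \<union> T) - 1)\<close> on the event \<open>bad_pair\<close>.\<close>

definition crossing_weight :: "'a set \<Rightarrow> 'a set \<Rightarrow> real \<Rightarrow> 'a set \<Rightarrow> real" where
  "crossing_weight S T c A =
     (if A \<inter> S = {} then 1 else if A \<subseteq> S \<union> T then c ^ (card A - 1) else 0)"

text \<open>The closed form of the expectation of \<open>crossing_weight\<close>. The difference
  takes the sets inside \<open>S \<union> T\<close> and removes those inside \<open>T\<close>, which
  leaves those that meet \<open>S\<close>; the factor \<open>1 / c\<close> turns
  \<open>c ^ card A\<close> into \<open>c ^ (card A - 1)\<close>.\<close>

definition crossing_mgf :: "nat \<Rightarrow> nat \<Rightarrow> nat \<Rightarrow> real \<Rightarrow> real \<Rightarrow> real" where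
  "crossing_mgf n s t p c = (1 - p) ^ s + (1 - p) ^ (n - (s + t)) / c *
     ((1 + (c - 1) * p) ^ (s + t) - (1 - p) ^ s * (1 + (c - 1) * p) ^ t)"

lemma expectation_crossing_weight:
  assumes ST: "S \<subseteq> {..<n}" "T \<subseteq> {..<n}" "S \<inter> T = {}" and p: "0 \<le> p" "p \<le> 1" and c: "c > 0"
  shows "subset_expectation n p (crossing_weight S T c) =
         crossing_mgf n (card S) (card T) p c"
proof -
  define h where "h R v b = (if b then (if v \<in> R then c else 0) else (1::real))" for R :: "nat set" and v b
  have fin: "finite S" "finite T" using ST by (auto intro: finite_subset)
  have card_ST: "card (S \<union> T) = card S + card T" using fin ST by (intro card_Un_disjoint)
  have "card (S \<union> T) \<le> card {..<n}" using ST by (intro card_mono) auto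
  then have le: "card S + card T \<le> n" by (simp add: card_ST)
  have h: "(\<Prod>v<n. h R v (v \<in> A)) = (if A \<subseteq> R then c ^ card A else 0)" if "A \<subseteq> {..<n}" for A R
    unfolding h_def by (rule prod_indicator_power[OF that])
  have decomp: "crossing_weight S T c A = indicator {A. A \<inter> S = {}} A +
      1 / c * ((\<Prod>v<n. h (S \<union> T) v (v \<in> A)) - (\<Prod>v<n. h T v (v \<in> A)))"
    if "A \<in> set_pmf (random_subset n p)" for A
  proof -
    have A: "A \<subseteq> {..<n}" using that by (rule set_random_subset)
    show ?thesis
    proof (cases "A \<inter> S = {}")
      case True
      then have "A \<subseteq> S \<union> T \<longleftrightarrow> A \<subseteq> T" by auto
      with True A show ?thesis by (simp add: crossing_weight_def h)
    next
      case False
      moreover from this have "card A > 0" using finite_subset[OF A] by (auto simp: card_gt_0_iff)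
      ultimately have "\<not> A \<subseteq> T" "card A = Suc (card A - 1)" using ST by auto
      then show ?thesis using c A False
        by (simp add: crossing_weight_def h) (metis nonzero_mult_div_cancel_left less_irrefl power_Suc)
    qed
  qed
  have Eh: "subset_expectation n p (\<lambda>A. \<Prod>v<n. h R v (v \<in> A)) =
      (1 + (c - 1) * p) ^ card R * (1 - p) ^ (n - card R)" if "R \<subseteq> {..<n}" for R
  proof -
    have "subset_expectation n p (\<lambda>A. \<Prod>v<n. h R v (v \<in> A)) =
       (\<Prod>v<n. p * h R v True + (1 - p) * h R v False)"
      using p c by (intro expectation_random_subset_prod) (auto simp: h_def)
    also have "\<dots> = (\<Prod>v<n. if v \<in> R then 1 + (c - 1) * p else 1 - p)"
      by (intro prod.cong) (auto simp: h_def algebra_simps)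
    also have "\<dots> = (1 + (c - 1) * p) ^ card R * (1 - p) ^ (n - card R)"
      by (rule prod_if_const_lessThan[OF that])
    finally show ?thesis .
  qed
  have "subset_expectation n p (crossing_weight S T c) =
     subset_expectation n p (\<lambda>A. indicator {A. A \<inter> S = {}} A +
      1 / c * ((\<Prod>v<n. h (S \<union> T) v (v \<in> A)) - (\<Prod>v<n. h T v (v \<in> A))))"
    by (intro integral_cong_AE AE_pmfI decomp) simp_all
  also have "\<dots> = (1 - p) ^ card S + 1 / c *
      ((1 + (c - 1) * p) ^ card (S \<union> T) * (1 - p) ^ (n - card (S \<union> T)) -
       (1 + (c - 1) * p) ^ card T * (1 - p) ^ (n - card T))"
    using ST by (simp add: Eh prob_random_subset_disjoint p)
  also have "n - card T = card S + (n - (card S + card T))" using le by simp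
  finally show ?thesis
    unfolding crossing_mgf_def by (simp add: card_ST power_add algebra_simps diff_divide_distrib)
qed

lemma crossing_weight_nonneg: "c \<ge> 0 \<Longrightarrow> crossing_weight S T c A \<ge> 0"
  by (simp add: crossing_weight_def)

lemma prob_bad_pair_le_mgf:
  assumes ST: "S \<subseteq> {..<n}" "T \<subseteq> {..<n}" "S \<inter> T = {}" and p: "0 \<le> p" "p \<le> 1" and c: "c \<ge> 1"
  shows "feature_prob n m p {F. bad_pair m F S T} \<le>
         (1 / c) ^ (card S + card T - 1) * crossing_mgf n (card S) (card T) p c ^ m"
proof -
  let ?r = "card S + card T"
  have "finite S" "finite T" using ST by (auto intro: finite_subset)
  then have card_ST: "card (S \<union> T) = ?r" using ST(3) by (intro card_Un_disjoint)
  have "indicator {F. bad_pair m F S T} F \<le> (1 / c) ^ (?r - 1) * (\<Prod>w<m. crossing_weight S T c (F w))" for F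
  proof (cases "bad_pair m F S T")
    case True
    have "(\<Prod>w<m. crossing_weight S T c (F w)) = (\<Prod>w<m. c ^ (if F w \<inter> S \<noteq> {} then card (F w) - 1 else 0))"
      using True by (intro prod.cong) (auto simp: crossing_weight_def bad_pair_def)
    also have "\<dots> = c ^ (\<Sum>w<m. if F w \<inter> S \<noteq> {} then card (F w) - 1 else 0)"
      by (simp add: power_sum)
    also have "(\<Sum>w<m. if F w \<inter> S \<noteq> {} then card (F w) - 1 else 0) =
        (\<Sum>w | w < m \<and> F w \<inter> S \<noteq> {}. card (F w) - 1)"
      by (rule sum.mono_neutral_cong_right) auto
    finally have "c ^ (?r - 1) \<le> (\<Prod>w<m. crossing_weight S T c (F w))"
      using True c by (auto simp: bad_pair_def card_ST intro!: power_increasing)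
    then show ?thesis using True c by (simp add: field_simps)
  next
    case False
    then show ?thesis using c by (auto intro!: mult_nonneg_nonneg prod_nonneg crossing_weight_nonneg)
  qed
  then have "measure_pmf.expectation (features n m p) (indicator {F. bad_pair m F S T} :: _ \<Rightarrow> real) \<le>
     measure_pmf.expectation (features n m p) (\<lambda>F. (1 / c) ^ (?r - 1) * (\<Prod>w<m. crossing_weight S T c (F w)))"
    by (intro integral_mono) auto
  also have "\<dots> = (1 / c) ^ (?r - 1) * crossing_mgf n (card S) (card T) p c ^ m"
    using c p by (simp add: expectation_crossing_weight[OF ST] expectation_prod_features[of "\<lambda>_. crossing_weight S T c"]
        crossing_weight_nonneg)
  finally show ?thesis by simp
qed

text \<open>The product with the quadratic Taylor polynomial of \<open>exp y\<close>, a lower bound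
  of \<open>exp y\<close>, is \<open>1 + y ^ 4 / 4\<close> and so at least 1. This needs no upper
  bound on \<open>y\<close>.\<close>

lemma exp_minus_le_quadratic:
  fixes y :: real
  assumes "y \<ge> 0"
  shows "exp (- y) \<le> 1 - y + y\<^sup>2 / 2"
proof -
  have "1 \<le> (1 - y + y\<^sup>2 / 2) * (1 + y + y\<^sup>2 / 2)"
  proof -
    have "(1 - y + y\<^sup>2 / 2) * (1 + y + y\<^sup>2 / 2) = 1 + (y\<^sup>2)\<^sup>2 / 4"
      by (simp add: field_simps power2_eq_square)
    then show ?thesis by simp
  qed
  also have "\<dots> \<le> (1 - y + y\<^sup>2 / 2) * exp y"
  proof (intro mult_left_mono exp_lower_Taylor_quadratic assms)
    have "0 \<le> (1 - y)\<^sup>2" by simp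
    also have "\<dots> = 1 - 2 * y + y\<^sup>2" by (simp add: power2_diff)
    finally show "0 \<le> 1 - y + y\<^sup>2 / 2" by linarith
  qed
  finally show ?thesis by (simp add: exp_minus field_simps)
qed

lemma exp_le_quadratic:
  fixes x :: real
  assumes "x \<le> 1"
  shows "exp x \<le> 1 + x + x\<^sup>2"
proof (cases "x \<ge> 0")
  case True
  then show ?thesis using exp_bound assms by simp
next
  case False
  then have "exp x \<le> 1 + x + x\<^sup>2 / 2" using exp_minus_le_quadratic[of "- x"] by simp
  also have "\<dots> \<le> 1 + x + x\<^sup>2" by simp
  finally show ?thesis .
qed

lemma power_diff_le:
  fixes a b :: real
  assumes "1 \<le> a" "0 \<le> b" "b \<le> a"
  shows "a ^ s - b ^ s \<le> real s * (a - b) * a ^ s"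
proof (induction s)
  case (Suc s)
  have "a ^ Suc s - b ^ Suc s = a * (a ^ s - b ^ s) + (a - b) * b ^ s" by (simp add: algebra_simps)
  also have "\<dots> \<le> a * (real s * (a - b) * a ^ s) + (a - b) * a ^ Suc s"
  proof (intro add_mono mult_left_mono Suc.IH)
    have "b ^ s \<le> a ^ s" using assms by (intro power_mono)
    also have "\<dots> \<le> a ^ Suc s" using assms by (intro power_increasing) auto
    finally show "b ^ s \<le> a ^ Suc s" .
  qed (use assms in auto)
  finally show ?case by (simp add: algebra_simps)
qed simp

lemma one_minus_power_le_exp:
  fixes p :: real
  assumes "0 \<le> p" "p \<le> 1"
  shows "(1 - p) ^ s \<le> exp (- (real s * p))"
proof -
  have "(1 - p) ^ s \<le> exp (- p) ^ s"
    using assms exp_ge_add_one_self[of "- p"] by (intro power_mono) auto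
  then show ?thesis by (simp add: exp_of_nat_mult[symmetric])
qed

lemma one_plus_power_le_exp:
  fixes x :: real
  assumes "- 1 \<le> x"
  shows "(1 + x) ^ s \<le> exp (real s * x)"
proof -
  have "(1 + x) ^ s \<le> exp x ^ s" using assms by (intro power_mono) auto
  then show ?thesis by (simp add: exp_of_nat_mult[symmetric])
qed

lemma crossing_mgf_nonneg:
  assumes p: "0 \<le> p" "p \<le> 1" and c: "c \<ge> 1"
  shows "0 \<le> crossing_mgf n s t p c"
proof -
  define u where "u = (c - 1) * p"
  have u: "u \<ge> 0" using p c by (simp add: u_def)
  have "(1 - p) ^ s * (1 + u) ^ t \<le> (1 + u) ^ s * (1 + u) ^ t"
    using p u by (intro mult_right_mono power_mono) auto
  then show ?thesis unfolding crossing_mgf_def u_def[symmetric]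
    using p c by (auto intro!: add_nonneg_nonneg mult_nonneg_nonneg simp: power_add)
qed

text \<open>In this second-order expansion the terms \<open>real s * p\<close> of first order
  cancel: features with a single vertex create no edges and must not contribute. What remains has
  the factor \<open>real s * p\<close>, so that \<open>m\<close> features together produce multiples
  of \<open>s * L\<close>. The assumption on \<open>c\<close> keeps the exponent \<open>x\<close> of
  the proof between \<open>- (n p)\<close> and \<open>n p\<close>, hence at most 1.\<close>

lemma crossing_mgf_le:
  assumes p: "0 \<le> p" "p \<le> 1" and c: "c \<ge> 1" and r: "s + t \<le> n"
    and mu: "(c - 1) * p * real (s + t) \<le> real n * p" and np: "real n * p \<le> 1"
  shows "crossing_mgf n s t p c \<le> 1 + real s * p *
    (real s * p / 2 - p * real (n - (s + t)) + (c - 1) * p * real (s + t) + (real n * p)\<^sup>2)"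
proof -
  define u where "u = (c - 1) * p"
  have u: "u \<ge> 0" using p c by (simp add: u_def)
  have up: "u + p = c * p" by (simp add: u_def algebra_simps)
  define b where "b = n - (s + t)"
  define x where "x = - (real b * p) + real (s + t) * u"
  have bp: "0 \<le> real b * p" "real b * p \<le> real n * p" using p by (auto simp: b_def intro!: mult_right_mono)
  have ru: "0 \<le> real (s + t) * u" "real (s + t) * u \<le> real n * p"
    using mu u by (auto simp: u_def mult.commute)
  have x: "\<bar>x\<bar> \<le> real n * p" using bp ru unfolding x_def by linarith
  have D: "(1 + u) ^ (s + t) - (1 - p) ^ s * (1 + u) ^ t \<le> c * (real s * p * (1 + u) ^ (s + t))"
  proof -
    have "(1 + u) ^ s - (1 - p) ^ s \<le> real s * ((1 + u) - (1 - p)) * (1 + u) ^ s"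
      using p u by (intro power_diff_le) auto
    then have "(1 + u) ^ s - (1 - p) ^ s \<le> real s * (c * p) * (1 + u) ^ s" using up by simp
    then have "((1 + u) ^ s - (1 - p) ^ s) * (1 + u) ^ t \<le> real s * (c * p) * (1 + u) ^ s * (1 + u) ^ t"
      using u by (intro mult_right_mono) auto
    then show ?thesis by (simp add: power_add algebra_simps)
  qed
  have "crossing_mgf n s t p c \<le> (1 - p) ^ s + (1 - p) ^ b / c * (c * (real s * p * (1 + u) ^ (s + t)))"
    unfolding crossing_mgf_def u_def[symmetric] b_def[symmetric] using D p c
    by (intro add_left_mono mult_left_mono) auto
  also have "\<dots> = (1 - p) ^ s + real s * p * ((1 - p) ^ b * (1 + u) ^ (s + t))"
    using c by simp
  also have "\<dots> \<le> (1 - real s * p + (real s * p)\<^sup>2 / 2) + real s * p * (1 + x + x\<^sup>2)"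
  proof (intro add_mono mult_left_mono)
    have "(1 - p) ^ s \<le> exp (- (real s * p))" by (rule one_minus_power_le_exp[OF p])
    also have "\<dots> \<le> 1 - real s * p + (real s * p)\<^sup>2 / 2" using p by (intro exp_minus_le_quadratic) auto
    finally show "(1 - p) ^ s \<le> 1 - real s * p + (real s * p)\<^sup>2 / 2" .
    have "(1 - p) ^ b * (1 + u) ^ (s + t) \<le> exp (- (real b * p)) * exp (real (s + t) * u)"
      using p u by (intro mult_mono one_minus_power_le_exp one_plus_power_le_exp) auto
    also have "\<dots> = exp x" by (simp add: x_def exp_add exp_diff exp_minus field_simps)
    also have "\<dots> \<le> 1 + x + x\<^sup>2" using x np by (intro exp_le_quadratic) linarith
    finally show "(1 - p) ^ b * (1 + u) ^ (s + t) \<le> 1 + x + x\<^sup>2" .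
  qed (use p in auto)
  also have "\<dots> = 1 + real s * p * (real s * p / 2 + x + x\<^sup>2)"
    by (simp add: algebra_simps power2_eq_square)
  also have "\<dots> \<le> 1 + real s * p * (real s * p / 2 + x + (real n * p)\<^sup>2)"
    using x p abs_le_square_iff[of x "real n * p"] by (intro add_left_mono mult_left_mono) auto
  also have "real s * p / 2 + x + (real n * p)\<^sup>2 =
     real s * p / 2 - p * real b + (c - 1) * p * real (s + t) + (real n * p)\<^sup>2"
    by (simp add: x_def u_def algebra_simps)
  finally show ?thesis unfolding b_def .
qed

text \<open>In the exponent, \<open>- L\<close> for each vertex of \<open>S\<close> is the price of
  having no two-element feature that leads outside; \<open>(s + t) / n\<close> corrects for partners
  inside \<open>S \<union> T\<close>, and \<open>s / (2 n)\<close> is lost because pairs inside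
  \<open>S\<close> are counted from both ends.\<close>

lemma prob_bad_pair_le:
  fixes n m :: nat and p :: real
  defines "L \<equiv> real m * real n * p\<^sup>2"
  assumes ST: "S \<subseteq> {..<n}" "T \<subseteq> {..<n}" "S \<inter> T = {}" "S \<noteq> {}" and p: "0 \<le> p" "p \<le> 1"
    and L: "L \<ge> 1" and Lnp: "L * (real n * p) \<le> 1"
  shows "feature_prob n m p {F. bad_pair m F S T} \<le>
     (real (card S + card T) * L / real n) ^ (card S + card T - 1) *
     exp (real (card S) * (2 - L * (1 - real (card S + card T) / real n - real (card S) / (2 * real n))))"
proof -
  define s t where "s = card S" and "t = card T"
  define r where "r = s + t"
  have fin: "finite S" "finite T" using ST by (auto intro: finite_subset)
  have s: "s \<ge> 1" using ST fin by (simp add: s_def Suc_leI card_gt_0_iff)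
  have "card (S \<union> T) \<le> card {..<n}" using ST by (intro card_mono) auto
  moreover have "card (S \<union> T) = s + t" using fin ST by (simp add: card_Un_disjoint s_def t_def)
  ultimately have rn: "r \<le> n" by (simp add: r_def)
  have r: "r \<ge> 1" using s by (simp add: r_def)
  have n: "n \<ge> 1" using r rn by simp
  have mp: "real m * p\<^sup>2 = L / real n" using n by (simp add: L_def)
  have np: "real n * p \<le> 1"
  proof -
    have "1 * (real n * p) \<le> L * (real n * p)" using L p by (intro mult_right_mono) auto
    with Lnp show ?thesis by simp
  qed
  \<comment> \<open>The largest base for which the features with two vertices in \<open>S \<union> T\<close> add only \<open>O(s)\<close> to the
    logarithm of the moment.\<close>
  define c where "c = max 1 (real n / (real r * L))"
  have c1: "c \<ge> 1" by (simp add: c_def)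
  have rL: "real r * L > 0" using r L by simp
  have cr: "(c - 1) * real r * L \<le> real n"
  proof (cases "real n / (real r * L) \<ge> 1")
    case True
    then have "c * (real r * L) = real n" using rL r L unfolding c_def max_def by auto
    moreover have "(c - 1) * real r * L = c * (real r * L) - real r * L" by (simp add: algebra_simps)
    ultimately show ?thesis using rL by linarith
  next
    case False
    then show ?thesis by (simp add: c_def)
  qed
  have cr': "(c - 1) * real r \<le> real n"
  proof -
    have "(c - 1) * real r * 1 \<le> (c - 1) * real r * L" using c1 L by (intro mult_left_mono) auto
    with cr show ?thesis by simp
  qed
  define z where "z = real s * p * (real s * p / 2 - p * real (n - (s + t)) +
      (c - 1) * p * real (s + t) + (real n * p)\<^sup>2)"
  have q: "crossing_mgf n s t p c \<le> 1 + z" unfolding z_def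
  proof (rule crossing_mgf_le[OF p c1])
    have "(c - 1) * real r * p \<le> real n * p" using cr' p by (intro mult_right_mono)
    then show "(c - 1) * p * real (s + t) \<le> real n * p" by (simp add: r_def mult_ac)
  qed (use rn np in \<open>auto simp: r_def\<close>)
  have q0: "0 \<le> crossing_mgf n s t p c" by (rule crossing_mgf_nonneg[OF p c1])
  have "crossing_mgf n s t p c ^ m \<le> (1 + z) ^ m" using q q0 by (intro power_mono)
  also have "\<dots> \<le> exp (real m * z)" using q q0 by (intro one_plus_power_le_exp) linarith
  \<comment> \<open>One unit of the constant 2 pays for features with two vertices in
    \<open>S \<union> T\<close>, which the choice of \<open>c\<close> controls, the other for the
    second-order error \<open>m p (n p)^2 = L (n p)\<close>.\<close>
  also have "real m * z \<le> real s * (2 - L * (1 - real r / real n - real s / (2 * real n)))"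
  proof -
    have e: "real m * z = real s * ((real m * p\<^sup>2) * real s / 2 - (real m * p\<^sup>2) * (real n - real r) +
        (real m * p\<^sup>2) * ((c - 1) * real r) + real m * p * (real n * p)\<^sup>2)"
      using rn by (simp add: z_def r_def of_nat_diff algebra_simps power2_eq_square)
    have "real m * p * (real n * p)\<^sup>2 = L * (real n * p)"
      by (simp add: L_def algebra_simps power2_eq_square)
    also have "\<dots> \<le> 1" by (rule Lnp)
    finally have a: "real m * p * (real n * p)\<^sup>2 \<le> 1" .
    have "L / real n * ((c - 1) * real r) = (c - 1) * real r * L / real n" by simp
    also have "\<dots> \<le> 1" using cr n by simp
    finally have b: "L / real n * ((c - 1) * real r) \<le> 1" .
    have "real m * z = real s * (L / real n * real s / 2 - L / real n * (real n - real r) +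
        L / real n * ((c - 1) * real r) + real m * p * (real n * p)\<^sup>2)"
      unfolding e mp ..
    also have "\<dots> \<le> real s * (L / real n * real s / 2 - L / real n * (real n - real r) + 1 + 1)"
      using a b by (intro mult_left_mono add_mono) auto
    also have "\<dots> = real s * (2 - L * (1 - real r / real n - real s / (2 * real n)))"
      using n by (simp add: field_simps)
    finally show ?thesis .
  qed
  finally have qm: "crossing_mgf n s t p c ^ m \<le>
      exp (real s * (2 - L * (1 - real r / real n - real s / (2 * real n))))" by simp
  have "1 / c \<le> real r * L / real n"
  proof -
    have "real n / (real r * L) \<le> c" by (simp add: c_def)
    then show ?thesis using rL n c1 by (simp add: field_simps)
  qed
  then have cpow: "(1 / c) ^ (r - 1) \<le> (real r * L / real n) ^ (r - 1)"
    using c1 by (intro power_mono) auto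
  have "feature_prob n m p {F. bad_pair m F S T} \<le>
         (1 / c) ^ (r - 1) * crossing_mgf n s t p c ^ m"
    unfolding r_def s_def t_def by (rule prob_bad_pair_le_mgf[OF ST(1-3) p c1])
  also have "\<dots> \<le> (real r * L / real n) ^ (r - 1) *
      exp (real s * (2 - L * (1 - real r / real n - real s / (2 * real n))))"
    using cpow qm q0 rL by (intro mult_mono) auto
  finally show ?thesis unfolding r_def s_def t_def .
qed

subsection \<open>Longest paths and boosters\<close>

text \<open>The edges are unordered, so that reversing a segment of a path does not change its set
  of edges.\<close>

fun path_edges :: "'a list \<Rightarrow> 'a set set" where
  "path_edges (x # y # xs) = insert {x, y} (path_edges (y # xs))"
| "path_edges _ = {}"

lemma path_edges_append:
  "path_edges (xs @ ys) = path_edges xs \<union> path_edges ys \<union>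
     (if xs \<noteq> [] \<and> ys \<noteq> [] then {{last xs, hd ys}} else {})"
proof (induction xs rule: path_edges.induct)
  case ("2_2" x)
  then show ?case by (cases ys) auto
qed auto

lemma path_edges_rev: "path_edges (rev xs) = path_edges xs"
proof (induction xs rule: path_edges.induct)
  case (1 x y xs)
  have "path_edges (rev (x # y # xs)) = path_edges (rev (y # xs)) \<union> {{y, x}}"
    using path_edges_append[of "rev (y # xs)" "[x]"] by simp
  also have "{y, x} = {x, y}" by auto
  finally show ?case using 1 by simp
qed auto

lemma path_edges_subset: "e \<in> path_edges xs \<Longrightarrow> e \<subseteq> set xs"
  by (induction xs rule: path_edges.induct) auto

lemma finite_path_edges [simp]: "finite (path_edges xs)"
  by (induction xs rule: path_edges.induct) auto

lemma path_edges_at: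
  assumes "distinct (as @ y # bs)"
  shows "{e \<in> path_edges (as @ y # bs). y \<in> e} =
     (if as \<noteq> [] then {{last as, y}} else {}) \<union> (if bs \<noteq> [] then {{y, hd bs}} else {})"
proof -
  have "path_edges (as @ y # bs) = path_edges as \<union> path_edges bs \<union>
     ((if as \<noteq> [] then {{last as, y}} else {}) \<union> (if bs \<noteq> [] then {{y, hd bs}} else {}))"
    by (cases bs) (auto simp: path_edges_append)
  then show ?thesis using assms path_edges_subset[of _ as] path_edges_subset[of _ bs] by auto
qed

lemma card_path_edges_at:
  assumes "distinct xs" "y \<in> set xs" "length xs \<ge> 2"
  shows "card {e \<in> path_edges xs. y \<in> e} = (if y = hd xs \<or> y = last xs then 1 else 2)"
proof -
  obtain as bs where xs: "xs = as @ y # bs" using assms(2) by (meson split_list)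
  have 1: "as \<noteq> [] \<Longrightarrow> last as \<in> set as" "bs \<noteq> [] \<Longrightarrow> hd bs \<in> set bs" "bs \<noteq> [] \<Longrightarrow> last bs \<in> set bs"
    "as \<noteq> [] \<Longrightarrow> hd as \<in> set as" by auto
  have ends: "y = hd xs \<longleftrightarrow> as = []" "y = last xs \<longleftrightarrow> bs = []"
    using assms(1) 1 unfolding xs by (auto simp: hd_append)
  have "{last as, y} \<noteq> {y, hd bs}" if "as \<noteq> []" "bs \<noteq> []"
  proof -
    have "last as \<noteq> hd bs" "last as \<noteq> y"
      using 1(1)[OF that(1)] 1(2)[OF that(2)] assms(1) unfolding xs by auto
    then show ?thesis by (auto simp: doubleton_eq_iff)
  qed
  moreover have "as \<noteq> [] \<or> bs \<noteq> []" using assms(3) xs by auto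
  ultimately show ?thesis
    unfolding ends unfolding xs path_edges_at[OF assms(1)[unfolded xs]] by auto
qed

lemma card_path_neighbours:
  assumes "distinct xs" "y \<in> set xs" "length xs \<ge> 2"
  shows "card {b. {y, b} \<in> path_edges xs} \<le> (if y = hd xs \<or> y = last xs then 1 else 2)"
proof -
  have "card {b. {y, b} \<in> path_edges xs} \<le> card {e \<in> path_edges xs. y \<in> e}"
    by (rule card_inj_on_le[of "\<lambda>b. {y, b}"]) (auto simp: inj_on_def doubleton_eq_iff)
  with card_path_edges_at[OF assms] show ?thesis by simp
qed

definition gpath :: "'a set \<Rightarrow> ('a \<Rightarrow> 'a \<Rightarrow> bool) \<Rightarrow> 'a list \<Rightarrow> bool" where
  "gpath V E xs \<longleftrightarrow> xs \<noteq> [] \<and> distinct xs \<and> set xs \<subseteq> V \<and> successively E xs"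

definition longest :: "'a set \<Rightarrow> ('a \<Rightarrow> 'a \<Rightarrow> bool) \<Rightarrow> nat" where
  "longest V E = Max (length ` {xs. gpath V E xs})"

definition hamiltonian :: "'a set \<Rightarrow> ('a \<Rightarrow> 'a \<Rightarrow> bool) \<Rightarrow> bool" where
  "hamiltonian V E \<longleftrightarrow> (\<exists>xs. gpath V E xs \<and> set xs = V \<and> 3 \<le> length xs \<and> E (last xs) (hd xs))"

lemma gpath_mono: "gpath V E xs \<Longrightarrow> (\<And>u v. E u v \<Longrightarrow> E' u v) \<Longrightarrow> gpath V E' xs"
  unfolding gpath_def by (auto intro: successively_mono)

lemma hamiltonian_mono: "hamiltonian V E \<Longrightarrow> (\<And>u v. E u v \<Longrightarrow> E' u v) \<Longrightarrow> hamiltonian V E'"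
  unfolding hamiltonian_def using gpath_mono[of V E _ E'] by blast

lemma finite_gpaths: "finite V \<Longrightarrow> finite {xs. gpath V E xs}"
  using finite_subset_distinct[of V] by (rule finite_subset[rotated]) (auto simp: gpath_def)

lemma gpath_length_le_card: "finite V \<Longrightarrow> gpath V E xs \<Longrightarrow> length xs \<le> card V"
  unfolding gpath_def by (metis card_mono distinct_card)

lemma gpath_length_le_longest: "finite V \<Longrightarrow> gpath V E xs \<Longrightarrow> length xs \<le> longest V E"
  unfolding longest_def by (intro Max_ge finite_imageI finite_gpaths) auto

lemma longest_gpath:
  assumes "finite V" "V \<noteq> {}"
  obtains xs where "gpath V E xs" "length xs = longest V E"
proof -
  obtain v where "v \<in> V" using assms by auto
  then have "gpath V E [v]" by (simp add: gpath_def)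
  then have "longest V E \<in> length ` {xs. gpath V E xs}"
    unfolding longest_def by (intro Max_in finite_imageI finite_gpaths assms) auto
  then show ?thesis using that by auto
qed

lemma longest_le_card:
  assumes "finite V" "V \<noteq> {}" shows "longest V E \<le> card V"
  by (metis longest_gpath[OF assms] gpath_length_le_card assms(1))

lemma longest_mono:
  assumes "finite V" "V \<noteq> {}" "\<And>u v. E u v \<Longrightarrow> E' u v"
  shows "longest V E \<le> longest V E'"
proof -
  obtain xs where xs: "gpath V E xs" "length xs = longest V E" using longest_gpath[OF assms(1,2)] .
  have "gpath V E' xs" using xs(1) assms(3) by (rule gpath_mono)
  from gpath_length_le_longest[OF assms(1) this] xs(2) show ?thesis by simp
qed

text \<open>Posa's rotations with the first vertex fixed: an edge from the last vertex back to
  \<open>y\<close> replaces the edge from \<open>y\<close> to \<open>hd bs\<close>, and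
  \<open>hd bs\<close> becomes the last vertex.\<close>

inductive rotations :: "('a \<Rightarrow> 'a \<Rightarrow> bool) \<Rightarrow> 'a list \<Rightarrow> 'a list \<Rightarrow> bool" for E xs where
  self: "rotations E xs xs"
| rotated: "rotations E xs (as @ y # bs) \<Longrightarrow> bs \<noteq> [] \<Longrightarrow> E (last bs) y \<Longrightarrow> rotations E xs (as @ y # rev bs)"

definition endpoints :: "('a \<Rightarrow> 'a \<Rightarrow> bool) \<Rightarrow> 'a list \<Rightarrow> 'a set" where
  "endpoints E xs = last ` {ys. rotations E xs ys}"

lemma rotations_invariant:
  assumes "rotations E xs ys" and sym: "\<And>u v. E u v \<Longrightarrow> E v u" and "gpath V E xs"
  shows "gpath V E ys \<and> set ys = set xs \<and> hd ys = hd xs \<and> length ys = length xs"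
  using assms(1)
proof induction
  case (rotated as y bs)
  have "gpath V E (as @ y # rev bs)"
  proof -
    have "successively E bs" using rotated by (cases bs) (auto simp: gpath_def successively_append_iff)
    then have "successively E (rev bs)"
      unfolding successively_rev using sym by (auto elim: successively_mono)
    moreover have "E y (hd (rev bs))" using rotated sym by (simp add: hd_rev)
    ultimately have "successively E (y # rev bs)" using rotated(2) by (cases "rev bs") auto
    with rotated show ?thesis by (auto simp: gpath_def successively_append_iff)
  qed
  with rotated show ?case by (auto simp: hd_append split: if_splits)
qed (use assms in auto)

text \<open>The only edge that a rotation removes is \<open>{y, hd bs}\<close>, and
  \<open>hd bs\<close> is an endpoint of the rotated path. So the edges of \<open>xs\<close> that
  touch no endpoint are never lost.\<close>

lemma path_edges_rotations:
  assumes "rotations E xs ys"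
  shows "path_edges xs \<subseteq> path_edges ys \<union> {e. e \<inter> endpoints E xs \<noteq> {}}"
  using assms
proof induction
  case (rotated as y bs)
  have 1: "path_edges (as @ y # bs) = path_edges (as @ [y]) \<union> path_edges bs \<union> {{y, hd bs}}"
    using rotated(2) path_edges_append[of "as @ [y]" bs] by simp
  have 2: "path_edges (as @ y # rev bs) = path_edges (as @ [y]) \<union> path_edges bs \<union> {{y, last bs}}"
    using rotated(2) path_edges_append[of "as @ [y]" "rev bs"] by (simp add: path_edges_rev hd_rev)
  have "rotations E xs (as @ y # rev bs)" using rotated by (intro rotations.rotated)
  then have "last (as @ y # rev bs) \<in> endpoints E xs" unfolding endpoints_def by blast
  then have "hd bs \<in> endpoints E xs" using rotated(2) by (simp add: last_rev)
  with rotated.IH show ?case unfolding 1 2 by auto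
qed auto

lemma last_in_endpoints: "last xs \<in> endpoints E xs"
  unfolding endpoints_def by (auto intro: rotations.self)

text \<open>Every vertex of the boundary is next to an endpoint on the original path
  \<open>xs\<close>. An endpoint has at most two neighbours along \<open>xs\<close>, and
  \<open>last xs\<close> has only one, hence the strict inequality. That \<open>xs\<close> is
  longest keeps the neighbours of endpoints on the path.\<close>

lemma posa:
  assumes V: "finite V" and sym: "\<And>u v. E u v \<Longrightarrow> E v u"
    and xs: "gpath V E xs" "length xs = longest V E" "length xs \<ge> 2"
  shows "endpoints E xs \<subseteq> set xs" "card (nbrs V E (endpoints E xs)) < 2 * card (endpoints E xs)"
proof -
  let ?S = "endpoints E xs"
  define nb where "nb z = {b. {z, b} \<in> path_edges xs}" for z
  have xs': "distinct xs" "xs \<noteq> []" using xs by (auto simp: gpath_def)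
  have inv: "gpath V E ys" "set ys = set xs" "hd ys = hd xs" "length ys = length xs" if "rotations E xs ys" for ys
    using rotations_invariant[OF that sym xs(1)] by auto
  show sub: "?S \<subseteq> set xs"
    unfolding endpoints_def using inv by (force simp: gpath_def)
  then have finS: "finite ?S" by (rule finite_subset) simp
  have finnb: "finite (nb z)" for z
  proof (rule finite_subset)
    show "nb z \<subseteq> set xs" using path_edges_subset[of _ xs] by (auto simp: nb_def)
  qed simp
  have "nbrs V E ?S \<subseteq> (\<Union>z\<in>?S. nb z)"
  proof
    fix y assume "y \<in> nbrs V E ?S"
    then obtain z where y: "y \<in> V" "y \<notin> ?S" "z \<in> ?S" "E z y" by (auto simp: nbrs_def)
    then obtain ys where ys: "rotations E xs ys" "z = last ys" by (auto simp: endpoints_def)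
    note ysi = inv[OF ys(1)]
    have yin: "y \<in> set ys"
    proof (rule ccontr)
      assume "y \<notin> set ys"
      then have "gpath V E (ys @ [y])"
        using ysi y ys by (auto simp: gpath_def successively_append_iff)
      from gpath_length_le_longest[OF V this] ysi xs show False by simp
    qed
    have ynl: "y \<noteq> last ys" "y \<noteq> last xs" using y ys(2) last_in_endpoints[of xs E] by auto
    obtain as bs where ab: "ys = as @ y # bs" using yin by (meson split_list)
    then have bs: "bs \<noteq> []" using ynl by auto
    have "rotations E xs (as @ y # rev bs)"
      using ys ab bs y by (intro rotations.rotated) auto
    then have "last (as @ y # rev bs) \<in> ?S" unfolding endpoints_def by blast
    then have hS: "hd bs \<in> ?S" using bs by (simp add: last_rev)
    show "y \<in> (\<Union>z\<in>?S. nb z)"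
    proof (rule ccontr)
      assume no: "\<not> ?thesis"
      \<comment> \<open>If no edge of \<open>xs\<close> at \<open>y\<close> touches an endpoint, all
        of them survive in \<open>ys\<close>. Since \<open>y\<close> has equally many edges on both
        paths, these are the same edges; one of them leads to \<open>hd bs\<close>, which is an
        endpoint.\<close>
      have "{e \<in> path_edges xs. y \<in> e} \<subseteq> {e \<in> path_edges ys. y \<in> e}"
      proof
        fix e assume e: "e \<in> {e \<in> path_edges xs. y \<in> e}"
        have "e \<inter> ?S = {}"
        proof (rule ccontr)
          assume "e \<inter> ?S \<noteq> {}"
          then obtain b where b: "b \<in> e" "b \<in> ?S" by auto
          have "\<exists>u v. e = {u, v}" using e by (induction xs rule: path_edges.induct) auto
          then have "e = {b, y}" using e b y by auto
          with e b no show False by (auto simp: nb_def)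
        qed
        with e path_edges_rotations[OF ys(1)] show "e \<in> {e \<in> path_edges ys. y \<in> e}" by auto
      qed
      moreover have "card {e \<in> path_edges xs. y \<in> e} = card {e \<in> path_edges ys. y \<in> e}"
        using card_path_edges_at[of xs y] card_path_edges_at[of ys y] xs xs' yin ysi ynl
        by (simp add: gpath_def)
      ultimately have "{e \<in> path_edges xs. y \<in> e} = {e \<in> path_edges ys. y \<in> e}"
        by (intro card_subset_eq) auto
      moreover have "{y, hd bs} \<in> {e \<in> path_edges ys. y \<in> e}"
        using path_edges_at[of as y bs] ysi(1) bs unfolding ab gpath_def by auto
      ultimately have "{hd bs, y} \<in> path_edges xs" by (auto simp: insert_commute)
      with hS no show False by (auto simp: nb_def)
    qed
  qed
  then have "card (nbrs V E ?S) \<le> card (\<Union>z\<in>?S. nb z)"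
    using finS finnb by (intro card_mono) auto
  also have "\<dots> \<le> (\<Sum>z\<in>?S. card (nb z))" using finS by (rule card_UN_le)
  also have "\<dots> = card (nb (last xs)) + (\<Sum>z\<in>?S - {last xs}. card (nb z))"
    using finS last_in_endpoints by (rule sum.remove)
  also have "\<dots> \<le> 1 + (\<Sum>z\<in>?S - {last xs}. 2)"
  proof (intro add_mono sum_mono)
    show "card (nb (last xs)) \<le> 1"
      using card_path_neighbours[OF xs'(1) last_in_set[OF xs'(2)] xs(3)] by (simp add: nb_def)
    fix z assume "z \<in> ?S - {last xs}"
    then have "z \<in> set xs" using sub by auto
    from card_path_neighbours[OF xs'(1) this xs(3)] show "card (nb z) \<le> 2"
      by (auto simp: nb_def split: if_splits)
  qed
  also have "\<dots> = 1 + 2 * (card ?S - 1)" using finS last_in_endpoints[of xs E] by simp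
  also have "\<dots> < 2 * card ?S"
  proof -
    have "card ?S > 0" using finS last_in_endpoints[of xs E] by (auto simp: card_gt_0_iff)
    then show ?thesis by simp
  qed
  finally show "card (nbrs V E ?S) < 2 * card ?S" .
qed

text \<open>Ordered pairs, because the two ends of a longest path are varied one after the
  other.\<close>

definition boosters :: "'a set \<Rightarrow> ('a \<Rightarrow> 'a \<Rightarrow> bool) \<Rightarrow> ('a \<times> 'a) set" where
  "boosters V E = {(hd xs, last xs) | xs. gpath V E xs \<and> length xs = longest V E}"

lemma boosters_subset: "boosters V E \<subseteq> V \<times> V"
  by (auto simp: boosters_def gpath_def)

lemma longest_ge_3:
  assumes V: "finite V" "V \<noteq> {}" and sym: "\<And>u v. E u v \<Longrightarrow> E v u"
    and ex: "expander V E b" and b: "b \<ge> 1"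
  shows "longest V E \<ge> 3"
proof -
  obtain u where u: "u \<in> V" using V by auto
  with ex b have "card (nbrs V E {u}) \<ge> 2" unfolding expander_def by force
  then obtain x y where xy: "x \<in> nbrs V E {u}" "y \<in> nbrs V E {u}" "x \<noteq> y"
    using finite_nbrs[OF V(1)] by (metis card_le_Suc0_iff_eq not_less_eq_eq numeral_2_eq_2)
  then have "gpath V E [x, u, y]" using u sym by (auto simp: gpath_def nbrs_def)
  from gpath_length_le_longest[OF V(1) this] show ?thesis by simp
qed

text \<open>By \<open>posa\<close>, an endpoint set of size at most \<open>b\<close> would
  contradict expansion. So rotating a longest path gives more than \<open>b\<close> last vertices
  \<open>z\<close>; reversing the path for each \<open>z\<close> and rotating again, now with
  \<open>z\<close> as the fixed first vertex, gives more than \<open>b\<close> partners of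
  \<open>z\<close>.\<close>

lemma card_boosters:
  assumes V: "finite V" "V \<noteq> {}" and sym: "\<And>u v. E u v \<Longrightarrow> E v u"
    and ex: "expander V E b" and b: "b \<ge> 1"
  shows "real (card (boosters V E)) \<ge> b\<^sup>2"
proof -
  have l3: "longest V E \<ge> 3" by (rule longest_ge_3[OF assms])
  have big: "b < real (card (endpoints E xs))" if "gpath V E xs" "length xs = longest V E" for xs
  proof (rule ccontr)
    assume c: "\<not> ?thesis"
    have "2 \<le> length xs" using that(2) l3 by simp
    note P = posa[OF V(1) sym that this]
    have "endpoints E xs \<subseteq> V" using P(1) that(1) by (auto simp: gpath_def)
    moreover have "endpoints E xs \<noteq> {}" using last_in_endpoints[of xs E] by blast
    ultimately have "2 * card (endpoints E xs) \<le> card (nbrs V E (endpoints E xs))"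
      using ex c unfolding expander_def by auto
    with P(2) show False by simp
  qed
  obtain xs where xs: "gpath V E xs" "length xs = longest V E" using longest_gpath[OF V] by blast
  define A where "A = endpoints E xs"
  have "\<exists>ys. rotations E xs ys \<and> last ys = z" if "z \<in> A" for z
    using that by (auto simp: A_def endpoints_def)
  then obtain Y where Y: "\<And>z. z \<in> A \<Longrightarrow> rotations E xs (Y z)" "\<And>z. z \<in> A \<Longrightarrow> last (Y z) = z" by metis
  define B where "B z = endpoints E (rev (Y z))" for z
  have Yp: "gpath V E (rev (Y z))" "length (rev (Y z)) = longest V E" "hd (rev (Y z)) = z" if "z \<in> A" for z
  proof -
    from rotations_invariant[OF Y(1)[OF that] sym xs(1)]
    have "gpath V E (Y z)" "length (Y z) = longest V E" using xs by auto
    then show "gpath V E (rev (Y z))" "length (rev (Y z)) = longest V E" "hd (rev (Y z)) = z"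
      using sym Y(2)[OF that] by (auto simp: gpath_def hd_rev elim: successively_mono)
  qed
  have fin: "finite (endpoints E xs)" if "gpath V E xs" "length xs = longest V E" for xs
  proof -
    have "2 \<le> length xs" using that(2) l3 by simp
    from posa(1)[OF V(1) sym that this] show ?thesis by (rule finite_subset) auto
  qed
  have finA: "finite A" "\<And>z. z \<in> A \<Longrightarrow> finite (B z)"
    using fin[OF xs] fin[OF Yp(1,2)] by (simp_all add: A_def B_def)
  have "Sigma A B \<subseteq> boosters V E"
  proof safe
    fix z z' assume z: "z \<in> A" "z' \<in> B z"
    then obtain zs where zs: "rotations E (rev (Y z)) zs" "z' = last zs" by (auto simp: B_def endpoints_def)
    from rotations_invariant[OF zs(1) sym Yp(1)[OF z(1)]] Yp[OF z(1)]
    have "gpath V E zs" "hd zs = z" "length zs = longest V E" by auto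
    then show "(z, z') \<in> boosters V E" using zs(2) unfolding boosters_def by blast
  qed
  then have "card (Sigma A B) \<le> card (boosters V E)"
    using finite_subset[OF boosters_subset finite_cartesian_product[OF V(1) V(1)]] by (rule card_mono[rotated])
  then have "real (card (Sigma A B)) \<le> real (card (boosters V E))" by simp
  moreover have "real (card (Sigma A B)) = (\<Sum>z\<in>A. real (card (B z)))" using finA by simp
  moreover have "(\<Sum>z\<in>A. b) \<le> (\<Sum>z\<in>A. real (card (B z)))"
    using big Yp unfolding B_def by (intro sum_mono less_imp_le) auto
  moreover have "b * b \<le> real (card A) * b"
    using big[OF xs] b unfolding A_def by (intro mult_right_mono) auto
  ultimately show ?thesis by (simp add: power2_eq_square)
qed

text \<open>The new edge closes a longest path to a cycle. If this misses a vertex, connectedness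
  provides an edge from some \<open>x\<close> on the cycle to some \<open>y\<close> outside; cutting
  the cycle open at \<open>x\<close> and starting from \<open>y\<close> gives a longer path.\<close>

lemma booster_improves:
  assumes V: "finite V" and con: "cut_free V E 1" and l3: "longest V E \<ge> 3"
    and uv: "(u, v) \<in> boosters V E" and E': "\<And>u v. E u v \<Longrightarrow> E' u v" "\<And>u v. E' u v \<Longrightarrow> E' v u" "E' u v"
  shows "hamiltonian V E' \<or> longest V E < longest V E'"
proof -
  obtain xs where xs: "gpath V E xs" "length xs = longest V E" "u = hd xs" "v = last xs"
    using uv by (auto simp: boosters_def)
  have xs': "gpath V E' xs" using gpath_mono[OF xs(1) E'(1)] .
  have close: "E' (last xs) (hd xs)" using E' xs by auto
  show ?thesis
  proof (cases "set xs = V")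
    case True
    then show ?thesis using xs xs' close l3 unfolding hamiltonian_def by (intro disjI1 exI[of _ xs]) simp
  next
    case False
    have ne: "set xs \<noteq> {}" "set xs \<subseteq> V" using xs by (auto simp: gpath_def)
    have "nbrs V E (set xs) \<noteq> {}"
    proof
      assume "nbrs V E (set xs) = {}"
      moreover have "card (nbrs V E (set xs)) < 1 \<longrightarrow> set xs \<union> nbrs V E (set xs) = V"
        using con ne unfolding cut_free_def by blast
      ultimately show False using False by simp
    qed
    then obtain y where "y \<in> nbrs V E (set xs)" by blast
    then obtain x where x: "x \<in> set xs" "E x y" "y \<notin> set xs" "y \<in> V" by (auto simp: nbrs_def)
    obtain as bs where ab: "xs = as @ x # bs" using x(1) by (meson split_list)
    have "successively E' (as @ x # bs)" using xs' ab by (simp add: gpath_def)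
    then have "successively E' as" "successively E' (x # bs)"
      unfolding successively_append_iff by blast+
    moreover have "as \<noteq> [] \<Longrightarrow> E' (last (x # bs)) (hd as)" using close ab by simp
    ultimately have "successively E' ((x # bs) @ as)"
      unfolding successively_append_iff by blast
    then have "gpath V E' (y # (x # bs) @ as)"
      using xs' x E' ab by (auto simp: gpath_def)
    from gpath_length_le_longest[OF V this] show ?thesis using ab xs(2) by simp
  qed
qed

section \<open>Exposing the reserved features one at a time\<close>

lemma features_Suc:
  "features n (Suc m) p =
     bind_pmf (features n m p) (\<lambda>F. map_pmf (\<lambda>A. F(m := A)) (random_subset n p))"
  unfolding features_def lessThan_Suc
  by (subst Pi_pmf_insert') (simp_all add: map_pmf_def bind_commute_pmf[of "random_subset n p"])

lemma expectation_features_Suc: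
  fixes f :: "(nat \<Rightarrow> nat set) \<Rightarrow> real"
  shows "measure_pmf.expectation (features n (Suc m) p) f =
    measure_pmf.expectation (features n m p)
      (\<lambda>F. subset_expectation n p (\<lambda>A. f (F(m := A))))"
proof -
  have "measure_pmf.expectation (features n (Suc m) p) f =
     (\<Sum>F\<in>set_pmf (features n m p). pmf (features n m p) F *\<^sub>R
        measure_pmf.expectation (map_pmf (\<lambda>A. F(m := A)) (random_subset n p)) f)"
    unfolding features_Suc by (rule pmf_expectation_bind) auto
  also have "\<dots> = measure_pmf.expectation (features n m p)
      (\<lambda>F. measure_pmf.expectation (map_pmf (\<lambda>A. F(m := A)) (random_subset n p)) f)"
    by (rule integral_measure_pmf[symmetric]) auto
  finally show ?thesis by simp
qed

lemma pmf_random_subset: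
  assumes "A \<subseteq> {..<n}" "0 \<le> p" "p \<le> 1"
  shows "pmf (random_subset n p) A = p ^ card A * (1 - p) ^ (n - card A)"
proof -
  define g where "g v b = (if (v \<in> A) = b then 1 else (0::real))" for v b
  have "(\<Prod>v<n. g v (v \<in> B)) = indicator {A} B" if "B \<in> set_pmf (random_subset n p)" for B
  proof (cases "A = B")
    case False
    with assms set_random_subset[OF that] obtain v where "v < n" "(v \<in> A) \<noteq> (v \<in> B)" by auto
    then show ?thesis using False by (auto simp: g_def intro!: prod_zero bexI[of _ v])
  qed (simp add: g_def)
  then have "subset_expectation n p (indicator {A} :: _ \<Rightarrow> real) =
     subset_expectation n p (\<lambda>B. \<Prod>v<n. g v (v \<in> B))"
    by (intro integral_cong_AE AE_pmfI) auto
  also have "\<dots> = (\<Prod>v<n. p * g v True + (1 - p) * g v False)"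
    using assms by (intro expectation_random_subset_prod) (auto simp: g_def)
  also have "\<dots> = (\<Prod>v<n. if v \<in> A then p else 1 - p)" by (intro prod.cong) (auto simp: g_def)
  also have "\<dots> = p ^ card A * (1 - p) ^ (n - card A)" using assms by (intro prod_if_const_lessThan)
  finally show ?thesis by (simp add: measure_pmf_single)
qed

text \<open>A feature that contains a booster at least halves the potential.\<close>

definition potential :: "'a set \<Rightarrow> ('a \<Rightarrow> 'a \<Rightarrow> bool) \<Rightarrow> real" where
  "potential V E = (if hamiltonian V E then 0 else 2 ^ (card V - longest V E))"

lemma potential_nonneg: "potential V E \<ge> 0"
  by (simp add: potential_def)

lemma potential_le: "potential V E \<le> 2 ^ card V"
  by (simp add: potential_def)

lemma potential_ge_1: "\<not> hamiltonian V E \<Longrightarrow> potential V E \<ge> 1"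
  by (simp add: potential_def)

lemma potential_mono:
  assumes "finite V" "V \<noteq> {}" "\<And>u v. E u v \<Longrightarrow> E' u v"
  shows "potential V E' \<le> potential V E"
  unfolding potential_def
  using hamiltonian_mono[of V E E'] longest_mono[OF assms] assms(3)
  by (auto intro!: power_increasing diff_le_mono2)

lemma card_unordered_pairs_ge:
  fixes B :: "('a \<times> 'a) set"
  assumes "finite B"
  shows "card B \<le> 2 * card ((\<lambda>(u, v). {u, v}) ` B)"
proof -
  let ?D = "(\<lambda>(u, v). {u, v}) ` B"
  have "card B \<le> card (\<Union>e\<in>?D. {x \<in> B. (\<lambda>(u, v). {u, v}) x = e})"
    using assms by (intro card_mono) auto
  also have "\<dots> \<le> (\<Sum>e\<in>?D. card {x \<in> B. (\<lambda>(u, v). {u, v}) x = e})"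
    using assms by (intro card_UN_le) auto
  also have "\<dots> \<le> (\<Sum>e\<in>?D. 2)"
  proof (rule sum_mono)
    fix e assume "e \<in> ?D"
    then obtain u v where e: "e = {u, v}" by auto
    have "card {x \<in> B. (\<lambda>(u, v). {u, v}) x = e} \<le> card {(u, v), (v, u)}"
    proof (rule card_mono)
      show "{x \<in> B. (\<lambda>(u, v). {u, v}) x = e} \<subseteq> {(u, v), (v, u)}"
      proof
        fix x assume "x \<in> {x \<in> B. (\<lambda>(u, v). {u, v}) x = e}"
        then have "{fst x, snd x} = {u, v}" by (simp add: e case_prod_beta)
        then show "x \<in> {(u, v), (v, u)}" by (cases x) (simp add: doubleton_eq_iff)
      qed
    qed simp
    moreover have "card {(u, v), (v, u)} \<le> 2" using card_length[of "[(u, v), (v, u)]"] by simp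
    ultimately show "card {x \<in> B. (\<lambda>(u, v). {u, v}) x = e} \<le> 2" by linarith
  qed
  finally show ?thesis by simp
qed

lemma adj_upd:
  "adj (Suc m) (F(m := A)) u v \<longleftrightarrow> adj m F u v \<or> u \<noteq> v \<and> u \<in> A \<and> v \<in> A"
  by (auto simp: adj_def less_Suc_eq)

lemma adj_upd_ge: "m \<le> k \<Longrightarrow> adj m (F(k := A)) = adj m F"
proof -
  assume "m \<le> k"
  then have "w < m \<Longrightarrow> (F(k := A)) w = F w" for w by simp
  then show ?thesis unfolding adj_def fun_eq_iff by metis
qed

text \<open>Only features that equal a two-element booster are counted; these are disjoint events,
  so their probabilities add up. The 4 combines a factor 2 for unordered pairs with a factor 2 for
  the halving. For all other features monotonicity keeps the potential from growing.\<close>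

lemma potential_step:
  assumes n: "n \<ge> 1" and p: "0 \<le> p" "p \<le> 1" and b: "b \<ge> 1"
    and con: "cut_free {..<n} (adj m F) 1" and ex: "expander {..<n} (adj m F) b"
  shows "subset_expectation n p (\<lambda>A. potential {..<n} (adj (Suc m) (F(m := A)))) \<le>
    potential {..<n} (adj m F) * (1 - b\<^sup>2 * p\<^sup>2 * (1 - p) ^ (n - 2) / 4)"
proof -
  let ?V = "{..<n}" and ?E = "adj m F"
  let ?E' = "\<lambda>A. adj (Suc m) (F(m := A))"
  have V: "finite ?V" "?V \<noteq> {}" using n by (auto simp: lessThan_empty_iff)
  have sym: "\<And>u v. ?E u v \<Longrightarrow> ?E v u" by (auto simp: adj_def)
  have l3: "longest ?V ?E \<ge> 3" by (rule longest_ge_3[OF V sym ex b])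
  define D where "D = (\<lambda>(u, v). {u, v}) ` boosters ?V ?E"
  have finB: "finite (boosters ?V ?E)"
    by (rule finite_subset[OF boosters_subset]) auto
  have D2: "e \<subseteq> ?V \<and> card e = 2" if "e \<in> D" for e
  proof -
    from that obtain u v where uv: "(u, v) \<in> boosters ?V ?E" "e = {u, v}" by (auto simp: D_def)
    then obtain xs where xs: "gpath ?V ?E xs" "length xs = longest ?V ?E" "u = hd xs" "v = last xs"
      by (auto simp: boosters_def)
    then have "xs \<noteq> []" "length xs > 1" using l3 by auto
    then have "u \<noteq> v" using xs by (auto simp: gpath_def hd_conv_nth last_conv_nth nth_eq_iff_index_eq)
    moreover have "u \<in> ?V" "v \<in> ?V" using uv boosters_subset by blast+
    ultimately show ?thesis using uv by auto
  qed
  have finD: "finite D" using finB by (simp add: D_def)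
  have "b\<^sup>2 / 2 \<le> real (card D)"
    using card_boosters[OF V sym ex b] card_unordered_pairs_ge[OF finB] by (simp add: D_def)
  then have "b\<^sup>2 / 2 * (p\<^sup>2 * (1 - p) ^ (n - 2)) \<le> real (card D) * (p\<^sup>2 * (1 - p) ^ (n - 2))"
    using p by (intro mult_right_mono) auto
  also have "\<dots> = (\<Sum>e\<in>D. pmf (random_subset n p) e)"
    using D2 p by (simp add: pmf_random_subset)
  also have "\<dots> = subset_prob n p D"
    using finD by (simp add: measure_measure_pmf_finite)
  finally have PD: "b\<^sup>2 / 2 * (p\<^sup>2 * (1 - p) ^ (n - 2)) \<le> subset_prob n p D" .
  have mono: "?E u v \<Longrightarrow> ?E' A u v" for A u v by (simp add: adj_upd)
  have pt: "potential ?V (?E' A) \<le> potential ?V ?E - potential ?V ?E / 2 * indicator D A" for A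
  proof (cases "A \<in> D \<and> \<not> hamiltonian ?V (?E' A)")
    case False
    then show ?thesis using potential_mono[OF V, of ?E "?E' A"] mono potential_nonneg[of ?V ?E]
      by (auto simp: potential_def[of _ "?E' A"] indicator_def)
  next
    case True
    then obtain u v where uv: "(u, v) \<in> boosters ?V ?E" "A = {u, v}" by (auto simp: D_def)
    with D2[of A] True have "u \<noteq> v" by auto
    then have "?E' A u v" using uv by (simp add: adj_upd)
    with booster_improves[OF V(1) con l3 uv(1), of "?E' A"] mono True
    have less: "longest ?V ?E < longest ?V (?E' A)" by (auto simp: adj_sym[of _ _ u] adj_def)
    have "longest ?V (?E' A) \<le> n" using longest_le_card[OF V, of "?E' A"] by simp
    with less have "Suc (n - longest ?V (?E' A)) \<le> n - longest ?V ?E" by simp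
    then have "(2::real) ^ Suc (n - longest ?V (?E' A)) \<le> 2 ^ (n - longest ?V ?E)"
      by (intro power_increasing) auto
    moreover have "\<not> hamiltonian ?V ?E" using True hamiltonian_mono[of ?V ?E "?E' A"] mono by blast
    ultimately show ?thesis using True by (simp add: potential_def)
  qed
  have "subset_expectation n p (\<lambda>A. potential ?V (?E' A)) \<le>
     subset_expectation n p (\<lambda>A. potential ?V ?E - potential ?V ?E / 2 * indicator D A)"
    by (intro integral_mono pt) auto
  also have "\<dots> = potential ?V ?E - potential ?V ?E / 2 * subset_prob n p D"
    by simp
  also have "\<dots> \<le> potential ?V ?E - potential ?V ?E / 2 * (b\<^sup>2 / 2 * (p\<^sup>2 * (1 - p) ^ (n - 2)))"
    using PD potential_nonneg[of ?V ?E] by (intro diff_left_mono mult_left_mono) auto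
  finally show ?thesis by (simp add: algebra_simps)
qed

lemma expectation_features_prefix:
  fixes f :: "(nat \<Rightarrow> nat \<Rightarrow> bool) \<Rightarrow> real"
  shows "measure_pmf.expectation (features n (m + j) p) (\<lambda>F. f (adj m F)) =
         measure_pmf.expectation (features n m p) (\<lambda>F. f (adj m F))"
proof (induction j)
  case (Suc j)
  then show ?case by (simp add: expectation_features_Suc adj_upd_ge)
qed simp

text \<open>The indicator refers to the first \<open>m\<close> features alone, so it stays fixed
  while the later ones are exposed, and by monotonicity the grown graph is still connected and
  expanding. Hence \<open>potential_step\<close> applies in every round, starting from at most
  \<open>2 ^ n\<close>.\<close>

lemma expectation_potential_le:
  fixes p b :: real and n m j :: nat
  defines "q \<equiv> b\<^sup>2 * p\<^sup>2 * (1 - p) ^ (n - 2) / 4"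
  assumes n: "n \<ge> 1" and p: "0 \<le> p" "p \<le> 1" and b: "b \<ge> 1" and q: "q \<le> 1"
  shows "measure_pmf.expectation (features n (m + j) p)
     (\<lambda>F. of_bool (cut_free {..<n} (adj m F) 1 \<and> expander {..<n} (adj m F) b) *
          potential {..<n} (adj (m + j) F)) \<le> 2 ^ n * (1 - q) ^ j"
proof (induction j)
  case 0
  have "measure_pmf.expectation (features n m p)
     (\<lambda>F. of_bool (cut_free {..<n} (adj m F) 1 \<and> expander {..<n} (adj m F) b) *
          potential {..<n} (adj m F)) \<le> measure_pmf.expectation (features n m p) (\<lambda>F. 2 ^ n)"
    using potential_le[of "{..<n}"] by (intro integral_mono) (auto simp: of_bool_def)
  then show ?case by simp
next
  case (Suc j)
  let ?g = "\<lambda>F. of_bool (cut_free {..<n} (adj m F) 1 \<and> expander {..<n} (adj m F) b) :: real"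
  have pre: "adj m (F(m + j := A)) = adj m F" for F :: "nat \<Rightarrow> nat set" and A
    by (simp add: adj_upd_ge)
  have "measure_pmf.expectation (features n (m + Suc j) p)
       (\<lambda>F. ?g F * potential {..<n} (adj (m + Suc j) F)) =
     measure_pmf.expectation (features n (m + j) p)
       (\<lambda>F. ?g F * subset_expectation n p
          (\<lambda>A. potential {..<n} (adj (Suc (m + j)) (F(m + j := A)))))"
    by (simp add: expectation_features_Suc pre)
  also have "\<dots> \<le> measure_pmf.expectation (features n (m + j) p)
       (\<lambda>F. (1 - q) * (?g F * potential {..<n} (adj (m + j) F)))"
  proof (intro integral_mono)
    fix F
    show "?g F * subset_expectation n p
          (\<lambda>A. potential {..<n} (adj (Suc (m + j)) (F(m + j := A)))) \<le>
        (1 - q) * (?g F * potential {..<n} (adj (m + j) F))"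
    proof (cases "cut_free {..<n} (adj m F) 1 \<and> expander {..<n} (adj m F) b")
      case True
      have mono: "adj m F u v \<Longrightarrow> adj (m + j) F u v" for u v
        unfolding adj_def using trans_less_add1 by blast
      have "cut_free {..<n} (adj (m + j) F) 1" "expander {..<n} (adj (m + j) F) b"
        using True by (auto intro: cut_free_mono[OF _ mono] expander_mono[OF _ mono])
      from potential_step[OF n p b this] True show ?thesis
        by (simp add: q_def mult.commute)
    next
      case False
      then have g0: "?g F = 0" by (simp only: of_bool_eq)
      show ?thesis unfolding g0 by simp
    qed
  qed auto
  also have "\<dots> = (1 - q) * measure_pmf.expectation (features n (m + j) p)
       (\<lambda>F. ?g F * potential {..<n} (adj (m + j) F))" by simp
  also have "\<dots> \<le> (1 - q) * (2 ^ n * (1 - q) ^ j)"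
    using q by (intro mult_left_mono Suc.IH) auto
  finally show ?case by (simp add: algebra_simps)
qed

text \<open>Markov's inequality: a graph without a Hamilton cycle has potential at least 1.\<close>

lemma prob_hamiltonian_ge:
  fixes p b :: real and n m j :: nat
  defines "q \<equiv> b\<^sup>2 * p\<^sup>2 * (1 - p) ^ (n - 2) / 4"
  assumes n: "n \<ge> 1" and p: "0 \<le> p" "p \<le> 1" and b: "b \<ge> 1" and q: "q \<le> 1"
  shows "feature_prob n (m + j) p {F. hamiltonian {..<n} (adj (m + j) F)} \<ge>
    feature_prob n m p {F. cut_free {..<n} (adj m F) 1 \<and> expander {..<n} (adj m F) b} -
    2 ^ n * (1 - q) ^ j"
proof -
  let ?good = "\<lambda>E. cut_free {..<n} E 1 \<and> expander {..<n} E b"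
  let ?M = "features n (m + j) p"
  have "feature_prob n m p {F. ?good (adj m F)} =
     measure_pmf.expectation (features n m p) (\<lambda>F. of_bool (?good (adj m F)))"
    unfolding prob_eq_expectation_indicator by (intro arg_cong[where f = "integral\<^sup>L _"]) (auto simp: indicator_def)
  also have "\<dots> = measure_pmf.expectation ?M (\<lambda>F. of_bool (?good (adj m F)))"
    by (rule expectation_features_prefix[of n m j p "\<lambda>E. of_bool (?good E)", symmetric])
  also have "\<dots> \<le> measure_pmf.expectation ?M (\<lambda>F. indicator {F. hamiltonian {..<n} (adj (m + j) F)} F +
      of_bool (?good (adj m F)) * potential {..<n} (adj (m + j) F))"
  proof (intro integral_mono)
    fix F
    show "of_bool (?good (adj m F)) \<le> indicator {F. hamiltonian {..<n} (adj (m + j) F)} F +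
      of_bool (?good (adj m F)) * potential {..<n} (adj (m + j) F)"
      using potential_ge_1[of "{..<n}" "adj (m + j) F"] potential_nonneg[of "{..<n}" "adj (m + j) F"]
      by (cases "hamiltonian {..<n} (adj (m + j) F)") auto
  qed auto
  also have "\<dots> = measure_pmf.prob ?M {F. hamiltonian {..<n} (adj (m + j) F)} +
     measure_pmf.expectation ?M (\<lambda>F. of_bool (?good (adj m F)) * potential {..<n} (adj (m + j) F))"
    by (subst Bochner_Integration.integral_add) auto
  also have "\<dots> \<le> measure_pmf.prob ?M {F. hamiltonian {..<n} (adj (m + j) F)} + 2 ^ n * (1 - q) ^ j"
    unfolding q_def using expectation_potential_le[OF n p b] q by (intro add_left_mono) (auto simp: q_def)
  finally show ?thesis by simp
qed

subsection \<open>Connectivity and Hamilton cycles of the intersection graph\<close>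

definition feature_graph :: "nat \<Rightarrow> nat \<Rightarrow> (nat \<Rightarrow> nat set) \<Rightarrow> nat pair_pre_digraph" where
  "feature_graph n m F = intersection_graph {..<n} (\<lambda>v. {w \<in> {..<m}. v \<in> F w})"

lemma pverts_feature_graph: "pverts (feature_graph n m F) = {..<n}"
  by (simp add: feature_graph_def intersection_graph_def)

lemma parcs_feature_graph: "(u, v) \<in> parcs (feature_graph n m F) \<longleftrightarrow> u < n \<and> v < n \<and> adj m F u v"
  by (auto simp: feature_graph_def intersection_graph_def adj_def)

lemma pcas_zip: "pcas x (zip (x # xs) (xs @ [y])) y"
  by (induction xs arbitrary: x) auto

lemma pawalk_verts_zip: "pawalk_verts x (zip (x # xs) (xs @ [y])) = x # xs @ [y]"
  by (induction xs arbitrary: x) auto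

lemma hamiltonian_imp_has_hamilton_cycle:
  assumes "hamiltonian {..<n} (adj m F)"
  shows "has_hamilton_cycle (with_proj (feature_graph n m F))"
proof -
  let ?G = "feature_graph n m F"
  obtain zs where zs: "gpath {..<n} (adj m F) zs" "set zs = {..<n}" "3 \<le> length zs"
    "adj m F (last zs) (hd zs)" using assms by (auto simp: hamiltonian_def)
  obtain x xs where x: "zs = x # xs" using zs(3) by (cases zs) auto
  \<comment> \<open>Each vertex is paired with its successor, and the last one with
    \<open>x\<close>.\<close>
  define c where "c = zip (x # xs) (xs @ [x])"
  have arcs: "set c \<subseteq> parcs ?G"
  proof
    fix e assume "e \<in> set c"
    then obtain i where i: "i < length (x # xs)" "e = ((x # xs) ! i, (xs @ [x]) ! i)"
      by (auto simp: c_def in_set_conv_nth)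
    have suc: "adj m F ((x # xs) ! i) ((xs @ [x]) ! i)"
    proof (cases "i < length xs")
      case True
      then have "adj m F ((x # xs) ! i) ((x # xs) ! Suc i)"
        using zs(1) unfolding gpath_def x successively_conv_nth by auto
      with True show ?thesis by (simp add: nth_append)
    next
      case False
      with i have "i = length xs" by simp
      moreover have "last (x # xs) = (x # xs) ! length xs"
        using last_conv_nth[of "x # xs"] by (simp del: last.simps)
      ultimately show ?thesis using zs(4) unfolding x by (simp del: last.simps)
    qed
    have "(x # xs) ! i \<in> set (x # xs)" by (rule nth_mem[OF i(1)])
    moreover have "(xs @ [x]) ! i \<in> set (xs @ [x])" using i(1) by (intro nth_mem) simp
    moreover have "set (xs @ [x]) = {..<n}" "set (x # xs) = {..<n}" using zs(2) x by auto
    ultimately show "e \<in> parcs ?G" using suc i(2) by (simp only: parcs_feature_graph lessThan_iff)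
  qed
  have "pre_digraph.awalk (with_proj ?G) x c x"
    using arcs zs(2) pcas_zip[of x xs x]
    by (auto simp: pre_digraph.awalk_def cas_with_proj_eq pverts_feature_graph c_def x)
  moreover have "distinct (tl (pre_digraph.awalk_verts (with_proj ?G) x c))"
    using zs(1) by (simp add: awalk_verts_with_proj_eq c_def pawalk_verts_zip gpath_def x)
  moreover have "length c = length zs" by (simp add: c_def x)
  moreover have "fst ` set c = {..<n}"
    using zs(2) unfolding x set_map[symmetric] c_def by simp
  ultimately show ?thesis
    using zs(3) unfolding has_hamilton_cycle_def pre_digraph.cycle_def
    by (intro exI[of _ c]) (auto simp: pverts_feature_graph)
qed

text \<open>The set \<open>R\<close> reached from \<open>u\<close> after deleting \<open>S\<close>
  has its boundary inside \<open>S\<close>. The boundary therefore has fewer than \<open>k\<close>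
  vertices, and \<open>cut_free\<close> leaves nothing outside of \<open>R\<close> and
  \<open>S\<close>.\<close>

lemma cut_free_imp_k_connected:
  assumes cf: "cut_free {..<n} (adj m F) k" and kn: "k < n"
  shows "k_connected k (with_proj (feature_graph n m F))"
  unfolding k_connected_def
proof (intro conjI allI impI)
  let ?G = "with_proj (feature_graph n m F)"
  show "k < card (verts ?G)" using kn by (simp add: pverts_feature_graph)
  fix S assume S: "S \<subseteq> verts ?G" "card S < k"
  then have SV: "S \<subseteq> {..<n}" by (simp add: pverts_feature_graph)
  let ?H = "mk_symmetric (induce_subgraph ?G (verts ?G - S))"
  have verts: "verts ?H = {..<n} - S" by (auto simp: mk_symmetric_def pverts_feature_graph)
  have arcs: "(u, v) \<in> arcs_ends ?H" if "u \<in> {..<n} - S" "v \<in> {..<n} - S" "adj m F u v" for u v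
    using that by (force simp: mk_symmetric_def pverts_feature_graph parcs_feature_graph)
  have "card S < card {..<n}" using S kn by simp
  then have ne: "{..<n} - S \<noteq> {}" using SV by (metis Diff_eq_empty_iff less_irrefl subset_antisym)
  have "v \<in> {..<n} - S \<Longrightarrow> (u, v) \<in> rtrancl_on (verts ?H) (arcs_ends ?H)" if u: "u \<in> {..<n} - S" for u v
  proof -
    define R where "R = {x \<in> {..<n} - S. (u, x) \<in> rtrancl_on (verts ?H) (arcs_ends ?H)}"
    have "u \<in> R" using u unfolding R_def verts[symmetric] by auto
    have sub: "nbrs {..<n} (adj m F) R \<subseteq> S"
    proof
      fix y assume "y \<in> nbrs {..<n} (adj m F) R"
      then obtain x where x: "x \<in> R" "adj m F x y" "y < n" "y \<notin> R" by (auto simp: nbrs_def)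
      show "y \<in> S"
      proof (rule ccontr)
        assume "y \<notin> S"
        then have y: "y \<in> {..<n} - S" using x by auto
        have "(x, y) \<in> arcs_ends ?H" using x y by (intro arcs) (auto simp: R_def)
        with x(1) y have "(u, y) \<in> rtrancl_on (verts ?H) (arcs_ends ?H)"
          unfolding R_def verts[symmetric] by (auto intro: rtrancl_on_into_rtrancl_on)
        with y x(4) show False by (simp add: R_def)
      qed
    qed
    have finS: "finite S" using SV by (rule finite_subset) simp
    have "card (nbrs {..<n} (adj m F) R) < k" using card_mono[OF finS sub] S(2) by simp
    moreover have "R \<subseteq> {..<n}" "R \<noteq> {}" using \<open>u \<in> R\<close> by (auto simp: R_def)
    ultimately have "R \<union> nbrs {..<n} (adj m F) R = {..<n}" using cf unfolding cut_free_def by blast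
    with sub show "v \<in> {..<n} - S \<Longrightarrow> (u, v) \<in> rtrancl_on (verts ?H) (arcs_ends ?H)"
      by (auto simp: R_def)
  qed
  then show "Digraph_Component.connected (induce_subgraph ?G (verts ?G - S))"
    unfolding connected_def strongly_connected_def reachable_def using ne verts by auto
qed

text \<open>Deleting the neighbours of \<open>v\<close> isolates \<open>v\<close>, and since there
  are more than \<open>k\<close> vertices another one remains that is separated from it.\<close>

lemma k_connected_imp_degree:
  assumes kc: "k_connected k (with_proj (feature_graph n m F))" and v: "v < n"
  shows "k \<le> card (nbrs {..<n} (adj m F) {v})"
proof (rule ccontr)
  let ?G = "with_proj (feature_graph n m F)" and ?N = "nbrs {..<n} (adj m F) {v}"
  assume "\<not> ?thesis"
  then have c: "card ?N < k" by simp
  have sub: "?N \<subseteq> {..<n} - {v}" by (rule nbrs_subset)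
  then have "Digraph_Component.connected (induce_subgraph ?G (verts ?G - ?N))"
    using kc c unfolding k_connected_def with_proj_simps pverts_feature_graph by blast
  let ?H = "mk_symmetric (induce_subgraph ?G (verts ?G - ?N))"
  have verts: "verts ?H = {..<n} - ?N" by (auto simp: mk_symmetric_def pverts_feature_graph)
  have "k < n" using kc by (simp add: k_connected_def pverts_feature_graph)
  have finN: "finite ?N" by (rule finite_nbrs) simp
  have "card (insert v ?N) < card {..<n}" using c \<open>k < n\<close> finN by (simp add: card_insert_if)
  then obtain x where x: "x < n" "x \<noteq> v" "x \<notin> ?N"
    by (metis finN card_mono finite_insert insertI1 insertI2 lessThan_iff not_le subsetI)
  have vx: "v \<in> verts ?H" "x \<in> verts ?H" using v x sub verts by auto
  then have "(v, x) \<in> rtrancl_on (verts ?H) (arcs_ends ?H)"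
    using \<open>Digraph_Component.connected _\<close> unfolding connected_def strongly_connected_def reachable_def
    by blast
  then have "x = v"
  proof (induction rule: rtrancl_on_induct)
    case (step y z)
    then have "(v, z) \<in> arcs_ends ?H" "z \<in> verts ?H" by auto
    then have "adj m F v z" "z < n" "z \<notin> ?N" unfolding verts
      by (auto simp: mk_symmetric_def parcs_feature_graph adj_sym)
    then show ?case by (auto simp: nbrs_def adj_def)
  qed simp
  with x show False by simp
qed

lemma has_hamilton_cycle_imp_degree:
  assumes hc: "has_hamilton_cycle (with_proj (feature_graph n m F))" and v: "v < n"
  shows "2 \<le> card (nbrs {..<n} (adj m F) {v})"
proof -
  let ?G = "feature_graph n m F"
  obtain c u where c: "3 \<le> length c" "fst ` set c = {..<n}" "set c \<subseteq> parcs ?G" "pcas u c u"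
    "distinct (tl (pawalk_verts u c))"
    using hc unfolding has_hamilton_cycle_def pre_digraph.cycle_def pre_digraph.awalk_def
    by (auto simp: cas_with_proj_eq awalk_verts_with_proj_eq pverts_feature_graph)
  have verts: "pcas a es b \<Longrightarrow> pawalk_verts a es = map fst es @ [b]" for a b and es :: "(nat \<times> nat) list"
    by (induction es arbitrary: a) auto
  have nxt: "pcas a es b \<Longrightarrow> Suc i < length es \<Longrightarrow> snd (es ! i) = fst (es ! Suc i)"
    for a b i and es :: "(nat \<times> nat) list"
  proof (induction es arbitrary: a i)
    case (Cons e es)
    show ?case
    proof (cases i)
      case 0
      with Cons.prems show ?thesis by (cases es) auto
    next
      case (Suc j)
      then show ?thesis using Cons.IH[of "snd e" j] Cons.prems by auto
    qed
  qed simp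
  have lst: "pcas a es b \<Longrightarrow> es \<noteq> [] \<Longrightarrow> snd (last es) = b \<and> fst (hd es) = a" for a b and es :: "(nat \<times> nat) list"
  proof (induction es arbitrary: a)
    case (Cons e es)
    then show ?case by (cases es) auto
  qed simp
  let ?l = "length c"
  have cne: "c \<noteq> []" using c(1) by auto
  \<comment> \<open>A cycle only has to have distinct vertices after the first one. The first one
    returns as the last, so the tails of the arcs are distinct too.\<close>
  have dist: "distinct (map fst c)"
  proof -
    have "distinct (tl (map fst c) @ [u])" using c(5) cne unfolding verts[OF c(4)] by simp
    moreover have "fst (hd c) = u" using lst[OF c(4) cne] by simp
    ultimately show ?thesis using cne by (cases c) auto
  qed
  define x where "x i = fst (c ! i)" for i
  have inj: "x i \<noteq> x j" if "i < ?l" "j < ?l" "i \<noteq> j" for i j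
    using dist that by (auto simp: x_def distinct_conv_nth)
  have edge: "adj m F (x i) (x (if Suc i = ?l then 0 else Suc i))" "x i < n" if "i < ?l" for i
  proof -
    have "c ! i \<in> parcs ?G" using that c(3) nth_mem by blast
    then have "fst (c ! i) < n" "adj m F (fst (c ! i)) (snd (c ! i))"
      using parcs_feature_graph[of "fst (c ! i)" "snd (c ! i)" n m F] by auto
    moreover have "snd (c ! i) = x (if Suc i = ?l then 0 else Suc i)"
    proof (cases "Suc i = ?l")
      case True
      then have "i = ?l - 1" by linarith
      then have "c ! i = last c" using cne by (simp add: last_conv_nth)
      with lst[OF c(4) cne] True cne show ?thesis by (simp add: x_def hd_conv_nth)
    next
      case False
      with that nxt[OF c(4), of i] show ?thesis by (simp add: x_def)
    qed
    ultimately show "adj m F (x i) (x (if Suc i = ?l then 0 else Suc i))" "x i < n" by (simp_all add: x_def)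
  qed
  obtain e where "e \<in> set c" "v = fst e" using v c(2) by (metis imageE lessThan_iff)
  then obtain i where i: "i < ?l" "v = x i" by (auto simp: in_set_conv_nth x_def)
  \<comment> \<open>The cyclic successor and predecessor of \<open>v\<close>; they differ because
    the cycle has length at least 3.\<close>
  define a where "a = (if Suc i = ?l then 0 else Suc i)"
  define b where "b = (if i = 0 then ?l - 1 else i - 1)"
  have ab: "a < ?l" "b < ?l" "a \<noteq> b" "a \<noteq> i" "b \<noteq> i" "(if Suc b = ?l then 0 else Suc b) = i"
    using i c(1) unfolding a_def b_def by (auto split: if_splits)
  have "adj m F v (x a)" using edge(1)[OF i(1)] i by (simp add: a_def)
  moreover have "adj m F v (x b)" using edge(1)[OF ab(2)] ab(6) i by (simp add: adj_sym)
  ultimately have "{x a, x b} \<subseteq> nbrs {..<n} (adj m F) {v}"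
    using edge(2) ab inj i by (auto simp: nbrs_def)
  then have "card {x a, x b} \<le> card (nbrs {..<n} (adj m F) {v})" by (intro card_mono finite_nbrs) auto
  moreover have "x a \<noteq> x b" using inj ab by blast
  ultimately show ?thesis by simp
qed

subsection \<open>Vertices of low degree\<close>

lemma prob_features_all:
  "feature_prob n m p {F. \<forall>w<m. F w \<in> E w} =
     (\<Prod>w<m. subset_prob n p (E w))"
proof -
  have "{F. \<forall>w<m. F w \<in> E w} = Pi {..<m} E" by auto
  then show ?thesis unfolding features_def by (simp add: measure_Pi_pmf_Pi)
qed

definition pair_sets :: "nat \<Rightarrow> nat \<Rightarrow> nat set set" where
  "pair_sets n v = {{v, t} | t. n div 2 \<le> t \<and> t < n}"

text \<open>The sets that, as a feature, give \<open>v\<close> no neighbour.\<close>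

definition lonely_sets :: "nat \<Rightarrow> nat set set" where
  "lonely_sets v = {A. v \<notin> A \<or> A = {v}}"

definition pair_prob :: "nat \<Rightarrow> real \<Rightarrow> real" where
  "pair_prob n p = real (n - n div 2) * (p\<^sup>2 * (1 - p) ^ (n - 2))"

definition lonely_prob :: "nat \<Rightarrow> real \<Rightarrow> real" where
  "lonely_prob n p = (1 - p) + p * (1 - p) ^ (n - 1)"

definition lonely2_prob :: "nat \<Rightarrow> real \<Rightarrow> real" where
  "lonely2_prob n p = (1 - p)\<^sup>2 + 2 * (p * (1 - p) ^ (n - 1))"

lemma prob_pair_sets:
  assumes v: "v < n div 2" and p: "0 \<le> p" "p \<le> 1"
  shows "subset_prob n p (pair_sets n v) = pair_prob n p"
proof -
  have eq: "pair_sets n v = (\<lambda>t. {v, t}) ` {n div 2..<n}" by (auto simp: pair_sets_def)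
  have "subset_prob n p (pair_sets n v) =
     (\<Sum>A\<in>(\<lambda>t. {v, t}) ` {n div 2..<n}. pmf (random_subset n p) A)"
    unfolding eq by (rule measure_measure_pmf_finite) simp
  also have "\<dots> = (\<Sum>t\<in>{n div 2..<n}. pmf (random_subset n p) {v, t})"
    using v by (subst sum.reindex) (auto simp: inj_on_def doubleton_eq_iff)
  also have "\<dots> = (\<Sum>t\<in>{n div 2..<n}. p\<^sup>2 * (1 - p) ^ (n - 2))"
  proof (rule sum.cong)
    fix t assume t: "t \<in> {n div 2..<n}"
    then have "{v, t} \<subseteq> {..<n}" "card {v, t} = 2" using v by auto
    then show "pmf (random_subset n p) {v, t} = p\<^sup>2 * (1 - p) ^ (n - 2)"
      using pmf_random_subset[OF _ p] by metis
  qed simp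
  finally show ?thesis by (simp add: pair_prob_def)
qed

lemma prob_lonely_sets:
  assumes v: "v < n" and p: "0 \<le> p" "p \<le> 1"
  shows "subset_prob n p (lonely_sets v) = lonely_prob n p"
proof -
  have eq: "lonely_sets v = {A. A \<inter> {v} = {}} \<union> {{v}}" by (auto simp: lonely_sets_def)
  have "subset_prob n p (lonely_sets v) =
     subset_prob n p {A. A \<inter> {v} = {}} + subset_prob n p {{v}}"
    unfolding eq by (rule measure_pmf.finite_measure_Union) auto
  then show ?thesis using v p prob_random_subset_disjoint[of "{v}" n p]
    by (simp add: measure_pmf_single pmf_random_subset lonely_prob_def)
qed

lemma prob_lonely2_sets:
  assumes v: "v < n" "u < n" "u \<noteq> v" and p: "0 \<le> p" "p \<le> 1"
  shows "subset_prob n p (lonely_sets u \<inter> lonely_sets v) = lonely2_prob n p"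
proof -
  have eq: "lonely_sets u \<inter> lonely_sets v = {A. A \<inter> {u, v} = {}} \<union> {{u}, {v}}"
    using v by (auto simp: lonely_sets_def)
  have "subset_prob n p (lonely_sets u \<inter> lonely_sets v) =
     subset_prob n p {A. A \<inter> {u, v} = {}} + subset_prob n p {{u}, {v}}"
    unfolding eq by (rule measure_pmf.finite_measure_Union) auto
  moreover have "subset_prob n p {{u}, {v}} = 2 * (p * (1 - p) ^ (n - 1))"
    using v p by (subst measure_measure_pmf_finite) (auto simp: pmf_random_subset)
  moreover have "subset_prob n p {A. A \<inter> {u, v} = {}} = (1 - p)\<^sup>2"
    using v p prob_random_subset_disjoint[of "{u, v}" n p] by (simp add: power2_eq_square)
  ultimately show ?thesis by (simp add: lonely2_prob_def)
qed

text \<open>The vertex \<open>v\<close> gets all its neighbours from the features in \<open>I\<close>, one from each. Only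
  vertices \<open>v < n div 2\<close> are used and their neighbours are at least \<open>n div 2\<close>, so that no feature
  plays this role for two vertices.\<close>

definition low_degree_event :: "nat \<Rightarrow> nat \<Rightarrow> nat \<times> nat set \<Rightarrow> (nat \<Rightarrow> nat set) set" where
  "low_degree_event n m = (\<lambda>(v, I). {F. \<forall>w<m. F w \<in> (if w \<in> I then pair_sets n v else lonely_sets v)})"

lemma low_degree_event_degree:
  assumes "F \<in> low_degree_event n m (v, I)" "finite I"
  shows "card (nbrs V (adj m F) {v}) \<le> card I"
proof -
  have "nbrs V (adj m F) {v} \<subseteq> (\<Union>w\<in>I. (if w < m then F w - {v} else {}))"
  proof
    fix x assume "x \<in> nbrs V (adj m F) {v}"
    then obtain w where w: "w < m" "v \<in> F w" "x \<in> F w" "x \<noteq> v" by (auto simp: nbrs_def adj_def)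
    with assms(1) have "w \<in> I" by (auto simp: low_degree_event_def lonely_sets_def split: if_splits)
    with w show "x \<in> (\<Union>w\<in>I. (if w < m then F w - {v} else {}))" by auto
  qed
  moreover have 1: "finite (if w < m then F w - {v} else {}) \<and> card (if w < m then F w - {v} else {}) \<le> 1"
    if "w \<in> I" for w
  proof (cases "w < m")
    case True
    with assms(1) that have "F w \<in> pair_sets n v" by (auto simp: low_degree_event_def)
    then obtain t where "F w = {v, t}" by (auto simp: pair_sets_def)
    then have "F w - {v} \<subseteq> {t}" by auto
    then have "finite (F w - {v})" "card (F w - {v}) \<le> card {t}"
      by (rule finite_subset, simp) (rule card_mono, simp_all add: \<open>F w - {v} \<subseteq> {t}\<close>)
    with True show ?thesis by simp
  qed simp
  ultimately have "card (nbrs V (adj m F) {v}) \<le> card (\<Union>w\<in>I. (if w < m then F w - {v} else {}))"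
    using assms(2) by (intro card_mono finite_UN_I) blast+
  also have "\<dots> \<le> (\<Sum>w\<in>I. card (if w < m then F w - {v} else {}))" using assms(2) by (rule card_UN_le)
  also have "\<dots> \<le> (\<Sum>w\<in>I. 1)" using 1 by (intro sum_mono) blast
  finally show ?thesis by simp
qed

lemma prob_low_degree_event:
  assumes v: "v < n div 2" and I: "I \<subseteq> {..<m}" and p: "0 \<le> p" "p \<le> 1"
  shows "feature_prob n m p (low_degree_event n m (v, I)) =
     pair_prob n p ^ card I * lonely_prob n p ^ (m - card I)"
proof -
  have "feature_prob n m p (low_degree_event n m (v, I)) =
     (\<Prod>w<m. if w \<in> I then pair_prob n p else lonely_prob n p)"
    using v unfolding low_degree_event_def prod.case prob_features_all
    by (intro prod.cong) (auto simp: prob_pair_sets prob_lonely_sets p)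
  then show ?thesis by (simp add: prod_if_const_lessThan[OF I])
qed

text \<open>A set in \<open>pair_sets n v\<close> is never lonely for \<open>v\<close>. In the
  second moment the events of one vertex therefore contribute their diagonal terms only.\<close>

lemma low_degree_event_disjoint_same:
  assumes "I \<subseteq> {..<m}" "J \<subseteq> {..<m}" "I \<noteq> J" and v: "v < n div 2"
  shows "low_degree_event n m (v, I) \<inter> low_degree_event n m (v, J) = {}"
proof -
  have False if F: "F \<in> low_degree_event n m (v, I)" "F \<in> low_degree_event n m (v, J)"
    and w: "w \<in> I" "w \<notin> J" "w < m" for F I J w
  proof -
    have "F w \<in> pair_sets n v" "F w \<in> lonely_sets v"
      using F w by (auto simp: low_degree_event_def dest!: spec[of _ w])
    with v show False by (auto simp: pair_sets_def lonely_sets_def)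
  qed
  with assms show ?thesis by blast
qed

text \<open>A feature common to \<open>I\<close> and \<open>J\<close> would have to pair both
  \<open>u\<close> and \<open>v\<close> with a vertex of the upper half, which no two-element set
  does. For disjoint \<open>I\<close> and \<open>J\<close>, each feature in \<open>I\<close> keeps
  only its condition for \<open>u\<close> and each one in \<open>J\<close> only that for
  \<open>v\<close>; the conditions on all other features are joint.\<close>

lemma prob_low_degree_event_pair:
  assumes uv: "u < n div 2" "v < n div 2" "u \<noteq> v" and I: "I \<subseteq> {..<m}" "J \<subseteq> {..<m}"
    and c: "card I = j" "card J = j" and p: "0 \<le> p" "p \<le> 1"
  shows "feature_prob n m p (low_degree_event n m (u, I) \<inter> low_degree_event n m (v, J)) \<le>
     pair_prob n p ^ (2 * j) * lonely2_prob n p ^ (m - 2 * j)"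
proof (cases "I \<inter> J = {}")
  case False
  then obtain w where w: "w \<in> I" "w \<in> J" "w < m" using I by auto
  have "low_degree_event n m (u, I) \<inter> low_degree_event n m (v, J) = {}"
  proof (rule ccontr)
    assume "\<not> ?thesis"
    then obtain F where "F \<in> low_degree_event n m (u, I)" "F \<in> low_degree_event n m (v, J)" by blast
    with w have "F w \<in> pair_sets n u" "F w \<in> pair_sets n v"
      by (auto simp: low_degree_event_def dest!: spec[of _ w])
    with uv show False by (auto simp: pair_sets_def doubleton_eq_iff)
  qed
  then show ?thesis using p by (simp add: pair_prob_def lonely2_prob_def)
next
  case True
  define E where "E w = (if w \<in> I then pair_sets n u else if w \<in> J then pair_sets n v
     else lonely_sets u \<inter> lonely_sets v)" for w
  have fin: "finite I" "finite J" using I by (auto intro: finite_subset)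
  have card: "card (I \<union> J) = 2 * j" using True fin c by (simp add: card_Un_disjoint)
  have "feature_prob n m p (low_degree_event n m (u, I) \<inter> low_degree_event n m (v, J)) \<le>
     feature_prob n m p {F. \<forall>w<m. F w \<in> E w}"
    using True by (intro measure_pmf.finite_measure_mono) (auto simp: low_degree_event_def E_def)
  also have "\<dots> = (\<Prod>w<m. if w \<in> I \<union> J then pair_prob n p else lonely2_prob n p)"
    unfolding prob_features_all
    using uv by (intro prod.cong) (auto simp: E_def prob_pair_sets prob_lonely2_sets p)
  also have "\<dots> = pair_prob n p ^ (2 * j) * lonely2_prob n p ^ (m - 2 * j)"
    using prod_if_const_lessThan[of "I \<union> J" m] I card by simp
  finally show ?thesis .
qed

text \<open>If none of the events occurs, their number \<open>Z\<close> is 0 and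
  \<open>(Z / \<mu> - 1)^2\<close> is 1. The expectation of this square is the second moment divided
  by the squared mean, minus 1, and \<open>y\<close> bounds each row of the second moment.\<close>

lemma prob_no_event_le_second_moment:
  fixes M :: "'a pmf" and ev :: "'k \<Rightarrow> 'a set"
  assumes K: "finite K" and fin: "finite (set_pmf M)"
    and P: "\<And>a. a \<in> K \<Longrightarrow> measure_pmf.prob M (ev a) = x"
    and Q: "\<And>a. a \<in> K \<Longrightarrow> (\<Sum>b\<in>K. measure_pmf.prob M (ev a \<inter> ev b)) \<le> y"
    and pos: "real (card K) * x > 0"
  shows "measure_pmf.prob M {F. \<forall>a\<in>K. F \<notin> ev a} \<le> y / (real (card K) * x\<^sup>2) - 1"
proof -
  define \<mu> where "\<mu> = real (card K) * x"
  define Z where "Z F = (\<Sum>a\<in>K. indicator (ev a) F :: real)" for F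
  have int: "integrable (measure_pmf M) f" for f :: "'a \<Rightarrow> real"
    by (rule integrable_measure_pmf_finite[OF fin])
  have EZ: "measure_pmf.expectation M Z = \<mu>"
    unfolding Z_def[abs_def] using P by (subst Bochner_Integration.integral_sum) (auto simp: int \<mu>_def)
  have "Z F ^ 2 = (\<Sum>a\<in>K. \<Sum>b\<in>K. indicator (ev a \<inter> ev b) F)" for F
    by (simp add: Z_def power2_eq_square sum_product indicator_inter_arith)
  then have "measure_pmf.expectation M (\<lambda>F. Z F ^ 2) = (\<Sum>a\<in>K. \<Sum>b\<in>K. measure_pmf.prob M (ev a \<inter> ev b))"
    using int by simp
  also have "\<dots> \<le> (\<Sum>a\<in>K. y)" by (intro sum_mono Q)
  finally have EZ2: "measure_pmf.expectation M (\<lambda>F. Z F ^ 2) \<le> real (card K) * y" by simp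
  have mu: "\<mu> > 0" using pos by (simp add: \<mu>_def)
  have "measure_pmf.prob M {F. \<forall>a\<in>K. F \<notin> ev a} =
     measure_pmf.expectation M (indicator {F. \<forall>a\<in>K. F \<notin> ev a} :: _ \<Rightarrow> real)" by simp
  also have "\<dots> \<le> measure_pmf.expectation M (\<lambda>F. (1 / \<mu>\<^sup>2) * Z F ^ 2 - (2 / \<mu>) * Z F + 1)"
  proof (intro integral_mono int)
    fix F
    have "(1 / \<mu>\<^sup>2) * Z F ^ 2 - (2 / \<mu>) * Z F + 1 = (Z F / \<mu> - 1)\<^sup>2"
      using mu by (simp add: power2_diff power_divide)
    moreover have "Z F = 0" if "\<forall>a\<in>K. F \<notin> ev a" using that by (simp add: Z_def)
    ultimately show "indicator {F. \<forall>a\<in>K. F \<notin> ev a} F \<le> (1 / \<mu>\<^sup>2) * Z F ^ 2 - (2 / \<mu>) * Z F + 1"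
      by (auto simp: indicator_def)
  qed
  also have "\<dots> = (1 / \<mu>\<^sup>2) * measure_pmf.expectation M (\<lambda>F. Z F ^ 2) - (2 / \<mu>) * \<mu> + 1"
    using int by (simp add: EZ)
  also have "\<dots> = measure_pmf.expectation M (\<lambda>F. Z F ^ 2) / \<mu>\<^sup>2 - 1" using mu by simp
  also have "\<dots> \<le> real (card K) * y / \<mu>\<^sup>2 - 1"
    using EZ2 by (intro diff_right_mono divide_right_mono) auto
  also have "real (card K) * y / \<mu>\<^sup>2 = y / (real (card K) * x\<^sup>2)"
    using pos by (simp add: \<mu>_def power2_eq_square field_simps)
  finally show ?thesis .
qed

lemma prob_min_degree_le:
  fixes n m j :: nat and p :: real
  defines "\<mu> \<equiv> real (n div 2) * real (m choose j) * (pair_prob n p ^ j * lonely_prob n p ^ (m - j))"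
  assumes p: "0 \<le> p" "p \<le> 1" and pos: "\<mu> > 0"
  shows "feature_prob n m p {F. \<forall>v<n. Suc j \<le> card (nbrs {..<n} (adj m F) {v})} \<le>
    1 / \<mu> + lonely2_prob n p ^ (m - 2 * j) / lonely_prob n p ^ (2 * (m - j)) - 1"
proof -
  define K where "K = {..<n div 2} \<times> {I. I \<subseteq> {..<m} \<and> card I = j}"
  define x where "x = pair_prob n p ^ j * lonely_prob n p ^ (m - j)"
  define z where "z = pair_prob n p ^ (2 * j) * lonely2_prob n p ^ (m - 2 * j)"
  have finK: "finite K" by (auto simp: K_def)
  have cK: "card K = (n div 2) * (m choose j)"
    by (simp add: K_def card_cartesian_product n_subsets)
  have \<mu>: "\<mu> = real (card K) * x" by (simp add: \<mu>_def cK x_def)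
  have z: "z \<ge> 0" using p by (simp add: z_def pair_prob_def lonely2_prob_def)
  have P: "feature_prob n m p (low_degree_event n m a) = x" if "a \<in> K" for a
    using that by (auto simp: K_def x_def prob_low_degree_event p)
  \<comment> \<open>The diagonal term becomes \<open>1 / \<mu>\<close>. The other terms are at most
    \<open>z\<close>, and \<open>z / x^2\<close>, the correlation of two vertices, will tend to 1
    and cancel against the final \<open>- 1\<close>.\<close>
  have Q: "(\<Sum>b\<in>K. feature_prob n m p (low_degree_event n m a \<inter> low_degree_event n m b)) \<le>
      x + real (card K) * z" if a: "a \<in> K" for a
  proof -
    obtain v I where aI: "a = (v, I)" "v < n div 2" "I \<subseteq> {..<m}" "card I = j" using a by (auto simp: K_def)
    have "(\<Sum>b\<in>K. feature_prob n m p (low_degree_event n m a \<inter> low_degree_event n m b)) \<le>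
       (\<Sum>b\<in>K. (if b = a then x else 0) + z)"
    proof (rule sum_mono)
      fix b assume b: "b \<in> K"
      then obtain u J where bJ: "b = (u, J)" "u < n div 2" "J \<subseteq> {..<m}" "card J = j" by (auto simp: K_def)
      show "feature_prob n m p (low_degree_event n m a \<inter> low_degree_event n m b) \<le>
          (if b = a then x else 0) + z"
      proof (cases "u = v")
        case True
        show ?thesis
        proof (cases "I = J")
          case eq: True
          with True have "b = a" using aI bJ by simp
          then show ?thesis using P[OF a] z by simp
        next
          case False
          then show ?thesis
            using low_degree_event_disjoint_same[OF aI(3) bJ(3) False aI(2)] True aI(1) bJ(1) z by simp
        qed
      next
        case False
        then show ?thesis
          using prob_low_degree_event_pair[OF aI(2) bJ(2) _ aI(3) bJ(3) aI(4) bJ(4) p] aI(1) bJ(1)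
          by (simp add: z_def)
      qed
    qed
    also have "\<dots> = x + real (card K) * z" using finK a by (simp add: sum.distrib)
    finally show ?thesis .
  qed
  have "feature_prob n m p {F. \<forall>v<n. Suc j \<le> card (nbrs {..<n} (adj m F) {v})} \<le>
     feature_prob n m p {F. \<forall>a\<in>K. F \<notin> low_degree_event n m a}"
  proof (intro measure_pmf.finite_measure_mono subsetI CollectI ballI notI)
    fix F a assume F: "F \<in> {F. \<forall>v<n. Suc j \<le> card (nbrs {..<n} (adj m F) {v})}"
      and a: "a \<in> K" "F \<in> low_degree_event n m a"
    obtain v I where aI: "a = (v, I)" "v < n div 2" "I \<subseteq> {..<m}" "card I = j" using a by (auto simp: K_def)
    then have "finite I" by (auto intro: finite_subset)
    with low_degree_event_degree[of F n m v I "{..<n}"] a aI have "card (nbrs {..<n} (adj m F) {v}) \<le> j" by simp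
    moreover have "v < n" using aI by simp
    ultimately show False using F by force
  qed simp
  also have "\<dots> \<le> (x + real (card K) * z) / (real (card K) * x\<^sup>2) - 1"
    using pos finK P Q unfolding \<mu> by (intro prob_no_event_le_second_moment) auto
  also have "(x + real (card K) * z) / (real (card K) * x\<^sup>2) = 1 / \<mu> + z / x\<^sup>2"
  proof -
    have "real (card K) \<noteq> 0" "x \<noteq> 0" using pos \<mu> by (metis less_irrefl mult_zero_left mult_zero_right)+
    then show ?thesis by (simp add: \<mu> add_divide_distrib power2_eq_square)
  qed
  also have "z / x\<^sup>2 = lonely2_prob n p ^ (m - 2 * j) / lonely_prob n p ^ (2 * (m - j))"
  proof -
    have "x\<^sup>2 = pair_prob n p ^ (2 * j) * lonely_prob n p ^ (2 * (m - j))"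
      by (simp add: x_def power_mult_distrib power_mult[symmetric] mult.commute)
    moreover have "pair_prob n p ^ (2 * j) \<noteq> 0"
    proof -
      have "pair_prob n p ^ j \<noteq> 0" using pos unfolding \<mu>_def by force
      then show ?thesis by (simp add: mult.commute[of 2] power_mult)
    qed
    ultimately show ?thesis unfolding z_def by (metis mult_divide_mult_cancel_left)
  qed
  finally show ?thesis by simp
qed

subsection \<open>Asymptotics\<close>

definition bad_bound :: "nat \<Rightarrow> real \<Rightarrow> nat \<Rightarrow> nat \<Rightarrow> real" where
  "bad_bound n L s t = real n * (2 * exp 1) ^ (s + t) * L ^ (s + t - 1) *
     exp (real s * (2 - L * (1 - real (s + t) / real n - real s / (2 * real n))))"

text \<open>The quotient \<open>r ^ r / fact r\<close> is a single term of the exponential series at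
  \<open>r\<close>.\<close>

lemma power_self_le_exp_fact: "real r ^ r \<le> exp (real r) * fact r"
proof -
  have "(\<Sum>i\<in>{r}. real r ^ i /\<^sub>R fact i) \<le> (\<Sum>i. real r ^ i /\<^sub>R fact i)"
    by (rule sum_le_suminf[OF summable_exp_generic]) auto
  then have "real r ^ r / fact r \<le> exp (real r)" by (simp add: exp_def field_simps)
  then show ?thesis by (simp add: field_simps)
qed

text \<open>With \<open>r = s + t\<close> there are at most \<open>n ^ r / (fact s * fact t)\<close>
  pairs of sets. Together with \<open>r ^ r \<le> exp r * fact r\<close> and
  \<open>fact r \<le> 2 ^ r * fact s * fact t\<close> this cancels all powers of \<open>r\<close>
  and all but one of \<open>n\<close>, the exponent being \<open>r - 1\<close>.\<close>

lemma bad_pair_count_le: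
  assumes s: "s \<ge> 1" and n: "n \<ge> 1" and L: "L \<ge> 0"
  shows "real (n choose s) * real (n choose t) *
     ((real (s + t) * L / real n) ^ (s + t - 1) * exp (real s * (2 - L * c))) \<le>
     real n * (2 * exp 1) ^ (s + t) * L ^ (s + t - 1) * exp (real s * (2 - L * c))"
proof -
  define r where "r = s + t"
  obtain r' where r': "r = Suc r'" using s by (cases r) (auto simp: r_def)
  have cs: "real (n choose s) * fact s \<le> real n ^ s" "real (n choose t) * fact t \<le> real n ^ t"
    using of_nat_mono[OF binomial_fact_pow[of n s], where 'a = real]
      of_nat_mono[OF binomial_fact_pow[of n t], where 'a = real] by simp_all
  have "real (n choose s) * fact s * (real (n choose t) * fact t) \<le> real n ^ s * real n ^ t"
    using cs by (intro mult_mono) auto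
  then have C: "real (n choose s) * real (n choose t) * (fact s * fact t) \<le> real n ^ r"
    by (simp add: r_def power_add mult_ac)
  have "real (r choose s) \<le> 2 ^ r" using of_nat_mono[OF binomial_le_pow2[of r s], where 'a = real] by simp
  then have "real (r choose s) * (fact s * fact t) \<le> 2 ^ r * (fact s * fact t)"
    by (intro mult_right_mono) auto
  moreover have "fact s * fact t * (r choose s) = fact r"
    using binomial_fact_lemma[of s r] by (simp add: r_def)
  then have "real (fact s * fact t * (r choose s)) = real (fact r)" by (rule arg_cong)
  then have "real (r choose s) * (fact s * fact t) = fact r" by (simp add: mult_ac)
  ultimately have "fact r \<le> 2 ^ r * (fact s * (fact t :: real))" by simp
  then have "real r ^ r \<le> exp (real r) * (2 ^ r * (fact s * fact t))"
    using power_self_le_exp_fact[of r] by (meson exp_ge_zero mult_left_mono order_trans)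
  also have "\<dots> = (2 * exp 1) ^ r * (fact s * fact t)"
    by (simp add: power_mult_distrib exp_of_nat_mult[symmetric])
  finally have "real r ^ r \<le> (2 * exp 1) ^ r * (fact s * fact t)" .
  moreover have "real r ^ r' \<le> real r ^ r" by (rule power_increasing) (auto simp: r')
  ultimately have rr: "real r ^ r' \<le> (2 * exp 1) ^ r * (fact s * fact t)" by (rule order_trans[rotated])
  have "real (n choose s) * real (n choose t) * real r ^ r' \<le>
     real (n choose s) * real (n choose t) * ((2 * exp 1) ^ r * (fact s * fact t))"
    using rr by (intro mult_left_mono) auto
  also have "\<dots> = (2 * exp 1) ^ r * (real (n choose s) * real (n choose t) * (fact s * fact t))" by simp
  also have "\<dots> \<le> (2 * exp 1) ^ r * real n ^ r" using C by (intro mult_left_mono) auto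
  finally have main: "real (n choose s) * real (n choose t) * real r ^ r' \<le> (2 * exp 1) ^ r * real n ^ r" .
  have "real (n choose s) * real (n choose t) * (real r * L / real n) ^ r' =
     (real (n choose s) * real (n choose t) * real r ^ r') * (L ^ r' / real n ^ r')"
    by (simp add: power_mult_distrib power_divide)
  also have "\<dots> \<le> ((2 * exp 1) ^ r * real n ^ r) * (L ^ r' / real n ^ r')"
    using main L by (intro mult_right_mono) auto
  also have "\<dots> = real n * (2 * exp 1) ^ r * L ^ r'" using n by (simp add: r')
  finally have "real (n choose s) * real (n choose t) * (real r * L / real n) ^ r' \<le>
     real n * (2 * exp 1) ^ r * L ^ r'" .
  then have "real (n choose s) * real (n choose t) * (real r * L / real n) ^ r' * exp (real s * (2 - L * c)) \<le>
     real n * (2 * exp 1) ^ r * L ^ r' * exp (real s * (2 - L * c))" by (intro mult_right_mono) auto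
  then show ?thesis unfolding r_def[symmetric] r' by simp
qed

definition has_bad_pair :: "nat \<Rightarrow> nat \<Rightarrow> (nat \<times> nat) set \<Rightarrow> (nat \<Rightarrow> nat set) \<Rightarrow> bool" where
  "has_bad_pair n m J F \<longleftrightarrow> (\<exists>S T. S \<subseteq> {..<n} \<and> T \<subseteq> {..<n} \<and> S \<inter> T = {} \<and> S \<noteq> {} \<and>
     (card S, card T) \<in> J \<and> bad_pair m F S T)"

lemma prob_has_bad_pair_le:
  fixes n m :: nat and p :: real and J :: "(nat \<times> nat) set"
  defines "L \<equiv> real m * real n * p\<^sup>2"
  assumes J: "finite J" "\<And>s t. (s, t) \<in> J \<Longrightarrow> s \<ge> 1" and n: "n \<ge> 1" and p: "0 \<le> p" "p \<le> 1"
    and L: "L \<ge> 1" and Lnp: "L * (real n * p) \<le> 1"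
  shows "feature_prob n m p {F. has_bad_pair n m J F} \<le> (\<Sum>(s, t)\<in>J. bad_bound n L s t)"
proof -
  let ?M = "features n m p"
  define K where "K s = {S. S \<subseteq> {..<n} \<and> card S = s}" for s
  have finK: "finite (K s)" and cardK: "card (K s) = n choose s" for s
    by (simp_all add: K_def n_subsets)
  define ev where "ev S T = {F. S \<inter> T = {} \<and> S \<noteq> {} \<and> bad_pair m F S T}" for S T :: "nat set"
  have one: "measure_pmf.prob ?M (ev S T) \<le> (real (s + t) * L / real n) ^ (s + t - 1) *
      exp (real s * (2 - L * (1 - real (s + t) / real n - real s / (2 * real n))))"
    if "S \<in> K s" "T \<in> K t" for S T s t
  proof (cases "S \<inter> T = {} \<and> S \<noteq> {}")
    case True
    have ST: "S \<subseteq> {..<n}" "T \<subseteq> {..<n}" "card S = s" "card T = t" using that by (auto simp: K_def)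
    have "ev S T = {F. bad_pair m F S T}" using True by (simp add: ev_def)
    then show ?thesis
      using prob_bad_pair_le[OF ST(1,2) _ _ p, of m, folded L_def] True L Lnp ST(3,4) by simp
  next
    case False
    then have e: "ev S T = {}" by (auto simp: ev_def)
    show ?thesis unfolding e using L by simp
  qed
  have "measure_pmf.prob ?M {F. has_bad_pair n m J F} \<le>
     measure_pmf.prob ?M (\<Union>(s, t)\<in>J. \<Union>(S, T)\<in>K s \<times> K t. ev S T)"
  proof (intro measure_pmf.finite_measure_mono subsetI)
    fix F assume "F \<in> {F. has_bad_pair n m J F}"
    then obtain S T where "S \<in> K (card S)" "T \<in> K (card T)" "(card S, card T) \<in> J" "F \<in> ev S T"
      unfolding K_def ev_def has_bad_pair_def by blast
    then show "F \<in> (\<Union>(s, t)\<in>J. \<Union>(S, T)\<in>K s \<times> K t. ev S T)"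
      by (intro UN_I[of "(card S, card T)"]) auto
  qed simp
  also have "\<dots> \<le> (\<Sum>x\<in>J. measure_pmf.prob ?M (case x of (s, t) \<Rightarrow> \<Union>(S, T)\<in>K s \<times> K t. ev S T))"
    by (intro measure_pmf.finite_measure_subadditive_finite J) auto
  also have "\<dots> \<le> (\<Sum>x\<in>J. case x of (s, t) \<Rightarrow> bad_bound n L s t)"
  proof (rule sum_mono, clarify)
    fix s t assume st: "(s, t) \<in> J"
    let ?c = "1 - real (s + t) / real n - real s / (2 * real n)"
    have "measure_pmf.prob ?M (\<Union>(S, T)\<in>K s \<times> K t. ev S T) \<le>
       (\<Sum>x\<in>K s \<times> K t. measure_pmf.prob ?M (case x of (S, T) \<Rightarrow> ev S T))"
      using finK by (intro measure_pmf.finite_measure_subadditive_finite) auto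
    also have "\<dots> \<le> (\<Sum>x\<in>K s \<times> K t. (real (s + t) * L / real n) ^ (s + t - 1) * exp (real s * (2 - L * ?c)))"
      using one by (intro sum_mono) auto
    also have "\<dots> = real (n choose s) * real (n choose t) *
        ((real (s + t) * L / real n) ^ (s + t - 1) * exp (real s * (2 - L * ?c)))"
      by (simp add: card_cartesian_product cardK)
    also have "\<dots> \<le> bad_bound n L s t" unfolding bad_bound_def
      using bad_pair_count_le[of s n L t ?c] J(2)[OF st] n L by simp
    finally show "measure_pmf.prob ?M (\<Union>(S, T)\<in>K s \<times> K t. ev S T) \<le> bad_bound n L s t" .
  qed
  finally show ?thesis .
qed

lemma sum_power_le_half:
  fixes x :: real
  assumes "0 \<le> x" "x \<le> 1 / 2"
  shows "(\<Sum>s=2..N. x ^ s) \<le> 1"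
proof -
  have "(\<Sum>s=2..N. x ^ s) \<le> (\<Sum>s=2..N. (1 / 2) ^ s)" using assms by (intro sum_mono power_mono)
  moreover have "(\<Sum>s=2..N. (1 / 2) ^ s) + (1 / 2) ^ N \<le> (1::real)"
  proof (induction N)
    case (Suc N)
    then show ?case by (cases "N \<ge> 1") (auto simp: not_le)
  qed simp
  moreover have "(0::real) \<le> (1 / 2) ^ N" by simp
  ultimately show ?thesis by linarith
qed

text \<open>Single vertices give the main term, of the order of the expected number of vertices of
  degree below \<open>k\<close>. In \<open>exp 3\<close>, 2 is the constant of
  \<open>prob_bad_pair_le\<close> and 1 bounds the corrections of order
  \<open>L * k / n\<close>.\<close>

lemma bad_bound_1_le:
  assumes L: "L \<ge> 1" and t: "t < k" and Ln: "L * real (k + 2) \<le> real n"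
  shows "bad_bound n L 1 t \<le> (2 * exp 1) ^ k * exp 3 * (real n * L ^ (k - 1) * exp (- L))"
proof -
  have n: "real n > 0" using L Ln by (cases "n = 0") (auto simp: mult_le_0_iff)
  have "L * (real (1 + t) / real n + 1 / (2 * real n)) \<le> L * (real (k + 2) / real n)"
  proof (intro mult_left_mono)
    have "real (1 + t) / real n + 1 / (2 * real n) = (real (1 + t) + 1 / 2) / real n"
      using n by (simp add: field_simps)
    also have "\<dots> \<le> real (k + 2) / real n" using t n by (intro divide_right_mono) auto
    finally show "real (1 + t) / real n + 1 / (2 * real n) \<le> real (k + 2) / real n" .
  qed (use L in auto)
  also have "\<dots> \<le> 1" using Ln n by simp
  finally have "real (1::nat) * (2 - L * (1 - real (1 + t) / real n - real (1::nat) / (2 * real n))) \<le> 3 - L"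
    by (simp add: algebra_simps)
  then have e: "exp (real (1::nat) * (2 - L * (1 - real (1 + t) / real n - real (1::nat) / (2 * real n)))) \<le> exp 3 * exp (- L)"
    by (subst mult_exp_exp) (metis exp_le_cancel_iff uminus_add_conv_diff add.commute)
  have c1: "(1::real) \<le> 2 * exp 1" using one_le_exp_iff[of "1::real"] by linarith
  have "bad_bound n L 1 t \<le> real n * (2 * exp 1) ^ k * L ^ (k - 1) * (exp 3 * exp (- L))"
    unfolding bad_bound_def using t L c1 e
    by (intro mult_mono power_increasing) auto
  then show ?thesis by (simp add: mult_ac)
qed

text \<open>For \<open>s \<ge> 2\<close> the decay is divided: \<open>3 / 2 > 1\<close> beats the
  remaining factor \<open>n\<close> and the powers of \<open>L\<close> that depend on
  \<open>k\<close>, while \<open>s / 10\<close> leaves a geometric series in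
  \<open>s\<close>.\<close>

lemma bad_bound_cut_le:
  assumes L: "L \<ge> 1" and s: "2 \<le> s" "2 * s \<le> n" and t: "t < k" and Ln: "L * real (k + 2) \<le> real n"
    and n: "n \<ge> 20"
  shows "bad_bound n L s t \<le> real n * (2 * exp 1 * L) ^ k * exp (- (3 / 2) * L) *
     (2 * exp 4 * (L * exp (- L / 10))) ^ s"
proof -
  have n0: "real n > 0" using n by simp
  \<comment> \<open>The left-hand side is concave in \<open>s\<close> and so lies above its chord
    between \<open>s = 2\<close> and \<open>s = n / 2\<close>; \<open>n \<ge> 20\<close> bounds the
    slope of the chord from below.\<close>
  have quad: "real s * (1 - 3 * real s / (2 * real n)) \<ge> 3 / 2 + real s / 10"
  proof -
    have "0 \<le> (real s - 2) * (real n / 2 - real s)" using s by (intro mult_nonneg_nonneg) auto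
    also have "\<dots> = real s * (real n / 2 + 2) - real n - real s * real s"
      by (simp add: algebra_simps add_divide_distrib diff_divide_distrib)
    finally have "real s * real s \<le> real s * (real n / 2 + 2) - real n" by (simp only: diff_ge_0_iff_ge)
    then have "3 * (real s * real s) \<le> 3 * (real s * (real n / 2 + 2) - real n)"
      by (intro mult_left_mono) simp_all
    then have "3 * (real s * real s) / (2 * real n) \<le> 3 * (real s * (real n / 2 + 2) - real n) / (2 * real n)"
      using n0 by (intro divide_right_mono) auto
    also have "\<dots> = 3 * real s / 4 + 3 * real s / real n - 3 / 2" using n0 by (simp add: field_simps)
    finally have a: "3 * (real s * real s) / (2 * real n) \<le> 3 * real s / 4 + 3 * real s / real n - 3 / 2" .
    have "3 * real s / real n \<le> 3 * real s / 20" using n s by (intro divide_left_mono) auto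
    moreover have "real s * (1 - 3 * real s / (2 * real n)) = real s - 3 * (real s * real s) / (2 * real n)"
      by (simp add: algebra_simps)
    ultimately show ?thesis using a by linarith
  qed
  have tn: "L * real t / real n \<le> 1"
  proof -
    have "L * real t \<le> L * real (k + 2)" using L t by (intro mult_left_mono) auto
    with Ln n0 show ?thesis by simp
  qed
  have "real s * (2 - L * (1 - real (s + t) / real n - real s / (2 * real n))) =
     2 * real s - L * (real s * (1 - 3 * real s / (2 * real n))) + real s * (L * real t / real n)"
    using n0 by (simp add: field_simps)
  also have "\<dots> \<le> 2 * real s - L * (3 / 2 + real s / 10) + real s * 1"
    using quad tn L by (intro add_mono diff_mono mult_left_mono) auto
  also have "\<dots> = - (3 / 2) * L + real s * (3 - L / 10)" by (simp add: algebra_simps)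
  finally have e: "exp (real s * (2 - L * (1 - real (s + t) / real n - real s / (2 * real n)))) \<le>
      exp (- (3 / 2) * L) * exp (3 - L / 10) ^ s"
    by (simp add: exp_of_nat_mult[symmetric] mult_exp_exp)
  have c1: "(1::real) \<le> 2 * exp 1" using one_le_exp_iff[of "1::real"] by linarith
  have "bad_bound n L s t \<le> real n * (2 * exp 1) ^ (s + k) * L ^ (s + k) * (exp (- (3 / 2) * L) * exp (3 - L / 10) ^ s)"
    unfolding bad_bound_def using t L c1 e
    by (intro mult_mono power_increasing) auto
  also have "\<dots> = real n * (2 * exp 1 * L) ^ k * exp (- (3 / 2) * L) * (2 * exp 1 * L * exp (3 - L / 10)) ^ s"
    by (simp add: power_add power_mult_distrib mult_ac)
  also have "2 * exp 1 * L * exp (3 - L / 10) = 2 * exp 4 * (L * exp (- L / 10))"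
  proof -
    have "exp (1::real) * exp (3 - L / 10) = exp 4 * exp (- L / 10)" unfolding mult_exp_exp by simp
    then show ?thesis by (simp add: algebra_simps)
  qed
  finally show ?thesis .
qed

text \<open>The size restrictions keep the corrections below \<open>1 / 4\<close>, which leaves the
  decay \<open>3 / 4 * s * L\<close>. Of this, \<open>5 / 8 * s \<ge> 5 / 4\<close> beats the factor
  \<open>n\<close>, and \<open>s / 8\<close> makes a geometric series, whose base contains
  \<open>L ^ 3\<close> because \<open>s + t < 3 * s\<close>.\<close>

lemma bad_bound_expander_le:
  assumes L: "L \<ge> 1" and s: "2 \<le> s" "real s \<le> real n / 30" and t: "t < 2 * s"
  shows "bad_bound n L s t \<le> real n * exp (- (5 / 4) * L) *
     (8 * exp 5 * (L ^ 3 * exp (- L / 8))) ^ s"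
proof -
  have n0: "real n > 0" using s by simp
  have "real (s + t) / real n + real s / (2 * real n) \<le> 1 / 4"
  proof -
    have "real (s + t) / real n + real s / (2 * real n) = (2 * real (s + t) + real s) / (2 * real n)"
      using n0 by (simp add: field_simps)
    also have "\<dots> \<le> 1 / 4" using n0 t s by (simp add: field_simps)
    finally show ?thesis .
  qed
  then have "3 / 4 * L \<le> L * (1 - real (s + t) / real n - real s / (2 * real n))"
    using L mult_left_mono[of "3 / 4" "1 - real (s + t) / real n - real s / (2 * real n)" L] by simp
  then have "real s * (2 - L * (1 - real (s + t) / real n - real s / (2 * real n))) \<le>
     real s * (2 - 3 / 4 * L)" by (intro mult_left_mono) auto
  also have "\<dots> \<le> - (5 / 4) * L + real s * (2 - L / 8)"
    using s(1) L mult_right_mono[of 2 "real s" "5 / 8 * L"] by (simp add: algebra_simps)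
  finally have e: "exp (real s * (2 - L * (1 - real (s + t) / real n - real s / (2 * real n)))) \<le>
      exp (- (5 / 4) * L) * exp (2 - L / 8) ^ s"
    by (simp add: exp_of_nat_mult[symmetric] mult_exp_exp)
  have c1: "(1::real) \<le> 2 * exp 1" using one_le_exp_iff[of "1::real"] by linarith
  have "bad_bound n L s t \<le> real n * (2 * exp 1) ^ (3 * s) * L ^ (3 * s) * (exp (- (5 / 4) * L) * exp (2 - L / 8) ^ s)"
    unfolding bad_bound_def using t L c1 e
    by (intro mult_mono power_increasing) auto
  also have "\<dots> = real n * exp (- (5 / 4) * L) * ((2 * exp 1) ^ 3 * L ^ 3 * exp (2 - L / 8)) ^ s"
  proof -
    have "x * a ^ (3 * s) * b ^ (3 * s) * (y * z ^ s) = x * y * (a ^ 3 * b ^ 3 * z) ^ s" for a b x y z :: real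
      unfolding power_mult power_mult_distrib by (simp only: mult_ac)
    then show ?thesis .
  qed
  also have "(2 * exp 1) ^ 3 * L ^ 3 * exp (2 - L / 8) = 8 * exp 5 * (L ^ 3 * exp (- L / 8))"
  proof -
    have "exp (1::real) ^ 3 * exp (2 - L / 8) = exp 5 * exp (- L / 8)"
      unfolding mult_exp_exp exp_of_nat_mult[symmetric] by simp
    then show ?thesis by (simp add: power_mult_distrib algebra_simps)
  qed
  finally show ?thesis .
qed

lemma prob_features_mono_on_support:
  assumes "\<And>F. (\<And>w. F w \<subseteq> {..<n}) \<Longrightarrow> P F \<Longrightarrow> Q F"
  shows "feature_prob n m p {F. P F} \<le> feature_prob n m p {F. Q F}"
proof (intro measure_pmf.finite_measure_mono_AE AE_pmfI impI)
  fix F assume F: "F \<in> set_pmf (features n m p)" "F \<in> {F. P F}"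
  have "\<And>w. F w \<subseteq> {..<n}" using F(1) by (rule set_features)
  with assms[of F] F(2) show "F \<in> {F. Q F}" by simp
qed simp

lemma sum_bad_bound_cut_le:
  assumes L: "L \<ge> 1" and Ln: "L * real (k + 2) \<le> real n" and n: "n \<ge> 20"
    and half: "2 * exp 4 * (L * exp (- L / 10)) \<le> 1 / 2"
  shows "(\<Sum>(s, t)\<in>{1..n div 2} \<times> {..<k}. bad_bound n L s t) \<le>
    real k * ((2 * exp 1) ^ k * exp 3 * (real n * L ^ (k - 1) * exp (- L))) +
    real k * (real n * (2 * exp 1 * L) ^ k * exp (- (3 / 2) * L))"
proof -
  let ?x = "2 * exp 4 * (L * exp (- L / 10))" and ?A = "real n * (2 * exp 1 * L) ^ k * exp (- (3 / 2) * L)"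
  have x0: "0 \<le> ?x" using L by simp
  have A0: "0 \<le> ?A" using L by simp
  have "(\<Sum>(s, t)\<in>{1..n div 2} \<times> {..<k}. bad_bound n L s t) =
     (\<Sum>s=1..n div 2. \<Sum>t<k. bad_bound n L s t)" by (rule sum.cartesian_product[symmetric])
  also have "\<dots> = (\<Sum>t<k. bad_bound n L 1 t) + (\<Sum>s=2..n div 2. \<Sum>t<k. bad_bound n L s t)"
  proof -
    have "1 \<le> n div 2" using n by simp
    from sum.atLeast_Suc_atMost[OF this, of "\<lambda>s. \<Sum>t<k. bad_bound n L s t"]
    show ?thesis by (simp only: Suc_1)
  qed
  also have "\<dots> \<le> (\<Sum>t<k. (2 * exp 1) ^ k * exp 3 * (real n * L ^ (k - 1) * exp (- L))) +
      (\<Sum>s=2..n div 2. \<Sum>t<k. ?A * ?x ^ s)"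
    using bad_bound_1_le[OF L _ Ln] bad_bound_cut_le[OF L _ _ _ Ln n] by (intro add_mono sum_mono) auto
  also have "(\<Sum>s=2..n div 2. \<Sum>t<k. ?A * ?x ^ s) = real k * ?A * (\<Sum>s=2..n div 2. ?x ^ s)"
    by (simp add: sum_distrib_left mult_ac)
  also have "\<dots> \<le> real k * ?A * 1"
    using sum_power_le_half[OF x0 half] A0 by (intro mult_left_mono) auto
  finally show ?thesis by simp
qed

lemma sum_bad_bound_expander_le:
  assumes L: "L \<ge> 1" and Ln: "L * 4 \<le> real n" and n: "n \<ge> 30"
    and half: "4 * (8 * exp 5 * (L ^ 3 * exp (- L / 8))) \<le> 1 / 2"
  shows "(\<Sum>(s, t)\<in>Sigma {1..n div 30} (\<lambda>s. {..<2 * s}). bad_bound n L s t) \<le>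
    2 * ((2 * exp 1) ^ 2 * exp 3 * (real n * L * exp (- L))) + real n * exp (- (5 / 4) * L)"
proof -
  let ?x = "8 * exp 5 * (L ^ 3 * exp (- L / 8))" and ?A = "real n * exp (- (5 / 4) * L)"
  have x0: "0 \<le> 4 * ?x" using L by simp
  have A0: "0 \<le> ?A" by simp
  have "(\<Sum>(s, t)\<in>Sigma {1..n div 30} (\<lambda>s. {..<2 * s}). bad_bound n L s t) =
     (\<Sum>s=1..n div 30. \<Sum>t<2 * s. bad_bound n L s t)" by (rule sum.Sigma[symmetric]) auto
  also have "\<dots> = (\<Sum>t<2 * 1. bad_bound n L 1 t) + (\<Sum>s=2..n div 30. \<Sum>t<2 * s. bad_bound n L s t)"
  proof -
    have "1 \<le> n div 30" using n by simp
    from sum.atLeast_Suc_atMost[OF this, of "\<lambda>s. \<Sum>t<2 * s. bad_bound n L s t"]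
    show ?thesis by (simp only: Suc_1)
  qed
  also have "\<dots> \<le> (\<Sum>t<2 * (1::nat). (2 * exp 1) ^ 2 * exp 3 * (real n * L * exp (- L))) +
      (\<Sum>s=2..n div 30. ?A * (4 * ?x) ^ s)"
  proof (intro add_mono sum_mono)
    fix t :: nat assume "t \<in> {..<2 * 1}"
    then show "bad_bound n L 1 t \<le> (2 * exp 1) ^ 2 * exp 3 * (real n * L * exp (- L))"
      using bad_bound_1_le[OF L, of t 2 n] Ln by simp
  next
    fix s assume s: "s \<in> {2..n div 30}"
    then have sn: "2 \<le> s" "real s \<le> real n / 30" by auto
    have "(\<Sum>t<2 * s. bad_bound n L s t) \<le> (\<Sum>t<2 * s. ?A * ?x ^ s)"
      by (intro sum_mono bad_bound_expander_le[OF L sn]) auto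
    also have "\<dots> = real (2 * s) * (?A * ?x ^ s)" by simp
    \<comment> \<open>The number \<open>2 * s\<close> of values of \<open>t\<close> is absorbed by a
      factor 4 in the base of the geometric series.\<close>
    also have "\<dots> \<le> 4 ^ s * (?A * ?x ^ s)"
    proof (intro mult_right_mono)
      have "2 * s \<le> 4 ^ s" using sn(1) by (induction s rule: nat_induct_at_least) auto
      then show "real (2 * s) \<le> 4 ^ s" using of_nat_mono[of "2 * s" "4 ^ s", where 'a = real] by simp
    qed (use L in auto)
    also have "\<dots> = ?A * (4 * ?x) ^ s" unfolding power_mult_distrib[of 4] by (simp only: mult_ac)
    finally show "(\<Sum>t<2 * s. bad_bound n L s t) \<le> ?A * (4 * ?x) ^ s" .
  qed
  also have "(\<Sum>s=2..n div 30. ?A * (4 * ?x) ^ s) = ?A * (\<Sum>s=2..n div 30. (4 * ?x) ^ s)"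
    by (rule sum_distrib_left[symmetric])
  also have "\<dots> \<le> ?A * 1" using sum_power_le_half[OF x0 half] A0 by (intro mult_left_mono) auto
  finally show ?thesis by simp
qed

lemma prob_not_cut_free_le:
  fixes n m k :: nat and p :: real
  defines "L \<equiv> real m * real n * p\<^sup>2"
  assumes p: "0 \<le> p" "p \<le> 1" and L: "L \<ge> 1" "L * (real n * p) \<le> 1" "L * real (k + 2) \<le> real n"
    and n: "n \<ge> 20" and half: "2 * exp 4 * (L * exp (- L / 10)) \<le> 1 / 2"
  shows "feature_prob n m p {F. \<not> cut_free {..<n} (adj m F) k} \<le>
    real k * ((2 * exp 1) ^ k * exp 3 * (real n * L ^ (k - 1) * exp (- L))) +
    real k * (real n * (2 * exp 1 * L) ^ k * exp (- (3 / 2) * L))"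
proof -
  let ?J = "{1..n div 2} \<times> {..<k}"
  have "feature_prob n m p {F. \<not> cut_free {..<n} (adj m F) k} \<le>
    feature_prob n m p {F. has_bad_pair n m ?J F}"
  proof (rule prob_features_mono_on_support)
    fix F :: "nat \<Rightarrow> nat set" assume F: "\<And>w. F w \<subseteq> {..<n}" "\<not> cut_free {..<n} (adj m F) k"
    obtain S T where ST: "S \<subseteq> {..<n}" "T \<subseteq> {..<n}" "S \<inter> T = {}" "S \<noteq> {}" "2 * card S \<le> card {..<n}"
      "card T < k" "bad_pair m F S T" using not_cut_free_bad_pair[OF finite_lessThan F] .
    have "finite S" using ST(1) by (rule finite_subset) simp
    then have "1 \<le> card S" using ST(4) by (simp add: Suc_leI card_gt_0_iff)
    moreover have "card S \<le> n div 2" using ST(5) by simp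
    ultimately have "(card S, card T) \<in> ?J" using ST(6) by simp
    with ST show "has_bad_pair n m ?J F" unfolding has_bad_pair_def by blast
  qed
  also have "\<dots> \<le> (\<Sum>(s, t)\<in>?J. bad_bound n L s t)"
    unfolding L_def using p L n by (intro prob_has_bad_pair_le) (auto simp: L_def)
  also note sum_bad_bound_cut_le[OF L(1,3) n half]
  finally show ?thesis .
qed

lemma prob_not_expander_le:
  fixes n m :: nat and p :: real
  defines "L \<equiv> real m * real n * p\<^sup>2"
  assumes p: "0 \<le> p" "p \<le> 1" and L: "L \<ge> 1" "L * (real n * p) \<le> 1" "L * 4 \<le> real n"
    and n: "n \<ge> 30" and half: "4 * (8 * exp 5 * (L ^ 3 * exp (- L / 8))) \<le> 1 / 2"
  shows "feature_prob n m p {F. \<not> expander {..<n} (adj m F) (real n / 30)} \<le>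
    2 * ((2 * exp 1) ^ 2 * exp 3 * (real n * L * exp (- L))) + real n * exp (- (5 / 4) * L)"
proof -
  let ?J = "Sigma {1..n div 30} (\<lambda>s. {..<2 * s})"
  have "feature_prob n m p {F. \<not> expander {..<n} (adj m F) (real n / 30)} \<le>
    feature_prob n m p {F. has_bad_pair n m ?J F}"
  proof (rule prob_features_mono_on_support)
    fix F :: "nat \<Rightarrow> nat set" assume F: "\<And>w. F w \<subseteq> {..<n}" "\<not> expander {..<n} (adj m F) (real n / 30)"
    obtain S T where ST: "S \<subseteq> {..<n}" "T \<subseteq> {..<n}" "S \<inter> T = {}" "S \<noteq> {}" "real (card S) \<le> real n / 30"
      "card T < 2 * card S" "bad_pair m F S T" using not_expander_bad_pair[OF finite_lessThan F] .
    have "finite S" using ST(1) by (rule finite_subset) simp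
    then have "1 \<le> card S" using ST(4) by (simp add: Suc_leI card_gt_0_iff)
    moreover have "card S \<le> n div 30" using ST(5) by linarith
    ultimately have "(card S, card T) \<in> ?J" using ST(6) by simp
    with ST show "has_bad_pair n m ?J F" unfolding has_bad_pair_def by blast
  qed
  also have "\<dots> \<le> (\<Sum>(s, t)\<in>?J. bad_bound n L s t)"
    unfolding L_def using p L n by (intro prob_has_bad_pair_le) (auto simp: L_def)
  also note sum_bad_bound_expander_le[OF L(1,3) n half]
  finally show ?thesis .
qed

section \<open>Limits above the threshold\<close>

locale supercritical =
  fixes k :: nat and m :: "nat \<Rightarrow> nat" and p L w :: "nat \<Rightarrow> real" and K :: real
  assumes k: "k \<ge> 1" and K: "K \<ge> 1"
    and L_def: "\<And>n. L n = real (m n) * real n * (p n)\<^sup>2"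
    and p: "\<forall>\<^sub>F n in sequentially. 0 \<le> p n \<and> p n \<le> 1"
    and lower: "\<forall>\<^sub>F n in sequentially. ln (real n) + (real k - 1) * ln (ln (real n)) + w n \<le> L n"
    and upper: "\<forall>\<^sub>F n in sequentially. L n \<le> K * ln (real n)"
    and w: "filterlim w at_top sequentially"
    and small: "(\<lambda>n. L n * (real n * p n)) \<longlonglongrightarrow> 0"
begin

lemma ev_ge: "\<forall>\<^sub>F n in sequentially. ln (real n) \<ge> 1 \<and> w n \<ge> 0 \<and> L n \<ge> ln (real n)"
proof -
  have "\<forall>\<^sub>F n in sequentially. ln (real n) \<ge> 1" by real_asymp
  moreover have "\<forall>\<^sub>F n in sequentially. w n \<ge> 0" using w by (simp add: filterlim_at_top)
  ultimately show ?thesis using lower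
  proof eventually_elim
    case (elim n)
    then have "0 \<le> (real k - 1) * ln (ln (real n))" using k by (intro mult_nonneg_nonneg) auto
    with elim show ?case by linarith
  qed
qed

lemma L_at_top: "filterlim L at_top sequentially"
proof (rule filterlim_at_top_mono)
  show "filterlim (\<lambda>n. ln (real n)) at_top sequentially" by real_asymp
  show "\<forall>\<^sub>F n in sequentially. ln (real n) \<le> L n" using ev_ge by eventually_elim simp
qed

text \<open>The lower bound on \<open>L\<close> gives
  \<open>exp (- L) \<le> exp (- w) / (n * ln n ^ (k - 1))\<close>. The double logarithm in the
  threshold thus exactly pays for \<open>L ^ (k - 1)\<close>, which is at most
  \<open>(K * ln n) ^ (k - 1)\<close>.\<close>

lemma degree_term: "(\<lambda>n. real n * L n ^ (k - 1) * exp (- L n)) \<longlonglongrightarrow> 0"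
proof (rule tendsto_sandwich[OF _ _ tendsto_const])
  have "((\<lambda>x::real. exp (- x)) \<longlongrightarrow> 0) at_top" by real_asymp
  from tendsto_mult_right_zero[OF filterlim_compose[OF this w], of "K ^ (k - 1)"]
  show "(\<lambda>n. K ^ (k - 1) * exp (- w n)) \<longlonglongrightarrow> 0" .
  show "\<forall>\<^sub>F n in sequentially. 0 \<le> real n * L n ^ (k - 1) * exp (- L n)"
    using ev_ge by eventually_elim auto
  show "\<forall>\<^sub>F n in sequentially. real n * L n ^ (k - 1) * exp (- L n) \<le> K ^ (k - 1) * exp (- w n)"
    using ev_ge lower upper eventually_gt_at_top[of 0]
  proof eventually_elim
    case (elim n)
    let ?l = "ln (real n)"
    have l: "?l \<ge> 1" using elim by simp
    have kk: "real k - 1 = real (k - 1)" using k by simp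
    have "exp (- L n) \<le> exp (- (?l + (real k - 1) * ln ?l + w n))" using elim by simp
    also have "\<dots> = exp (- ?l) * exp (- (real (k - 1) * ln ?l)) * exp (- w n)"
      unfolding mult_exp_exp kk by simp
    also have "exp (- ?l) = 1 / real n" using elim by (simp add: exp_minus field_simps)
    also have "exp (- (real (k - 1) * ln ?l)) = 1 / ?l ^ (k - 1)"
      unfolding exp_minus exp_of_nat_mult using l by (simp add: divide_inverse)
    finally have e: "exp (- L n) \<le> 1 / real n * (1 / ?l ^ (k - 1)) * exp (- w n)" .
    have "L n ^ (k - 1) \<le> (K * ?l) ^ (k - 1)" using elim by (intro power_mono) auto
    then have "real n * L n ^ (k - 1) * exp (- L n) \<le>
       real n * (K * ?l) ^ (k - 1) * (1 / real n * (1 / ?l ^ (k - 1)) * exp (- w n))"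
      using e K l elim by (intro mult_mono) auto
    also have "\<dots> = K ^ (k - 1) * exp (- w n)"
    proof -
      have l0: "?l ^ (k - 1) \<noteq> 0" using l by simp
      have n0: "real n \<noteq> 0" using elim by simp
      have c: "a * (x * c) * (1 / a * (1 / c) * y) = x * y" if "a \<noteq> 0" "c \<noteq> 0" for a c x y :: real
        using that by simp
      show ?thesis unfolding power_mult_distrib by (rule c[OF n0 l0])
    qed
    finally show ?case .
  qed
qed

lemma ev_conditions: "\<forall>\<^sub>F n in sequentially. 0 \<le> p n \<and> p n \<le> 1 \<and> L n \<ge> 1 \<and> L n * (real n * p n) \<le> 1 \<and>
   L n * real (k + 2) \<le> real n \<and> L n * 4 \<le> real n \<and> n \<ge> 30"
proof -
  have "\<forall>\<^sub>F n in sequentially. L n * (real n * p n) < 1" using order_tendstoD(2)[OF small] by simp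
  moreover have "\<forall>\<^sub>F n in sequentially. K * ln (real n) * (real k + 6) \<le> real n" by real_asymp
  ultimately show ?thesis using ev_ge upper p eventually_ge_at_top[of 30]
  proof eventually_elim
    case (elim n)
    have "L n * (real k + 6) \<le> K * ln (real n) * (real k + 6)" using elim by (intro mult_right_mono) auto
    then have a: "L n * (real k + 6) \<le> real n" using elim(2) by (rule order_trans)
    have L0: "L n \<ge> 1" using elim by linarith
    have "L n * real (k + 2) \<le> real n" using L0 by (intro order_trans[OF _ a] mult_left_mono) auto
    moreover have "L n * 4 \<le> real n" using L0 by (intro order_trans[OF _ a] mult_left_mono) auto
    ultimately show ?case using elim L0 by simp
  qed
qed

lemma prob_not_cut_free_tendsto:
  "(\<lambda>n. feature_prob n (m n) (p n) {F. \<not> cut_free {..<n} (adj (m n) F) k}) \<longlonglongrightarrow> 0"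
proof (rule tendsto_sandwich[OF _ _ tendsto_const])
  \<comment> \<open>As \<open>L\<close> lies between \<open>ln n\<close> and
    \<open>K * ln n\<close>, this is at most a power of \<open>ln n\<close> divided by the square
    root of \<open>n\<close>.\<close>
  have "(\<lambda>n. real n * (2 * exp 1 * L n) ^ k * exp (- (3 / 2) * L n)) \<longlonglongrightarrow> 0"
  proof (rule tendsto_sandwich[OF _ _ tendsto_const])
    have "(\<lambda>n. real n powr (- 1 / 2) * ln (real n) powr real k) \<longlonglongrightarrow> 0" by real_asymp
    from tendsto_mult_right_zero[OF this, of "(2 * exp 1 * K) ^ k"]
    show "(\<lambda>n. (2 * exp 1 * K) ^ k * (real n powr (- 1 / 2) * ln (real n) powr real k)) \<longlonglongrightarrow> 0" .
    show "\<forall>\<^sub>F n in sequentially. 0 \<le> real n * (2 * exp 1 * L n) ^ k * exp (- (3 / 2) * L n)"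
      using ev_ge by eventually_elim auto
    show "\<forall>\<^sub>F n in sequentially. real n * (2 * exp 1 * L n) ^ k * exp (- (3 / 2) * L n) \<le>
        (2 * exp 1 * K) ^ k * (real n powr (- 1 / 2) * ln (real n) powr real k)"
      using ev_ge upper eventually_gt_at_top[of 0]
    proof eventually_elim
      case (elim n)
      let ?l = "ln (real n)"
      have "exp (- (3 / 2) * L n) \<le> exp (- (3 / 2) * ?l)" using elim by simp
      also have "\<dots> = real n powr (- 3 / 2)" using elim by (simp add: powr_def)
      finally have e: "exp (- (3 / 2) * L n) \<le> real n powr (- 3 / 2)" .
      have "(2 * exp 1 * L n) ^ k \<le> (2 * exp 1 * (K * ?l)) ^ k" using elim by (intro power_mono mult_left_mono) auto
      then have "real n * (2 * exp 1 * L n) ^ k * exp (- (3 / 2) * L n) \<le>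
         real n * (2 * exp 1 * (K * ?l)) ^ k * real n powr (- 3 / 2)"
        using e elim K by (intro mult_mono) auto
      also have "\<dots> = (2 * exp 1 * K) ^ k * ((real n * real n powr (- 3 / 2)) * ?l ^ k)"
        by (simp add: power_mult_distrib)
      also have "real n * real n powr (- 3 / 2) = real n powr (- 1 / 2)"
        using elim powr_add[of "real n" 1 "- 3 / 2"] by simp
      also have "?l ^ k = ?l powr real k" using elim by (intro powr_realpow[symmetric]) linarith
      finally show ?case .
    qed
  qed
  from tendsto_add[OF tendsto_mult_right_zero[OF tendsto_mult_right_zero[OF degree_term]] tendsto_mult_right_zero[OF this]]
  show "(\<lambda>n. real k * ((2 * exp 1) ^ k * exp 3 * (real n * L n ^ (k - 1) * exp (- L n))) +
    real k * (real n * (2 * exp 1 * L n) ^ k * exp (- (3 / 2) * L n))) \<longlonglongrightarrow> 0" by simp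
  have "((\<lambda>x::real. 2 * exp 4 * (x * exp (- x / 10))) \<longlongrightarrow> 0) at_top" by real_asymp
  from order_tendstoD(2)[OF filterlim_compose[OF this L_at_top], of "1 / 2"]
  have "\<forall>\<^sub>F n in sequentially. 2 * exp 4 * (L n * exp (- L n / 10)) < 1 / 2" by simp
  then show "\<forall>\<^sub>F n in sequentially. feature_prob n (m n) (p n) {F. \<not> cut_free {..<n} (adj (m n) F) k} \<le>
    real k * ((2 * exp 1) ^ k * exp 3 * (real n * L n ^ (k - 1) * exp (- L n))) +
    real k * (real n * (2 * exp 1 * L n) ^ k * exp (- (3 / 2) * L n))"
    using ev_conditions
  proof eventually_elim
    case (elim n)
    then show ?case using prob_not_cut_free_le[of "p n" "m n" n k] unfolding L_def[symmetric] by simp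
  qed
qed simp

text \<open>For a single vertex the expansion factor 2 asks for degree 2, so the main term is
  \<open>degree_term\<close> with \<open>k = 2\<close>; all larger sets are of lower order.\<close>

lemma prob_not_expander_tendsto:
  assumes "k = 2"
  shows "(\<lambda>n. feature_prob n (m n) (p n)
     {F. \<not> expander {..<n} (adj (m n) F) (real n / 30)}) \<longlonglongrightarrow> 0"
proof (rule tendsto_sandwich[OF _ _ tendsto_const])
  have "(\<lambda>n. real n * exp (- (5 / 4) * L n)) \<longlonglongrightarrow> 0"
  proof (rule tendsto_sandwich[OF _ _ tendsto_const])
    show "(\<lambda>n. real n * exp (- (5 / 4) * ln (real n))) \<longlonglongrightarrow> 0" by real_asymp
    show "\<forall>\<^sub>F n in sequentially. real n * exp (- (5 / 4) * L n) \<le> real n * exp (- (5 / 4) * ln (real n))"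
      using ev_ge by eventually_elim (intro mult_left_mono, auto)
  qed simp
  moreover have "(\<lambda>n. real n * L n * exp (- L n)) \<longlonglongrightarrow> 0" using degree_term assms by simp
  then have "(\<lambda>n. 2 * ((2 * exp 1) ^ 2 * exp 3 * (real n * L n * exp (- L n)))) \<longlonglongrightarrow> 0"
    by (intro tendsto_mult_right_zero)
  ultimately show "(\<lambda>n. 2 * ((2 * exp 1) ^ 2 * exp 3 * (real n * L n * exp (- L n))) +
      real n * exp (- (5 / 4) * L n)) \<longlonglongrightarrow> 0"
    using tendsto_add_zero by blast
  have "((\<lambda>x::real. 4 * (8 * exp 5 * (x ^ 3 * exp (- x / 8)))) \<longlongrightarrow> 0) at_top" by real_asymp
  from order_tendstoD(2)[OF filterlim_compose[OF this L_at_top], of "1 / 2"]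
  have "\<forall>\<^sub>F n in sequentially. 4 * (8 * exp 5 * (L n ^ 3 * exp (- L n / 8))) < 1 / 2" by simp
  then show "\<forall>\<^sub>F n in sequentially. feature_prob n (m n) (p n)
     {F. \<not> expander {..<n} (adj (m n) F) (real n / 30)} \<le>
    2 * ((2 * exp 1) ^ 2 * exp 3 * (real n * L n * exp (- L n))) + real n * exp (- (5 / 4) * L n)"
    using ev_conditions
  proof eventually_elim
    case (elim n)
    then show ?case using prob_not_expander_le[of "p n" "m n" n] unfolding L_def[symmetric] by simp
  qed
qed simp

end

section \<open>Estimates and limits below the threshold\<close>

lemma one_minus_power_ge:
  fixes p :: real
  assumes "0 \<le> p" "p \<le> 1"
  shows "1 - real n * p \<le> (1 - p) ^ n"
  using Bernoulli_inequality[of "- p" n] assms by simp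

lemma lonely_prob_bounds:
  assumes p: "0 \<le> p" "p \<le> 1"
  shows "1 - real n * p\<^sup>2 \<le> lonely_prob n p" "lonely_prob n p \<le> 1"
proof -
  have "1 - real n * p \<le> 1 - real (n - 1) * p" using p by (intro diff_left_mono mult_right_mono) auto
  also have "\<dots> \<le> (1 - p) ^ (n - 1)" by (rule one_minus_power_ge[OF p])
  finally have "p * (1 - real n * p) \<le> p * (1 - p) ^ (n - 1)" using p by (intro mult_left_mono)
  then show "1 - real n * p\<^sup>2 \<le> lonely_prob n p"
    by (simp add: lonely_prob_def algebra_simps power2_eq_square)
  have "p * (1 - p) ^ (n - 1) \<le> p * 1" using p by (intro mult_left_mono power_le_one) auto
  then show "lonely_prob n p \<le> 1" by (simp add: lonely_prob_def)
qed

text \<open>Two vertices are nearly independent: the exact excess over the square is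
  \<open>2 * p\<^sup>2 * a - (p * a)\<^sup>2\<close> with \<open>a = (1 - p) ^ (n - 1)\<close>. Over
  all features it adds up to order \<open>m * p\<^sup>2 = L / n\<close>.\<close>

lemma lonely2_prob_le:
  assumes p: "0 \<le> p" "p \<le> 1"
  shows "lonely2_prob n p \<le> (lonely_prob n p)\<^sup>2 + 2 * p\<^sup>2"
proof -
  define a where "a = (1 - p) ^ (n - 1)"
  have a: "0 \<le> a" "a \<le> 1" using p by (auto simp: a_def intro: power_le_one)
  have "lonely2_prob n p = (lonely_prob n p)\<^sup>2 + 2 * p\<^sup>2 * a - (p * a)\<^sup>2"
    unfolding lonely2_prob_def lonely_prob_def a_def[symmetric]
    by (simp add: power2_eq_square algebra_simps)
  also have "\<dots> \<le> (lonely_prob n p)\<^sup>2 + 2 * p\<^sup>2 * 1 - 0"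
    using a by (intro diff_mono add_left_mono mult_left_mono) auto
  finally show ?thesis by simp
qed

text \<open>Since \<open>lonely_prob\<close> is at least \<open>1 / 2\<close>, the excess
  \<open>2 * p\<^sup>2\<close> is at most \<open>8 * p\<^sup>2\<close> times its square. The powers
  then cancel up to \<open>2 * j\<close> surplus ones in the denominator and the factor
  \<open>(1 + 8 * p\<^sup>2) ^ m\<close>.\<close>

lemma lonely_ratio_le:
  assumes p: "0 \<le> p" "p \<le> 1" and np: "real n * p\<^sup>2 \<le> 1 / 2" and j: "2 * j \<le> m"
  shows "lonely2_prob n p ^ (m - 2 * j) / lonely_prob n p ^ (2 * (m - j)) \<le>
     exp (8 * (real m * p\<^sup>2)) / (1 - real n * p\<^sup>2) ^ (2 * j)"
proof -
  define y where "y = lonely_prob n p"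
  have y: "1 / 2 \<le> y" "1 - real n * p\<^sup>2 \<le> y" using lonely_prob_bounds[OF p, of n] np by (auto simp: y_def)
  have "(1 / 2)\<^sup>2 \<le> y\<^sup>2" using y by (intro power_mono) auto
  then have y2: "1 \<le> 4 * y\<^sup>2" by (simp add: power2_eq_square)
  have "lonely2_prob n p \<le> y\<^sup>2 + 2 * p\<^sup>2 * 1" using lonely2_prob_le[OF p] by (simp add: y_def)
  also have "\<dots> \<le> y\<^sup>2 + 2 * p\<^sup>2 * (4 * y\<^sup>2)" using y2 by (intro add_left_mono mult_left_mono) auto
  finally have le: "lonely2_prob n p \<le> y\<^sup>2 * (1 + 8 * p\<^sup>2)" by (simp add: algebra_simps)
  have "0 \<le> lonely2_prob n p" using p by (simp add: lonely2_prob_def)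
  then have "lonely2_prob n p ^ (m - 2 * j) \<le> (y\<^sup>2 * (1 + 8 * p\<^sup>2)) ^ (m - 2 * j)"
    by (intro power_mono le)
  also have "\<dots> = y ^ (2 * (m - 2 * j)) * (1 + 8 * p\<^sup>2) ^ (m - 2 * j)"
    by (simp add: power_mult_distrib power_mult)
  finally have "lonely2_prob n p ^ (m - 2 * j) / y ^ (2 * (m - j)) \<le>
      y ^ (2 * (m - 2 * j)) * (1 + 8 * p\<^sup>2) ^ (m - 2 * j) / y ^ (2 * (m - j))"
    using y by (intro divide_right_mono) auto
  also have e: "2 * (m - j) = 2 * (m - 2 * j) + 2 * j" using j by simp
  also have "y ^ (2 * (m - 2 * j)) * (1 + 8 * p\<^sup>2) ^ (m - 2 * j) / y ^ (2 * (m - 2 * j) + 2 * j) =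
      (1 + 8 * p\<^sup>2) ^ (m - 2 * j) / y ^ (2 * j)"
    using y by (simp add: power_add)
  also have "\<dots> \<le> exp (8 * (real m * p\<^sup>2)) / (1 - real n * p\<^sup>2) ^ (2 * j)"
  proof (intro frac_le)
    have "(1 + 8 * p\<^sup>2) ^ (m - 2 * j) \<le> (1 + 8 * p\<^sup>2) ^ m" by (intro power_increasing) auto
    also have "\<dots> \<le> exp (real m * (8 * p\<^sup>2))" by (intro one_plus_power_le_exp) (simp add: order_trans[of "-1" 0])
    finally show "(1 + 8 * p\<^sup>2) ^ (m - 2 * j) \<le> exp (8 * (real m * p\<^sup>2))" by (simp add: mult_ac)
    show "0 < (1 - real n * p\<^sup>2) ^ (2 * j)" using np by (intro zero_less_power) simp
    show "(1 - real n * p\<^sup>2) ^ (2 * j) \<le> y ^ (2 * j)" using np y by (intro power_mono) auto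
  qed auto
  finally show ?thesis unfolding e y_def .
qed

text \<open>The order \<open>n * L ^ j * exp (- L)\<close> matches the main term above the
  threshold. The 3 accounts for rounding in \<open>n div 2\<close>, the 4 for using only half of the
  vertices as partners and for \<open>(1 - p) ^ (n - 2) \<ge> 1 / 2\<close>, and the 2 in the
  exponent for the quadratic error of \<open>ln (1 - n * p\<^sup>2)\<close>.\<close>

lemma expected_low_degree_ge:
  fixes n m j :: nat and p :: real
  defines "L \<equiv> real m * real n * p\<^sup>2"
  assumes p: "0 \<le> p" "p \<le> 1" and n: "n \<ge> 3" and L: "L \<ge> 1" "L * (real n * p) \<le> 1 / 2" and j: "j \<le> m"
  shows "real n / 3 * (L / (4 * real (Suc j))) ^ j * exp (- L - 2) \<le>
    real (n div 2) * real (m choose j) * (pair_prob n p ^ j * lonely_prob n p ^ (m - j))"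
proof -
  have np: "real n * p \<le> 1 / 2"
  proof -
    have "1 * (real n * p) \<le> L * (real n * p)" using L p by (intro mult_right_mono) auto
    with L show ?thesis by simp
  qed
  have z: "real n * p\<^sup>2 \<le> 1 / 2"
  proof -
    have "real n * p * p \<le> real n * p * 1" using p by (intro mult_left_mono) auto
    with np show ?thesis by (simp add: power2_eq_square mult.assoc)
  qed
  have "real n / 3 \<le> real (n div 2)" using n by linarith
  moreover have "(real m / real (Suc j)) ^ j \<le> real (m choose j)"
  proof -
    have "(real m / real (Suc j)) ^ j \<le> (real m / real j) ^ j"
      by (cases "j = 0") (auto intro!: power_mono divide_left_mono)
    also have "\<dots> \<le> real (m choose j)" using j by (rule binomial_ge_n_over_k_pow_k)
    finally show ?thesis .
  qed
  moreover have "real n * p\<^sup>2 / 4 \<le> pair_prob n p"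
  proof -
    have "1 / 2 \<le> 1 - real n * p" using np by simp
    also have "\<dots> \<le> 1 - real (n - 2) * p" using p by (intro diff_left_mono mult_right_mono) auto
    also have "\<dots> \<le> (1 - p) ^ (n - 2)" by (rule one_minus_power_ge[OF p])
    finally have a: "1 / 2 \<le> (1 - p) ^ (n - 2)" .
    have "real n / 2 * (p\<^sup>2 * (1 / 2)) \<le> real (n - n div 2) * (p\<^sup>2 * (1 - p) ^ (n - 2))"
      using a p by (intro mult_mono mult_left_mono) auto
    then show ?thesis by (simp add: pair_prob_def)
  qed
  moreover have "exp (- L - 2) \<le> lonely_prob n p ^ (m - j)"
  proof -
    let ?z = "real n * p\<^sup>2"
    have "real m * ?z\<^sup>2 = L * (real n * p) * p" by (simp add: L_def power2_eq_square mult_ac)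
    also have "\<dots> \<le> 1 / 2 * 1" using L p by (intro mult_mono) auto
    finally have mz: "real m * ?z\<^sup>2 \<le> 1" by simp
    have "- ?z - 2 * ?z\<^sup>2 \<le> ln (1 - ?z)" using z by (intro ln_one_minus_pos_lower_bound) auto
    then have "real m * (- ?z - 2 * ?z\<^sup>2) \<le> real m * ln (1 - ?z)" by (intro mult_left_mono) auto
    moreover have "- L - 2 \<le> real m * (- ?z - 2 * ?z\<^sup>2)" using mz by (simp add: L_def algebra_simps)
    ultimately have "exp (- L - 2) \<le> exp (real m * ln (1 - ?z))" by simp
    also have "\<dots> = (1 - ?z) ^ m" using z by (simp add: exp_of_nat_mult)
    also have "\<dots> \<le> lonely_prob n p ^ m" using z lonely_prob_bounds[OF p, of n] by (intro power_mono) auto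
    also have "\<dots> \<le> lonely_prob n p ^ (m - j)"
      using z lonely_prob_bounds[OF p, of n] by (intro power_decreasing) auto
    finally show ?thesis .
  qed
  ultimately have "real n / 3 * (real m / real (Suc j)) ^ j * ((real n * p\<^sup>2 / 4) ^ j * exp (- L - 2)) \<le>
    real (n div 2) * real (m choose j) * (pair_prob n p ^ j * lonely_prob n p ^ (m - j))"
    by (intro mult_mono power_mono) (auto simp: pair_prob_def p)
  moreover have e: "(real m / real (Suc j)) ^ j * (real n * p\<^sup>2 / 4) ^ j = (L / (4 * real (Suc j))) ^ j"
    unfolding power_mult_distrib[symmetric] by (simp add: L_def mult_ac)
  moreover have "real n / 3 * (L / (4 * real (Suc j))) ^ j * exp (- L - 2) =
      real n / 3 * (real m / real (Suc j)) ^ j * ((real n * p\<^sup>2 / 4) ^ j * exp (- L - 2))"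
    unfolding e[symmetric] by (simp only: mult_ac)
  ultimately show ?thesis by (simp only:)
qed

text \<open>The assumption \<open>lower\<close> is there because the events ask for exactly
  \<open>k - 1\<close> features that bring a neighbour, which is unlikely for small
  \<open>L\<close>; it keeps \<open>L ^ (k - 1)\<close> at the order of
  \<open>ln n ^ (k - 1)\<close>.\<close>

locale subcritical =
  fixes k :: nat and m :: "nat \<Rightarrow> nat" and p L w :: "nat \<Rightarrow> real"
  assumes k: "k \<ge> 1"
    and L_def: "\<And>n. L n = real (m n) * real n * (p n)\<^sup>2"
    and p: "\<forall>\<^sub>F n in sequentially. 0 \<le> p n \<and> p n \<le> 1"
    and upper: "\<forall>\<^sub>F n in sequentially. L n \<le> ln (real n) + (real k - 1) * ln (ln (real n)) + w n"
    and lower: "\<forall>\<^sub>F n in sequentially. ln (real n) / 2 \<le> L n"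
    and w: "filterlim w at_bot sequentially"
    and small: "(\<lambda>n. L n * (real n * p n)) \<longlonglongrightarrow> 0"
begin

lemma ev_conditions: "\<forall>\<^sub>F n in sequentially. 0 \<le> p n \<and> p n \<le> 1 \<and> L n \<ge> 1 \<and> L n * (real n * p n) \<le> 1 / 2 \<and>
   n \<ge> 3 \<and> 2 * k \<le> m n \<and> real n * p n \<le> L n * (real n * p n) \<and> real n * (p n)\<^sup>2 \<le> 1 / 2"
proof -
  have "\<forall>\<^sub>F n in sequentially. L n * (real n * p n) < 1 / 2" using order_tendstoD(2)[OF small, of "1 / 2"] by simp
  moreover have "\<forall>\<^sub>F n in sequentially. 2 \<le> ln (real n)" by real_asymp
  ultimately show ?thesis using p lower eventually_ge_at_top[of "max 3 (2 * k)"]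
  proof eventually_elim
    case (elim n)
    have L1: "L n \<ge> 1" using elim by linarith
    have a: "1 * (real n * p n) \<le> L n * (real n * p n)" using L1 elim by (intro mult_right_mono) auto
    then have np: "real n * p n \<le> 1 / 2" using elim by linarith
    \<comment> \<open>The locale does not relate \<open>m n\<close> to \<open>n\<close>. That there
      are enough features follows from \<open>L n * n = m n * (n p)^2\<close> and
      \<open>n p \<le> 1\<close>.\<close>
    have "L n * real n = real (m n) * ((real n * p n) * (real n * p n))"
      by (simp add: L_def power2_eq_square)
    also have "\<dots> \<le> real (m n) * (1 * 1)" using np elim by (intro mult_left_mono mult_mono) auto
    finally have "L n * real n \<le> real (m n)" by simp
    moreover have "1 * real n \<le> L n * real n" using L1 by (intro mult_right_mono) auto
    ultimately have "n \<le> m n" by simp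
    moreover have "real n * p n * p n \<le> real n * p n * 1" using elim by (intro mult_left_mono) auto
    then have "real n * (p n)\<^sup>2 \<le> 1 / 2" using np by (simp add: power2_eq_square mult.assoc)
    ultimately show ?case using L1 a elim by auto
  qed
qed

lemma prob_min_degree_tendsto:
  "(\<lambda>n. feature_prob n (m n) (p n)
     {F. \<forall>v<n. k \<le> card (nbrs {..<n} (adj (m n) F) {v})}) \<longlonglongrightarrow> 0"
proof (rule tendsto_sandwich[OF _ _ tendsto_const])
  define j where "j = k - 1"
  have kj: "k = Suc j" using k by (simp add: j_def)
  \<comment> \<open>From \<open>expected_low_degree_ge\<close>: 3 and \<open>exp 2\<close> are its
    constants, and \<open>8 * k\<close> arises from \<open>L / (4 * k)\<close> and
    \<open>L \<ge> ln n / 2\<close>.\<close>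
  define C where "C = 3 * exp 2 * (8 * real k) ^ j"
  have np0: "(\<lambda>n. real n * p n) \<longlonglongrightarrow> 0"
  proof (rule tendsto_sandwich[OF _ _ tendsto_const small])
    show "\<forall>\<^sub>F n in sequentially. 0 \<le> real n * p n" using ev_conditions by eventually_elim simp
    show "\<forall>\<^sub>F n in sequentially. real n * p n \<le> L n * (real n * p n)" using ev_conditions by eventually_elim simp
  qed
  have np2: "(\<lambda>n. real n * (p n)\<^sup>2) \<longlonglongrightarrow> 0"
  proof (rule tendsto_sandwich[OF _ _ tendsto_const np0])
    show "\<forall>\<^sub>F n in sequentially. 0 \<le> real n * (p n)\<^sup>2" by simp
    show "\<forall>\<^sub>F n in sequentially. real n * (p n)\<^sup>2 \<le> real n * p n"
      using ev_conditions
    proof eventually_elim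
      case (elim n)
      have "real n * p n * p n \<le> real n * p n * 1" using elim by (intro mult_left_mono) auto
      then show ?case by (simp add: power2_eq_square mult.assoc)
    qed
  qed
  have mp2: "(\<lambda>n. real (m n) * (p n)\<^sup>2) \<longlonglongrightarrow> 0"
  proof (rule tendsto_sandwich[OF _ _ tendsto_const])
    show "(\<lambda>n. (ln (real n) + (real k - 1) * ln (ln (real n))) / real n) \<longlonglongrightarrow> 0" by real_asymp
    show "\<forall>\<^sub>F n in sequentially. 0 \<le> real (m n) * (p n)\<^sup>2" by simp
    have "\<forall>\<^sub>F n in sequentially. w n \<le> 0" using w by (simp add: filterlim_at_bot)
    then show "\<forall>\<^sub>F n in sequentially. real (m n) * (p n)\<^sup>2 \<le>
        (ln (real n) + (real k - 1) * ln (ln (real n))) / real n"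
      using upper eventually_gt_at_top[of 0]
    proof eventually_elim
      case (elim n)
      have "real (m n) * (p n)\<^sup>2 = L n / real n" using elim by (simp add: L_def)
      also have "\<dots> \<le> (ln (real n) + (real k - 1) * ln (ln (real n))) / real n"
        using elim by (intro divide_right_mono) auto
      finally show ?case .
    qed
  qed
  have "(\<lambda>n. exp (8 * (real (m n) * (p n)\<^sup>2)) / (1 - real n * (p n)\<^sup>2) ^ (2 * j)) \<longlonglongrightarrow> exp (8 * 0) / (1 - 0) ^ (2 * j)"
    by (intro tendsto_intros mp2 np2) auto
  moreover have "((\<lambda>x::real. exp x) \<longlongrightarrow> 0) at_bot" by real_asymp
  from tendsto_mult_right_zero[OF filterlim_compose[OF this w], of C]
  have "(\<lambda>n. C * exp (w n)) \<longlonglongrightarrow> 0" .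
  ultimately have "(\<lambda>n. C * exp (w n) + exp (8 * (real (m n) * (p n)\<^sup>2)) / (1 - real n * (p n)\<^sup>2) ^ (2 * j) - 1)
      \<longlonglongrightarrow> 0 + exp (8 * 0) / (1 - 0) ^ (2 * j) - 1"
    by (intro tendsto_add tendsto_diff tendsto_const)
  then show "(\<lambda>n. C * exp (w n) + exp (8 * (real (m n) * (p n)\<^sup>2)) / (1 - real n * (p n)\<^sup>2) ^ (2 * j) - 1) \<longlonglongrightarrow> 0"
    by simp
  have "\<forall>\<^sub>F n in sequentially. ln (real n) \<ge> 1" by real_asymp
  then show "\<forall>\<^sub>F n in sequentially. feature_prob n (m n) (p n)
     {F. \<forall>v<n. k \<le> card (nbrs {..<n} (adj (m n) F) {v})} \<le>
     C * exp (w n) + exp (8 * (real (m n) * (p n)\<^sup>2)) / (1 - real n * (p n)\<^sup>2) ^ (2 * j) - 1"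
    using ev_conditions upper lower
  proof eventually_elim
    case (elim n)
    define \<mu> where "\<mu> = real (n div 2) * real (m n choose j) *
       (pair_prob n (p n) ^ j * lonely_prob n (p n) ^ (m n - j))"
    let ?l = "ln (real n)"
    have jm: "j \<le> m n" "2 * j \<le> m n" using elim by (auto simp: kj)
    have P: "0 \<le> p n" "p n \<le> 1" using elim by auto
    have n0: "real n > 0" using elim by simp
    have l: "?l \<ge> 1" and L1: "L n \<ge> 1" using elim by auto
    have m1: "real n / 3 * (L n / (4 * real k)) ^ j * exp (- L n - 2) \<le> \<mu>"
      unfolding \<mu>_def kj L_def using elim jm by (intro expected_low_degree_ge) (auto simp: L_def)
    have "exp (- w n) / (3 * exp 2 * (8 * real k) ^ j) \<le> real n / 3 * (L n / (4 * real k)) ^ j * exp (- L n - 2)"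
    proof -
      have "exp (- L n) \<ge> exp (- (?l + real j * ln ?l + w n))" using elim by (simp add: kj)
      also have "exp (- (?l + real j * ln ?l + w n)) = exp (- ?l) * exp (- (real j * ln ?l)) * exp (- w n)"
        unfolding mult_exp_exp by simp
      also have "exp (- ?l) = 1 / real n" using n0 by (simp add: exp_minus field_simps)
      also have "exp (- (real j * ln ?l)) = 1 / ?l ^ j"
        unfolding exp_minus exp_of_nat_mult using l by (simp add: divide_inverse)
      finally have e: "1 / real n * (1 / ?l ^ j) * exp (- w n) \<le> exp (- L n)" .
      have "(?l / 2 / (4 * real k)) ^ j \<le> (L n / (4 * real k)) ^ j"
        using elim l by (intro power_mono divide_right_mono) auto
      then have "real n / 3 * (?l / 2 / (4 * real k)) ^ j * (1 / real n * (1 / ?l ^ j) * exp (- w n) * exp (- 2)) \<le>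
         real n / 3 * (L n / (4 * real k)) ^ j * (exp (- L n) * exp (- 2))"
        using e l L1 by (intro mult_mono mult_nonneg_nonneg) auto
      moreover have "real n / 3 * (?l / 2 / (4 * real k)) ^ j * (1 / real n * (1 / ?l ^ j) * exp (- w n) * exp (- 2)) =
         exp (- w n) / (3 * exp 2 * (8 * real k) ^ j)"
      proof -
        have "(?l / 2 / (4 * real k)) ^ j = ?l ^ j / (8 * real k) ^ j" by (simp add: power_divide)
        moreover have "?l ^ j \<noteq> 0" using l by simp
        moreover have "exp (- 2) = 1 / exp (2::real)" by (simp add: exp_minus field_simps)
        moreover have rearr: "a / 3 * (c / d) * (1 / a * (1 / c) * x * (1 / e)) = x / (3 * e * d)"
          if "a \<noteq> 0" "c \<noteq> 0" for a c d e x :: real using that by simp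
        ultimately show ?thesis using rearr[of "real n" "?l ^ j"] n0 by simp
      qed
      moreover have "exp (- L n) * exp (- 2) = exp (- L n - 2)" unfolding mult_exp_exp by simp
      ultimately show ?thesis by simp
    qed
    with m1 have \<mu>: "exp (- w n) / C \<le> \<mu>" by (simp add: C_def)
    have C0: "C > 0" using k by (simp add: C_def)
    then have "0 < exp (- w n) / C" by simp
    with \<mu> have pos: "\<mu> > 0" by linarith
    have "1 / \<mu> \<le> 1 / (exp (- w n) / C)" using \<mu> C0 by (intro divide_left_mono) (auto simp: pos)
    also have "\<dots> = C * exp (w n)" by (simp add: exp_minus field_simps)
    finally have 1: "1 / \<mu> \<le> C * exp (w n)" .
    have 2: "lonely2_prob n (p n) ^ (m n - 2 * j) / lonely_prob n (p n) ^ (2 * (m n - j)) \<le>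
     exp (8 * (real (m n) * (p n)\<^sup>2)) / (1 - real n * (p n)\<^sup>2) ^ (2 * j)"
      using elim jm by (intro lonely_ratio_le) auto
    from prob_min_degree_le[OF P pos[unfolded \<mu>_def], folded \<mu>_def] 1 2 show ?case by (simp add: kj)
  qed
qed simp

end

section \<open>The window of slowly growing deviations, and Hamilton cycles in it\<close>

lemma threshold_prob_mono:
  assumes "\<omega> n \<le> w n"
  shows "threshold_prob m \<omega> k n \<le> threshold_prob m w k n"
  unfolding threshold_prob_def using assms by (intro real_sqrt_le_mono divide_right_mono) auto

lemma prob_random_intersection_graph:
  "measure_pmf.prob (random_intersection_graph n m p) {G. P (with_proj G)} =
   feature_prob n m p {F. P (with_proj (feature_graph n m F))}"
  unfolding random_intersection_graph_features feature_graph_def measure_map_pmf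
  by (simp add: vimage_def)

text \<open>The bound on \<open>w\<close> confines the numerator of the radicand to between
  \<open>ln n / 2\<close> and \<open>(k + 1) * ln n\<close>, as both preceding locales require. The
  assumption on \<open>m\<close> admits any rounding of \<open>n powr \<alpha>\<close>.\<close>

locale threshold_window =
  fixes k :: nat and \<alpha> :: real and m :: "nat \<Rightarrow> nat" and w :: "nat \<Rightarrow> real"
  assumes k: "k \<ge> 1" and \<alpha>: "\<alpha> > 1"
    and m: "\<And>n. \<bar>real (m n) - real n powr \<alpha>\<bar> < 1"
    and w: "\<forall>\<^sub>F n in sequentially. \<bar>w n\<bar> \<le> ln (ln (real n))"
begin

abbreviation "q \<equiv> threshold_prob m w k"

definition "R n = ln (real n) + (real k - 1) * ln (ln (real n)) + w n"

lemma ev_basic: "\<forall>\<^sub>F n in sequentially. 0 < real n \<and> 0 < real (m n) \<and> 0 \<le> q n \<and> q n \<le> 1 \<and>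
   real (m n) * real n * (q n)\<^sup>2 = R n \<and> 1 \<le> R n \<and>
   ln (real n) / 2 \<le> R n \<and> R n \<le> (real k + 1) * ln (real n) \<and> real n powr \<alpha> - 1 \<le> real (m n)"
proof -
  have "\<forall>\<^sub>F n in sequentially. ln (real n) - ln (ln (real n)) \<ge> ln (real n) / 2" by real_asymp
  moreover have "\<forall>\<^sub>F n in sequentially. ln (ln (real n)) \<le> ln (real n)" by real_asymp
  moreover have "\<forall>\<^sub>F n in sequentially. 2 \<le> ln (real n)" by real_asymp
  moreover have "\<forall>\<^sub>F n in sequentially. 1 \<le> real n powr \<alpha> - 1" using \<alpha> by real_asymp
  moreover have "\<forall>\<^sub>F n in sequentially. (real k + 1) * ln (real n) \<le> (real n powr \<alpha> - 1) * real n"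
    using \<alpha> by real_asymp
  ultimately show ?thesis using w eventually_gt_at_top[of 0]
  proof eventually_elim
    case (elim n)
    let ?l = "ln (real n)"
    have ll: "0 \<le> ln ?l" using elim by simp
    have mn: "real n powr \<alpha> - 1 \<le> real (m n)" using m[of n] by linarith
    have a: "0 \<le> (real k - 1) * ln ?l" using k ll by (intro mult_nonneg_nonneg) auto
    have b: "(real k - 1) * ln ?l \<le> (real k - 1) * ?l" using k elim by (intro mult_left_mono) auto
    have R: "?l / 2 \<le> R n" "R n \<le> (real k + 1) * ?l"
      using a b elim unfolding R_def by (auto simp: algebra_simps)
    have R1: "R n \<ge> 1" using R elim by linarith
    have m0: "0 < real (m n)" using mn elim by linarith
    have n0: "0 < real n" using elim by simp
    have q: "q n = sqrt (R n / (real (m n) * real n))" by (simp add: threshold_prob_def R_def)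
    have q2: "(q n)\<^sup>2 = R n / (real (m n) * real n)" unfolding q using R1 m0 n0 by simp
    have "R n \<le> (real n powr \<alpha> - 1) * real n" using R elim by linarith
    also have "\<dots> \<le> real (m n) * real n" using mn by (intro mult_right_mono) auto
    finally have "q n \<le> 1" unfolding q using m0 n0 R1 by simp
    moreover have "0 \<le> q n" unfolding q using R1 m0 n0 by simp
    moreover have "real (m n) * real n * (q n)\<^sup>2 = R n" unfolding q2 using m0 n0 by simp
    ultimately show ?case using R R1 m0 n0 mn by blast
  qed
qed

text \<open>The mean size \<open>n * q n\<close> of a feature is of order at most the square root of
  \<open>n * ln n / m n\<close>. By \<open>\<alpha> > 1\<close> it decays like a power of
  \<open>n\<close>, up to logarithms, so the factor \<open>R n\<close> is harmless.\<close>

lemma small: "(\<lambda>n. R n * (real n * q n)) \<longlonglongrightarrow> 0"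
proof (rule tendsto_sandwich[OF _ _ tendsto_const])
  show "(\<lambda>n. (real k + 1) * ln (real n) *
      sqrt (real n * ((real k + 1) * ln (real n)) / (real n powr \<alpha> - 1))) \<longlonglongrightarrow> 0"
    using \<alpha> by real_asymp
  show "\<forall>\<^sub>F n in sequentially. 0 \<le> R n * (real n * q n)" using ev_basic by eventually_elim auto
  have "\<forall>\<^sub>F n in sequentially. 1 \<le> real n powr \<alpha> - 1" using \<alpha> by real_asymp
  then show "\<forall>\<^sub>F n in sequentially. R n * (real n * q n) \<le> (real k + 1) * ln (real n) *
      sqrt (real n * ((real k + 1) * ln (real n)) / (real n powr \<alpha> - 1))"
    using ev_basic
  proof eventually_elim
    case (elim n)
    have "(real n * q n)\<^sup>2 * real (m n) = real n * R n"
      using elim by (metis (no_types, lifting) mult.assoc mult.commute power2_eq_square)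
    then have "(real n * q n)\<^sup>2 = real n * R n / real (m n)" using elim by (simp add: field_simps)
    also have "\<dots> \<le> real n * ((real k + 1) * ln (real n)) / (real n powr \<alpha> - 1)"
      using elim by (intro frac_le mult_left_mono mult_nonneg_nonneg) auto
    finally have "real n * q n \<le> sqrt (real n * ((real k + 1) * ln (real n)) / (real n powr \<alpha> - 1))"
      by (rule real_le_rsqrt)
    then show ?case using elim by (intro mult_mono) auto
  qed
qed

lemma supercritical:
  assumes "filterlim w at_top sequentially"
  shows "supercritical k m q (\<lambda>n. real (m n) * real n * (q n)\<^sup>2) w (real k + 1)"
proof
  have ev: "\<forall>\<^sub>F n in sequentially. real (m n) * real n * (q n)\<^sup>2 = R n"
    using ev_basic by eventually_elim simp
  show "\<forall>\<^sub>F n in sequentially. 0 \<le> q n \<and> q n \<le> 1" using ev_basic by eventually_elim simp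
  show "\<forall>\<^sub>F n in sequentially. ln (real n) + (real k - 1) * ln (ln (real n)) + w n \<le>
      real (m n) * real n * (q n)\<^sup>2" using ev by eventually_elim (simp add: R_def)
  show "\<forall>\<^sub>F n in sequentially. real (m n) * real n * (q n)\<^sup>2 \<le> (real k + 1) * ln (real n)"
    using ev_basic by eventually_elim simp
  show "(\<lambda>n. real (m n) * real n * (q n)\<^sup>2 * (real n * q n)) \<longlonglongrightarrow> 0"
  proof (rule Lim_transform_eventually[OF small])
    show "\<forall>\<^sub>F n in sequentially. R n * (real n * q n) = real (m n) * real n * (q n)\<^sup>2 * (real n * q n)"
      using ev by eventually_elim simp
  qed
qed (use k assms in auto)

lemma subcritical:
  assumes "filterlim w at_bot sequentially"
  shows "subcritical k m q (\<lambda>n. real (m n) * real n * (q n)\<^sup>2) w"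
proof
  have ev: "\<forall>\<^sub>F n in sequentially. real (m n) * real n * (q n)\<^sup>2 = R n"
    using ev_basic by eventually_elim simp
  show "\<forall>\<^sub>F n in sequentially. 0 \<le> q n \<and> q n \<le> 1" using ev_basic by eventually_elim simp
  show "\<forall>\<^sub>F n in sequentially. real (m n) * real n * (q n)\<^sup>2 \<le>
      ln (real n) + (real k - 1) * ln (ln (real n)) + w n" using ev by eventually_elim (simp add: R_def)
  show "\<forall>\<^sub>F n in sequentially. ln (real n) / 2 \<le> real (m n) * real n * (q n)\<^sup>2"
    using ev_basic by eventually_elim simp
  show "(\<lambda>n. real (m n) * real n * (q n)\<^sup>2 * (real n * q n)) \<longlonglongrightarrow> 0"
  proof (rule Lim_transform_eventually[OF small])
    show "\<forall>\<^sub>F n in sequentially. R n * (real n * q n) = real (m n) * real n * (q n)\<^sup>2 * (real n * q n)"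
      using ev by eventually_elim simp
  qed
qed (use k assms in auto)

text \<open>Sprinkling by whole features: the reserved ones are independent of the others and have
  the same parameter \<open>q n\<close>. The exponent gained from them is of order
  \<open>n * w n\<close> and beats the \<open>2 ^ n\<close> of the initial potential as soon as
  \<open>w n\<close> exceeds a constant.\<close>

lemma prob_hamiltonian_tendsto:
  assumes k2: "k = 2" and wt: "filterlim w at_top sequentially"
  shows "(\<lambda>n. feature_prob n (m n) (q n) {F. hamiltonian {..<n} (adj (m n) F)}) \<longlonglongrightarrow> 1"
proof -
  \<comment> \<open>The last \<open>m2 n\<close> features, which use up half of \<open>w n\<close>, are reserved for the boosters.\<close>
  define m2 where "m2 n = nat \<lfloor>real (m n) * w n / (2 * R n)\<rfloor>" for n
  define m1 where "m1 n = m n - m2 n" for n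
  have w0: "\<forall>\<^sub>F n in sequentially. 0 \<le> w n" using wt by (simp add: filterlim_at_top)
  have lll: "\<forall>\<^sub>F n in sequentially. ln (ln (real n)) \<le> ln (real n) / 2" by real_asymp
  \<comment> \<open>A single feature contributes \<open>n * (q n)\<^sup>2 \<le> 1\<close> to the
    sum, so rounding \<open>m2 n\<close> down costs at most 1.\<close>
  have split: "\<forall>\<^sub>F n in sequentially. m n = m1 n + m2 n \<and> real (m2 n) * real n * (q n)\<^sup>2 \<le> w n / 2 \<and>
     w n / 2 - 1 \<le> real (m2 n) * real n * (q n)\<^sup>2"
    using ev_basic w0 w lll order_tendstoD(2)[OF small, of 1, simplified]
  proof eventually_elim
    case (elim n)
    let ?x = "real (m n) * w n / (2 * R n)"
    have R1: "R n \<ge> 1" and m0: "real (m n) > 0" and q0: "0 \<le> q n" "q n \<le> 1" and n0: "real n > 0"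
      and RL: "real (m n) * real n * (q n)\<^sup>2 = R n" using elim by auto
    have x0: "0 \<le> ?x" using elim by auto
    have "w n \<le> R n" using elim by linarith
    then have "?x \<le> real (m n) * R n / (2 * R n)" using R1 by (intro divide_right_mono mult_left_mono) auto
    also have "\<dots> = real (m n) / 2" using R1 by simp
    also have "\<dots> \<le> real (m n)" by simp
    finally have xm: "?x \<le> real (m n)" .
    have m2: "real (m2 n) \<le> ?x" "?x - 1 \<le> real (m2 n)" using x0 unfolding m2_def by linarith+
    then have le: "m2 n \<le> m n" using xm by linarith
    have y: "real n * (q n)\<^sup>2 = R n / real (m n)" using RL m0 by (simp add: field_simps)
    have xy: "?x * (real n * (q n)\<^sup>2) = w n / 2" unfolding y using m0 R1 by simp
    have y1: "real n * (q n)\<^sup>2 \<le> 1"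
    proof -
      have "1 * (real n * q n) \<le> R n * (real n * q n)" using R1 q0 by (intro mult_right_mono) auto
      then have "real n * q n \<le> 1" using elim by linarith
      moreover have "real n * q n * q n \<le> real n * q n * 1" using q0 by (intro mult_left_mono) auto
      ultimately show ?thesis by (simp add: power2_eq_square mult.assoc)
    qed
    have "real (m2 n) * (real n * (q n)\<^sup>2) \<le> ?x * (real n * (q n)\<^sup>2)" using m2 by (intro mult_right_mono) auto
    moreover have "(?x - 1) * (real n * (q n)\<^sup>2) \<le> real (m2 n) * (real n * (q n)\<^sup>2)" using m2 by (intro mult_right_mono) auto
    moreover have "(?x - 1) * (real n * (q n)\<^sup>2) = w n / 2 - real n * (q n)\<^sup>2" using xy by (simp add: algebra_simps)
    ultimately show ?case using le xy y1 by (auto simp: m1_def mult.assoc)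
  qed
  \<comment> \<open>Half of \<open>w n\<close> still tends to infinity, so the first
    \<open>m1 n\<close> features are above the threshold by themselves. Because of the rounding,
    their share of \<open>R n\<close> is known only up to inequalities.\<close>
  interpret S: supercritical k m1 q "\<lambda>n. real (m1 n) * real n * (q n)\<^sup>2" "\<lambda>n. w n / 2" "real k + 1"
  proof
    have d: "real (m1 n) * real n * (q n)\<^sup>2 = real (m n) * real n * (q n)\<^sup>2 - real (m2 n) * real n * (q n)\<^sup>2"
      if "m n = m1 n + m2 n" for n using that by (simp add: algebra_simps)
    show "\<forall>\<^sub>F n in sequentially. 0 \<le> q n \<and> q n \<le> 1" using ev_basic by eventually_elim simp
    show "\<forall>\<^sub>F n in sequentially. ln (real n) + (real k - 1) * ln (ln (real n)) + w n / 2 \<le>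
        real (m1 n) * real n * (q n)\<^sup>2" using ev_basic split
    proof eventually_elim
      case (elim n)
      have "real (m1 n) * real n * (q n)\<^sup>2 \<ge> R n - w n / 2" using d[of n] elim by linarith
      then show ?case by (simp add: R_def)
    qed
    have le: "\<forall>\<^sub>F n in sequentially. real (m1 n) * real n * (q n)\<^sup>2 \<le> R n" using ev_basic split
    proof eventually_elim
      case (elim n)
      have "0 \<le> real (m2 n) * real n * (q n)\<^sup>2" by simp
      with d[of n] elim show ?case by linarith
    qed
    then show "\<forall>\<^sub>F n in sequentially. real (m1 n) * real n * (q n)\<^sup>2 \<le> (real k + 1) * ln (real n)"
      using ev_basic by eventually_elim linarith
    show "filterlim (\<lambda>n. w n / 2) at_top sequentially"
      using filterlim_tendsto_pos_mult_at_top[OF tendsto_const _ wt, of "1 / 2"] by simp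
    show "(\<lambda>n. real (m1 n) * real n * (q n)\<^sup>2 * (real n * q n)) \<longlonglongrightarrow> 0"
    proof (rule tendsto_sandwich[OF _ _ tendsto_const small])
      show "\<forall>\<^sub>F n in sequentially. 0 \<le> real (m1 n) * real n * (q n)\<^sup>2 * (real n * q n)"
        using ev_basic by eventually_elim simp
      show "\<forall>\<^sub>F n in sequentially. real (m1 n) * real n * (q n)\<^sup>2 * (real n * q n) \<le> R n * (real n * q n)"
        using ev_basic le by eventually_elim (intro mult_right_mono, auto)
    qed
  qed (use k in auto)
  let ?P1 = "\<lambda>n. feature_prob n (m1 n) (q n) {F. \<not> cut_free {..<n} (adj (m1 n) F) k}"
  let ?P2 = "\<lambda>n. feature_prob n (m1 n) (q n) {F. \<not> expander {..<n} (adj (m1 n) F) (real n / 30)}"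
  have lim: "(\<lambda>n. 1 - (?P1 n + ?P2 n) - exp (- real n)) \<longlonglongrightarrow> 1 - (0 + 0) - 0"
  proof (intro tendsto_diff tendsto_add tendsto_const S.prob_not_cut_free_tendsto S.prob_not_expander_tendsto k2)
    show "(\<lambda>n. exp (- real n)) \<longlonglongrightarrow> 0" by real_asymp
  qed
  \<comment> \<open>\<open>28802 = 2 * (2 * 7200 + 1)\<close> makes the exponent gained from the reserved features at least \<open>2 * n\<close>;
    \<open>7200 = 30\<^sup>2 * 8\<close> comes from the number of boosters.\<close>
  have "\<forall>\<^sub>F n in sequentially. 28802 \<le> w n" using wt by (simp add: filterlim_at_top)
  then have "\<forall>\<^sub>F n in sequentially. 1 - (?P1 n + ?P2 n) - exp (- real n) \<le>
     feature_prob n (m n) (q n) {F. hamiltonian {..<n} (adj (m n) F)}"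
    using split ev_basic eventually_ge_at_top[of 30] S.ev_conditions order_tendstoD(2)[OF small, of "1 / 2", simplified]
  proof eventually_elim
    case (elim n)
    let ?M = "features n (m1 n) (q n)"
    define b where "b = real n / 30"
    define r where "r = b\<^sup>2 * (q n)\<^sup>2 * (1 - q n) ^ (n - 2) / 4"
    have q0: "0 \<le> q n" "q n \<le> 1" using elim by auto
    have b1: "b \<ge> 1" using elim by (simp add: b_def)
    have np: "real n * q n \<le> 1 / 2"
    proof -
      have "1 * (real n * q n) \<le> R n * (real n * q n)" using elim by (intro mult_right_mono) auto
      then show ?thesis using elim by linarith
    qed
    have "1 / 2 \<le> 1 - real n * q n" using np by simp
    also have "\<dots> \<le> 1 - real (n - 2) * q n" using q0 by (intro diff_left_mono mult_right_mono) auto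
    also have "\<dots> \<le> (1 - q n) ^ (n - 2)" by (rule one_minus_power_ge[OF q0])
    finally have pw: "1 / 2 \<le> (1 - q n) ^ (n - 2)" .
    have r_ge: "real n * (real n * (q n)\<^sup>2) / 7200 \<le> r"
    proof -
      have "b\<^sup>2 * (q n)\<^sup>2 * (1 / 2) \<le> b\<^sup>2 * (q n)\<^sup>2 * (1 - q n) ^ (n - 2)" using pw by (intro mult_left_mono) auto
      then show ?thesis by (simp add: r_def b_def power2_eq_square)
    qed
    have r1: "r \<le> 1"
    proof -
      have "b * q n \<le> real n * q n" using q0 by (intro mult_right_mono) (auto simp: b_def)
      then have bq: "b * q n \<le> 1" using np by linarith
      have "(b * q n)\<^sup>2 \<le> 1\<^sup>2" using bq b1 q0 by (intro power_mono) auto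
      then have "b\<^sup>2 * (q n)\<^sup>2 * (1 - q n) ^ (n - 2) \<le> 1 * 1"
        using q0 by (intro mult_mono power_le_one) (auto simp: power_mult_distrib)
      then show ?thesis by (simp add: r_def)
    qed
    have "2 ^ n * (1 - r) ^ m2 n \<le> exp (real n) * exp (- (real (m2 n) * r))"
    proof (intro mult_mono)
      show "(1 - r) ^ m2 n \<le> exp (- (real (m2 n) * r))"
        using one_plus_power_le_exp[of "- r" "m2 n"] r1 by simp
      show "2 ^ n \<le> exp (real n)" using one_plus_power_le_exp[of 1 n] by simp
    qed (use r1 in auto)
    also have "real (m2 n) * r \<ge> 2 * real n"
    proof -
      have "14400 \<le> real (m2 n) * real n * (q n)\<^sup>2" using elim by linarith
      then have "real n * 14400 / 7200 \<le> real n * (real (m2 n) * real n * (q n)\<^sup>2) / 7200"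
        by (intro divide_right_mono mult_left_mono) auto
      also have "\<dots> = real (m2 n) * (real n * (real n * (q n)\<^sup>2) / 7200)" by simp
      also have "\<dots> \<le> real (m2 n) * r" using r_ge by (intro mult_left_mono) auto
      finally show ?thesis by simp
    qed
    then have "exp (real n) * exp (- (real (m2 n) * r)) \<le> exp (- real n)"
      unfolding mult_exp_exp by simp
    finally have fail: "2 ^ n * (1 - r) ^ m2 n \<le> exp (- real n)" .
    let ?C = "{F. cut_free {..<n} (adj (m1 n) F) k}" and ?X = "{F. expander {..<n} (adj (m1 n) F) b}"
    have "1 - (?P1 n + ?P2 n) \<le> measure_pmf.prob ?M (?C \<inter> ?X)"
    proof -
      have "measure_pmf.prob ?M (- (?C \<inter> ?X)) \<le> measure_pmf.prob ?M (- ?C \<union> - ?X)"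
        by (intro measure_pmf.finite_measure_mono) auto
      also have "\<dots> \<le> measure_pmf.prob ?M (- ?C) + measure_pmf.prob ?M (- ?X)"
        by (rule measure_Un_le) auto
      finally show ?thesis
        using measure_pmf.prob_compl[of "?C \<inter> ?X" ?M]
        by (simp add: Collect_neg_eq b_def Compl_eq_Diff_UNIV)
    qed
    also have "\<dots> \<le> measure_pmf.prob ?M {F. cut_free {..<n} (adj (m1 n) F) 1 \<and> expander {..<n} (adj (m1 n) F) b}"
    proof (intro measure_pmf.finite_measure_mono subsetI)
      fix F assume F: "F \<in> ?C \<inter> ?X"
      then have "cut_free {..<n} (adj (m1 n) F) 1" using k unfolding cut_free_def by force
      with F show "F \<in> {F. cut_free {..<n} (adj (m1 n) F) 1 \<and> expander {..<n} (adj (m1 n) F) b}" by simp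
    qed simp
    finally have good: "1 - (?P1 n + ?P2 n) \<le> \<dots>" .
    have "measure_pmf.prob ?M {F. cut_free {..<n} (adj (m1 n) F) 1 \<and> expander {..<n} (adj (m1 n) F) b} -
        2 ^ n * (1 - r) ^ m2 n \<le>
       feature_prob n (m1 n + m2 n) (q n) {F. hamiltonian {..<n} (adj (m1 n + m2 n) F)}"
      using prob_hamiltonian_ge[OF _ q0 b1, of n "m1 n" "m2 n"] r1 elim(4) unfolding r_def by simp
    moreover have "m n = m1 n + m2 n" using elim by blast
    ultimately show ?case using fail good by simp
  qed
  then show ?thesis
  proof (rule tendsto_sandwich)
    show "(\<lambda>n. 1 - (?P1 n + ?P2 n) - exp (- real n)) \<longlonglongrightarrow> 1" using lim by simp
    show "\<forall>\<^sub>F n in sequentially. feature_prob n (m n) (q n)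
       {F. hamiltonian {..<n} (adj (m n) F)} \<le> 1" by simp
  qed simp
qed

end

section \<open>Arbitrary omega and the conclusion\<close>

lemma prob_not_tendsto_1:
  assumes "\<forall>\<^sub>F n in sequentially. measure_pmf.prob (M n) {x. P n x} \<le> u n" and "u \<longlonglongrightarrow> 0"
  shows "(\<lambda>n. measure_pmf.prob (M n) {x. \<not> P n x}) \<longlonglongrightarrow> 1"
proof (rule tendsto_sandwich[OF _ _ _ tendsto_const])
  have "measure_pmf.prob (M n) {x. \<not> P n x} = 1 - measure_pmf.prob (M n) {x. P n x}" for n
    using measure_pmf.prob_compl[of "{x. P n x}" "M n"] by (simp add: Collect_neg_eq Compl_eq_Diff_UNIV)
  with assms(1) show "\<forall>\<^sub>F n in sequentially. 1 - u n \<le> measure_pmf.prob (M n) {x. \<not> P n x}"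
    by (auto elim: eventually_mono)
  show "(\<lambda>n. 1 - u n) \<longlonglongrightarrow> 1" using tendsto_diff[OF tendsto_const assms(2), of 1] by simp
qed simp

text \<open>Raising \<open>\<omega>\<close> to \<open>w = max \<omega> (- ln (ln n))\<close> raises
  the probability of this increasing event, and \<open>w\<close> still tends to minus infinity. So
  the limit 0 inside the window suffices.\<close>

lemma prob_min_degree_below_threshold:
  fixes k :: nat and \<alpha> :: real and m :: "nat \<Rightarrow> nat" and \<omega> :: "nat \<Rightarrow> real"
  assumes k: "k \<ge> 1" and \<alpha>: "\<alpha> > 1" and m: "\<And>n. \<bar>real (m n) - real n powr \<alpha>\<bar> < 1"
    and p: "\<forall>\<^sub>F n in sequentially. threshold_prob m \<omega> k n \<in> {0..1}"
    and \<omega>: "filterlim \<omega> at_bot sequentially"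
  shows "(\<lambda>n. feature_prob n (m n) (threshold_prob m \<omega> k n)
     {F. \<forall>v<n. k \<le> card (nbrs {..<n} (adj (m n) F) {v})}) \<longlonglongrightarrow> 0"
proof -
  define w where "w n = max (\<omega> n) (- ln (ln (real n)))" for n
  have neg: "\<forall>\<^sub>F n in sequentially. \<omega> n \<le> Z" for Z using \<omega> by (simp add: filterlim_at_bot)
  have wb: "filterlim w at_bot sequentially"
  proof -
    have "\<forall>\<^sub>F n in sequentially. w n \<le> Z" for Z
    proof -
      have "filterlim (\<lambda>n::nat. - ln (ln (real n))) at_bot sequentially" by real_asymp
      then have "\<forall>\<^sub>F n::nat in sequentially. - ln (ln (real n)) \<le> Z" by (simp add: filterlim_at_bot)
      then show ?thesis using neg[of Z] by eventually_elim (simp add: w_def)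
    qed
    then show ?thesis by (simp add: filterlim_at_bot)
  qed
  interpret W: threshold_window k \<alpha> m w
  proof
    have "\<forall>\<^sub>F n::nat in sequentially. 0 \<le> ln (ln (real n))" by real_asymp
    then show "\<forall>\<^sub>F n in sequentially. \<bar>w n\<bar> \<le> ln (ln (real n))" using neg[of 0]
      by eventually_elim (auto simp: w_def)
  qed (use k \<alpha> m in auto)
  interpret S: subcritical k m W.q "\<lambda>n. real (m n) * real n * (W.q n)\<^sup>2" w
    by (rule W.subcritical[OF wb])
  show ?thesis
  proof (rule tendsto_sandwich[OF _ _ tendsto_const S.prob_min_degree_tendsto])
    show "\<forall>\<^sub>F n in sequentially. feature_prob n (m n) (threshold_prob m \<omega> k n)
        {F. \<forall>v<n. k \<le> card (nbrs {..<n} (adj (m n) F) {v})} \<le>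
       feature_prob n (m n) (W.q n) {F. \<forall>v<n. k \<le> card (nbrs {..<n} (adj (m n) F) {v})}"
      using p W.ev_basic
    proof eventually_elim
      case (elim n)
      show ?case
      proof (rule prob_features_mono)
        fix F F' :: "nat \<Rightarrow> nat set"
        assume F: "\<And>w. F w \<subseteq> F' w" "\<forall>v<n. k \<le> card (nbrs {..<n} (adj (m n) F) {v})"
        have "card (nbrs {..<n} (adj (m n) F) S) \<le> card (nbrs {..<n} (adj (m n) F') S)" for S
          by (intro card_mono finite_nbrs nbrs_mono adj_mono[OF _ F(1)]) auto
        with F(2) show "\<forall>v<n. k \<le> card (nbrs {..<n} (adj (m n) F') {v})" by (meson order_trans)
      qed (use elim in \<open>auto intro!: threshold_prob_mono simp: w_def\<close>)
    qed
  qed simp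
qed

text \<open>Dually, \<open>\<omega>\<close> is lowered to at most \<open>ln (ln n)\<close>, which
  keeps \<open>L\<close> logarithmic however fast \<open>\<omega>\<close> grows. The property
  \<open>P\<close> is abstract because the reduction serves both \<open>cut_free\<close> and
  \<open>hamiltonian\<close>.\<close>

lemma prob_increasing_above_threshold:
  fixes k :: nat and \<alpha> :: real and m :: "nat \<Rightarrow> nat" and \<omega> :: "nat \<Rightarrow> real"
    and P :: "nat \<Rightarrow> (nat \<Rightarrow> nat \<Rightarrow> bool) \<Rightarrow> bool"
  assumes k: "k \<ge> 1" and \<alpha>: "\<alpha> > 1" and m: "\<And>n. \<bar>real (m n) - real n powr \<alpha>\<bar> < 1"
    and p: "\<forall>\<^sub>F n in sequentially. threshold_prob m \<omega> k n \<in> {0..1}"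
    and \<omega>: "filterlim \<omega> at_top sequentially"
    and mono: "\<And>n E E'. (\<And>u v. E u v \<Longrightarrow> E' u v) \<Longrightarrow> P n E \<Longrightarrow> P n E'"
    and lim: "\<And>w. threshold_window k \<alpha> m w \<Longrightarrow> filterlim w at_top sequentially \<Longrightarrow>
      (\<lambda>n. feature_prob n (m n) (threshold_prob m w k n) {F. P n (adj (m n) F)}) \<longlonglongrightarrow> 1"
  shows "(\<lambda>n. feature_prob n (m n) (threshold_prob m \<omega> k n) {F. P n (adj (m n) F)}) \<longlonglongrightarrow> 1"
proof -
  define w where "w n = min (\<omega> n) (ln (ln (real n)))" for n
  have pos: "\<forall>\<^sub>F n in sequentially. Z \<le> \<omega> n" for Z using \<omega> by (simp add: filterlim_at_top)
  have wt: "filterlim w at_top sequentially"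
  proof -
    have "\<forall>\<^sub>F n in sequentially. Z \<le> w n" for Z
    proof -
      have "filterlim (\<lambda>n::nat. ln (ln (real n))) at_top sequentially" by real_asymp
      then have "\<forall>\<^sub>F n::nat in sequentially. Z \<le> ln (ln (real n))" by (simp add: filterlim_at_top)
      then show ?thesis using pos[of Z] by eventually_elim (simp add: w_def)
    qed
    then show ?thesis by (simp add: filterlim_at_top)
  qed
  interpret W: threshold_window k \<alpha> m w
  proof
    have "\<forall>\<^sub>F n::nat in sequentially. 0 \<le> ln (ln (real n))" by real_asymp
    then show "\<forall>\<^sub>F n in sequentially. \<bar>w n\<bar> \<le> ln (ln (real n))" using pos[of 0]
      by eventually_elim (auto simp: w_def)
  qed (use k \<alpha> m in auto)
  show ?thesis
  proof (rule tendsto_sandwich[OF _ _ lim[OF W.threshold_window_axioms wt] tendsto_const])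
    show "\<forall>\<^sub>F n in sequentially. feature_prob n (m n) (W.q n) {F. P n (adj (m n) F)} \<le>
       feature_prob n (m n) (threshold_prob m \<omega> k n) {F. P n (adj (m n) F)}"
      using p W.ev_basic
    proof eventually_elim
      case (elim n)
      show ?case
      proof (rule prob_features_mono)
        fix F F' :: "nat \<Rightarrow> nat set"
        assume F: "\<And>w. F w \<subseteq> F' w" "P n (adj (m n) F)"
        show "P n (adj (m n) F')" by (rule mono[OF _ F(2)]) (erule adj_mono[OF _ F(1)])
      qed (use elim in \<open>auto intro!: threshold_prob_mono simp: w_def\<close>)
    qed
  qed simp
qed

lemma prob_tendsto_1_subset:
  assumes "(\<lambda>n. measure_pmf.prob (M n) {x. P n x}) \<longlonglongrightarrow> 1"
    and "\<forall>\<^sub>F n in sequentially. \<forall>x. P n x \<longrightarrow> Q n x"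
  shows "(\<lambda>n. measure_pmf.prob (M n) {x. Q n x}) \<longlonglongrightarrow> 1"
proof (rule tendsto_sandwich[OF _ _ assms(1) tendsto_const])
  show "\<forall>\<^sub>F n in sequentially. measure_pmf.prob (M n) {x. P n x} \<le> measure_pmf.prob (M n) {x. Q n x}"
    using assms(2) by eventually_elim (intro measure_pmf.finite_measure_mono, auto)
qed simp

theorem theorem7:
  fixes k :: nat and \<alpha> :: real and m :: "nat \<Rightarrow> nat" and \<omega> :: "nat \<Rightarrow> real"
  assumes "k \<ge> 1" and "\<alpha> > 1"
    and "\<And>n. \<bar>real (m n) - real n powr \<alpha>\<bar> < 1"
  shows
    "((\<forall>\<^sub>F n in sequentially. threshold_prob m \<omega> k n \<in> {0..1}) \<longrightarrow>
        filterlim \<omega> at_bot sequentially \<longrightarrow>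
        (\<lambda>n. measure_pmf.prob (random_intersection_graph n (m n) (threshold_prob m \<omega> k n))
               {G. \<not> k_connected k (with_proj G)}) \<longlonglongrightarrow> 1) \<and>
     ((\<forall>\<^sub>F n in sequentially. threshold_prob m \<omega> k n \<in> {0..1}) \<longrightarrow>
        filterlim \<omega> at_top sequentially \<longrightarrow>
        (\<lambda>n. measure_pmf.prob (random_intersection_graph n (m n) (threshold_prob m \<omega> k n))
               {G. k_connected k (with_proj G)}) \<longlonglongrightarrow> 1) \<and>
     ((\<forall>\<^sub>F n in sequentially. threshold_prob m \<omega> 2 n \<in> {0..1}) \<longrightarrow>
        filterlim \<omega> at_bot sequentially \<longrightarrow>
        (\<lambda>n. measure_pmf.prob (random_intersection_graph n (m n) (threshold_prob m \<omega> 2 n))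
               {G. \<not> has_hamilton_cycle (with_proj G)}) \<longlonglongrightarrow> 1) \<and>
     ((\<forall>\<^sub>F n in sequentially. threshold_prob m \<omega> 2 n \<in> {0..1}) \<longrightarrow>
        filterlim \<omega> at_top sequentially \<longrightarrow>
        (\<lambda>n. measure_pmf.prob (random_intersection_graph n (m n) (threshold_prob m \<omega> 2 n))
               {G. has_hamilton_cycle (with_proj G)}) \<longlonglongrightarrow> 1)"
proof (intro conjI impI)
  assume p: "\<forall>\<^sub>F n in sequentially. threshold_prob m \<omega> k n \<in> {0..1}"
    and \<omega>: "filterlim \<omega> at_bot sequentially"
  show "(\<lambda>n. measure_pmf.prob (random_intersection_graph n (m n) (threshold_prob m \<omega> k n))
               {G. \<not> k_connected k (with_proj G)}) \<longlonglongrightarrow> 1"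
  proof (rule prob_not_tendsto_1[OF _ prob_min_degree_below_threshold[OF assms p \<omega>]])
    show "\<forall>\<^sub>F n in sequentially. measure_pmf.prob (random_intersection_graph n (m n) (threshold_prob m \<omega> k n))
        {G. k_connected k (with_proj G)} \<le> feature_prob n (m n) (threshold_prob m \<omega> k n)
        {F. \<forall>v<n. k \<le> card (nbrs {..<n} (adj (m n) F) {v})}"
      unfolding prob_random_intersection_graph[of _ _ _ "k_connected k"]
      by (intro always_eventually allI measure_pmf.finite_measure_mono) (auto dest: k_connected_imp_degree)
  qed
next
  assume p: "\<forall>\<^sub>F n in sequentially. threshold_prob m \<omega> k n \<in> {0..1}"
    and \<omega>: "filterlim \<omega> at_top sequentially"
  have "(\<lambda>n. feature_prob n (m n) (threshold_prob m \<omega> k n)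
      {F. cut_free {..<n} (adj (m n) F) k}) \<longlonglongrightarrow> 1"
  proof (rule prob_increasing_above_threshold[OF assms p \<omega>])
    show "cut_free {..<n} E k \<Longrightarrow> cut_free {..<n} E' k" if "\<And>u v. E u v \<Longrightarrow> E' u v" for n :: nat and E E'
      by (rule cut_free_mono[OF _ that]) auto
    fix w assume W: "threshold_window k \<alpha> m w" "filterlim w at_top sequentially"
    interpret S: supercritical k m "threshold_prob m w k"
      "\<lambda>n. real (m n) * real n * (threshold_prob m w k n)\<^sup>2" w "real k + 1"
      by (rule threshold_window.supercritical[OF W])
    have "(\<lambda>n. feature_prob n (m n) (threshold_prob m w k n)
      {F. \<not> \<not> cut_free {..<n} (adj (m n) F) k}) \<longlonglongrightarrow> 1"
      by (rule prob_not_tendsto_1[OF _ S.prob_not_cut_free_tendsto]) simp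
    then show "(\<lambda>n. feature_prob n (m n) (threshold_prob m w k n)
      {F. cut_free {..<n} (adj (m n) F) k}) \<longlonglongrightarrow> 1" by simp
  qed
  then show "(\<lambda>n. measure_pmf.prob (random_intersection_graph n (m n) (threshold_prob m \<omega> k n))
               {G. k_connected k (with_proj G)}) \<longlonglongrightarrow> 1"
    unfolding prob_random_intersection_graph[of _ _ _ "k_connected k"]
  proof (rule prob_tendsto_1_subset)
    show "\<forall>\<^sub>F n in sequentially. \<forall>F. cut_free {..<n} (adj (m n) F) k \<longrightarrow>
        k_connected k (with_proj (feature_graph n (m n) F))"
      using eventually_gt_at_top[of k] by eventually_elim (auto intro: cut_free_imp_k_connected)
  qed
next
  assume p: "\<forall>\<^sub>F n in sequentially. threshold_prob m \<omega> 2 n \<in> {0..1}"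
    and \<omega>: "filterlim \<omega> at_bot sequentially"
  show "(\<lambda>n. measure_pmf.prob (random_intersection_graph n (m n) (threshold_prob m \<omega> 2 n))
               {G. \<not> has_hamilton_cycle (with_proj G)}) \<longlonglongrightarrow> 1"
  \<comment> \<open>A Hamilton cycle forces minimum degree 2, so the obstruction is the one for
    \<open>k = 2\<close>.\<close>
  proof (rule prob_not_tendsto_1[OF _ prob_min_degree_below_threshold[OF _ assms(2,3) p \<omega>]])
    show "\<forall>\<^sub>F n in sequentially. measure_pmf.prob (random_intersection_graph n (m n) (threshold_prob m \<omega> 2 n))
        {G. has_hamilton_cycle (with_proj G)} \<le> feature_prob n (m n) (threshold_prob m \<omega> 2 n)
        {F. \<forall>v<n. 2 \<le> card (nbrs {..<n} (adj (m n) F) {v})}"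
      unfolding prob_random_intersection_graph[of _ _ _ has_hamilton_cycle]
      by (intro always_eventually allI measure_pmf.finite_measure_mono) (auto dest: has_hamilton_cycle_imp_degree)
  qed simp
next
  assume p: "\<forall>\<^sub>F n in sequentially. threshold_prob m \<omega> 2 n \<in> {0..1}"
    and \<omega>: "filterlim \<omega> at_top sequentially"
  have "(\<lambda>n. feature_prob n (m n) (threshold_prob m \<omega> 2 n)
      {F. hamiltonian {..<n} (adj (m n) F)}) \<longlonglongrightarrow> 1"
  proof (rule prob_increasing_above_threshold[OF _ assms(2,3) p \<omega>])
    show "hamiltonian {..<n} E \<Longrightarrow> hamiltonian {..<n} E'" if "\<And>u v. E u v \<Longrightarrow> E' u v" for n :: nat and E E'
      using that by (rule hamiltonian_mono[rotated])
    fix w assume W: "threshold_window 2 \<alpha> m w" "filterlim w at_top sequentially"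
    show "(\<lambda>n. feature_prob n (m n) (threshold_prob m w 2 n)
      {F. hamiltonian {..<n} (adj (m n) F)}) \<longlonglongrightarrow> 1"
      by (rule threshold_window.prob_hamiltonian_tendsto[OF W(1) refl W(2)])
  qed simp
  then show "(\<lambda>n. measure_pmf.prob (random_intersection_graph n (m n) (threshold_prob m \<omega> 2 n))
               {G. has_hamilton_cycle (with_proj G)}) \<longlonglongrightarrow> 1"
    unfolding prob_random_intersection_graph[of _ _ _ has_hamilton_cycle]
  proof (rule prob_tendsto_1_subset)
    show "\<forall>\<^sub>F n in sequentially. \<forall>F. hamiltonian {..<n} (adj (m n) F) \<longrightarrow>
        has_hamilton_cycle (with_proj (feature_graph n (m n) F))"
      by (simp add: hamiltonian_imp_has_hamilton_cycle)
  qed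
qed

end
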